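(* Let $\varepsilon>0$ and let $n,m\ge1$ with $nm=2$. Let $f$ and $g(r):=r^{-m(n-1)}f(r)$ be dimension functions such that $r\mapsto r^{-nm}f(r)$ is monotonic. Then for every $\psi:\mathbb{N}\to\mathbb{R}_{\geq0}$ and every $\mathbf{y}\in[0,1]^m$, \[ \mathcal{H}^f(\mathcal{A}^{\mathbf{y}}_{n,m}(\psi))=\mathcal{H}^f([0,1]^{nm})\quad\text{if}\quad\sum_{q=1}^\infty\Bigl(\frac{\varphi(q)}{q}\Bigr)^{1+\varepsilon}q^{n+m-1}g\Bigl(\frac{\psi(q)}{q}\Bigr)=\infty. \]
   Context: $\varphi$ is Euler's totient function. A dimension function is a continuous non-decreasing $f:\mathbb{R}_{>0}\to\mathbb{R}_{>0}$ with $f(r)\to0$ as $r\to0$; $\mathcal{H}^f$ is the Hausdorff $f$-measure ($\mathcal{H}^f(F)=\lim_{\rho\to0}\inf\sum_i f(r_i)$ over covers of $F$ by balls $B(x_i,r_i)$ with $r_i<\rho$). For $\mathbf{q}\in\mathbb{Z}^n$, $|\mathbf{q}|=\max_i|q_i|$; $\mathbf{x}\in[0,1]^{nm}$ is an $n\times m$ matrix and $\mathbf{q}\mathbf{x}$ the row-vector–matrix product. $\mathcal{A}^{\mathbf{y}}_{n,m}(\psi)$ is the set of $\mathbf{x}\in[0,1]^{nm}$ such that for infinitely many $(\mathbf{p},\mathbf{q})\in\mathbb{Z}^m\times(\mathbb{Z}^n\setminus\{\mathbf0\})$, $\mathbf{q}\mathbf{x}+\mathbf{p}$ lies in the max-norm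 ball in $\mathbb{R}^m/\mathbb{Z}^m$ of centre $\mathbf{y}$ and radius $\psi(|\mathbf{q}|)$. *)

theory Defs
  imports "HOL-Analysis.Analysis" "HOL-Number_Theory.Number_Theory"
begin

definition dimension_function :: "(real \<Rightarrow> real) \<Rightarrow> bool" where
  "dimension_function f \<longleftrightarrow>
     continuous_on {0<..} f \<and> mono_on {0<..} f \<and> (\<forall>r>0. f r > 0) \<and> (f \<longlongrightarrow> 0) (at_right 0)"

definition maxdist :: "real^'m^'n \<Rightarrow> real^'m^'n \<Rightarrow> real" where
  "maxdist x y = Max (range (\<lambda>(i,j). \<bar>x$i$j - y$i$j\<bar>))"

text \<open>Hausdorff f-measure w.r.t. a distance d, using countable covers by (open) balls
  of radius < rho; radius 0 (empty ball) contributes 0, allowing finite covers.\<close>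
definition hausdorff_fm :: "('a \<Rightarrow> 'a \<Rightarrow> real) \<Rightarrow> (real \<Rightarrow> real) \<Rightarrow> 'a set \<Rightarrow> ennreal" where
  "hausdorff_fm d f F =
     (SUP \<rho>\<in>{0<..}. INF cr \<in> {(c :: nat \<Rightarrow> 'a, r :: nat \<Rightarrow> real).
         (\<forall>i. 0 \<le> r i \<and> r i < \<rho>) \<and> F \<subseteq> (\<Union>i. {z. d (c i) z < r i})}.
       (\<Sum>i. ennreal (if snd cr i > 0 then f (snd cr i) else 0)))"

definition qnorm :: "int^'n \<Rightarrow> nat" where
  "qnorm q = nat (Max (range (\<lambda>i. \<bar>q$i\<bar>)))"

definition rowmul :: "int^'n \<Rightarrow> real^'m^'n \<Rightarrow> real^'m" where
  "rowmul q x = (\<chi> j. \<Sum>i\<in>UNIV. of_int (q$i) * x$i$j)"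

definition unit_cube :: "(real^'m^'n) set" where
  "unit_cube = {x. \<forall>i j. 0 \<le> x$i$j \<and> x$i$j \<le> 1}"

definition A_set :: "(nat \<Rightarrow> real) \<Rightarrow> real^'m \<Rightarrow> (real^'m^'n) set" where
  "A_set \<psi> y = {x \<in> unit_cube.
     infinite {(p :: int^'m, q :: int^'n). q \<noteq> 0 \<and>
        (\<forall>j. \<bar>rowmul q x $ j + of_int (p$j) - y$j\<bar> < \<psi> (qnorm q))}}"

end

(* Since (\<phi>(q)/q)^(1+\<epsilon>) \<le> \<phi>(q)/q, the series with the weights \<phi>(q)/q diverges too.

   Full Lebesgue measure. For (n,m) = (2,1) only the vectors (k,j) with j \<le> k coprime to k are used: two different
   ones are linearly independent, so the corresponding subsets of the torus are exactly pairwise independent, and there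
   are \<phi>(k) of them with norm k. For (n,m) = (1,2) the sets A_q are given the weights w_q = \<phi>(q)/q. The overlap of
   A_q and A_r involves an error (gcd(q,r) \<psi>(r)/r)^2, and \<Sum>{q \<le> r} w_q gcd(q,r)^2/r^2 \<le> 1, so the weighted
   sums have second moment O(S^2), where S is their integral. Since the normalised sums are bounded in L^2
   and converge weakly to something bounded below, while they tend to 0 on any set avoiding all but finitely many A_q,
   such a set is null: no zero-one law and no local independence estimate are needed.

   Hausdorff measure. If f(r)/r^2 is bounded near 0, null sets have measure zero and the full measure statement
   suffices. Otherwise f(r)/r^2 tends to infinity, and the full measure statement applied to the enlarged
   neighbourhoods is converted into infinite measure: starting from M times the Lebesgue measure of the square, the mass
   is repeatedly concentrated, by means of the Vitali covering theorem, on small pieces of the neighbourhoods.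
   Balls of radius at most some s0 always carry mass at most 2 f(radius), and the bound survives the infinitely many
   steps because at each of them the previous density is bounded whereas f(s)/s^2 is as large as desired. *)
theory Submission
  imports Defs
begin

section \<open>Hausdorff measures\<close>

text \<open>The two halves fit together through a matching of series. For f(r) = r^2 the divergence
  condition with weights \<phi>(q)/q reads \<Sum> \<phi>(q) \<psi>(q)^2 / q = \<infinity> when (n,m)
  = (1,2) and \<Sum> \<phi>(q) \<psi>(q) = \<infinity> when (n,m) = (2,1). Up to a constant, this is
  the integral of the (weighted) counting function in the full measure statement. For general f the
  enlarged radius \<psi>' is defined by letting (\<psi>'(q)/q)^m be a constant multiple of
  g(\<psi>(q)/q), so its series for r^2 is the given one up to that constant. Divergence does not
  see the constant, so it may be as small as desired. This freedom is essential: the density reached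
  after finitely many redistributions of mass is finite but uncontrolled, and a small constant is
  what compensates for it in the next one.\<close>

lemma hausdorff_fm_mono: "A \<subseteq> B \<Longrightarrow> hausdorff_fm d f A \<le> hausdorff_fm d f B"
  unfolding hausdorff_fm_def by (intro SUP_mono' INF_superset_mono) auto

text \<open>At a fixed scale two nearly optimal covers, each within e/2 of the infimum, are
  interleaved into one sequence, the first on even and the second on odd indices.\<close>

lemma hausdorff_fm_subadditive:
  shows "hausdorff_fm d f (A \<union> B) \<le> hausdorff_fm d f A + hausdorff_fm d f (B :: 'a set)"
proof -
  define cont where "cont \<rho> F = (INF cr \<in> {(c :: nat \<Rightarrow> 'a, r :: nat \<Rightarrow> real).
         (\<forall>i. 0 \<le> r i \<and> r i < \<rho>) \<and> F \<subseteq> (\<Union>i. {z. d (c i) z < r i})}.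
       (\<Sum>i. ennreal (if snd cr i > 0 then f (snd cr i) else 0)))" for \<rho> F
  have H: "hausdorff_fm d f F = (SUP \<rho>\<in>{0<..}. cont \<rho> F)" for F
    unfolding hausdorff_fm_def cont_def ..
  have "cont \<rho> (A \<union> B) \<le> cont \<rho> A + cont \<rho> B" for \<rho>
  proof (rule ennreal_le_epsilon)
    fix e :: real assume fin: "cont \<rho> A + cont \<rho> B < top_class.top" and e: "0 < e"
    have e2: "ennreal (e / 2) > 0" using e by simp
    have "\<exists>c r. (\<forall>i::nat. 0 \<le> r i \<and> r i < \<rho>) \<and> F \<subseteq> (\<Union>i. {z. d (c i) z < r i}) \<and>
       (\<Sum>i. ennreal (if r i > 0 then f (r i) else 0)) < cont \<rho> F + ennreal (e / 2)"
      if "cont \<rho> F < \<infinity>" for F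
    proof -
      have "cont \<rho> F < cont \<rho> F + ennreal (e / 2)" using that e by (cases "cont \<rho> F") (auto simp: ennreal_plus[symmetric] ennreal_less_iff simp del: ennreal_plus)
      then obtain cr where "cr \<in> {(c :: nat \<Rightarrow> 'a, r :: nat \<Rightarrow> real).
         (\<forall>i. 0 \<le> r i \<and> r i < \<rho>) \<and> F \<subseteq> (\<Union>i. {z. d (c i) z < r i})}"
        "(\<Sum>i. ennreal (if snd cr i > 0 then f (snd cr i) else 0)) < cont \<rho> F + ennreal (e / 2)"
        unfolding cont_def INF_less_iff by blast
      then show ?thesis by (intro exI[of _ "fst cr"] exI[of _ "snd cr"]) (auto simp: case_prod_beta)
    qed
    note ex = this
    have "cont \<rho> A < \<infinity>" "cont \<rho> B < \<infinity>" using fin by (auto simp: less_top)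
    from ex[OF this(1)] ex[OF this(2)] obtain c1 r1 c2 r2 where
      1: "\<forall>i::nat. 0 \<le> r1 i \<and> r1 i < \<rho>" "A \<subseteq> (\<Union>i. {z. d (c1 i) z < r1 i})"
       "(\<Sum>i. ennreal (if r1 i > 0 then f (r1 i) else 0)) < cont \<rho> A + ennreal (e / 2)"
      and 2: "\<forall>i::nat. 0 \<le> r2 i \<and> r2 i < \<rho>" "B \<subseteq> (\<Union>i. {z. d (c2 i) z < r2 i})"
       "(\<Sum>i. ennreal (if r2 i > 0 then f (r2 i) else 0)) < cont \<rho> B + ennreal (e / 2)"
      by blast
    define c where "c i = (if even i then c1 (i div 2) else c2 (i div 2))" for i :: nat
    define r where "r i = (if even i then r1 (i div 2) else r2 (i div 2))" for i :: nat
    define t where "t i = ennreal (if r i > 0 then f (r i) else 0)" for i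
    have te: "t (2 * i) = ennreal (if r1 i > 0 then f (r1 i) else 0)" for i unfolding t_def r_def by simp
    have to: "t (2 * i + 1) = ennreal (if r2 i > 0 then f (r2 i) else 0)" for i unfolding t_def r_def by simp
    have "cont \<rho> (A \<union> B) \<le> (\<Sum>i. t i)"
    proof -
      have "A \<union> B \<subseteq> (\<Union>i. {z. d (c i) z < r i})"
      proof
        fix z assume "z \<in> A \<union> B"
        then consider i where "d (c1 i) z < r1 i" | i where "d (c2 i) z < r2 i" using 1(2) 2(2) by blast
        then show "z \<in> (\<Union>i. {z. d (c i) z < r i})"
        proof cases
          case 1 then have "d (c (2 * i)) z < r (2 * i)" unfolding c_def r_def by simp
          then show ?thesis by blast
        next
          case 2 then have "d (c (2 * i + 1)) z < r (2 * i + 1)" unfolding c_def r_def by simp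
          then show ?thesis by blast
        qed
      qed
      moreover have "\<forall>i. 0 \<le> r i \<and> r i < \<rho>" unfolding r_def using 1(1) 2(1) by simp
      ultimately show ?thesis unfolding cont_def t_def
        by (intro INF_lower2[of "(c, r)"]) (blast, simp only: snd_conv order_refl)
    qed
    also have "(\<Sum>i. t i) = (\<Sum>i. t (2 * i)) + (\<Sum>i. t (2 * i + 1))"
    proof -
      have "(\<Sum>i. t i) = (\<integral>\<^sup>+i. t i \<partial>count_space UNIV)" by (simp add: nn_integral_count_space_nat)
      also have "\<dots> = (\<Sum>i. \<Sum>j\<in>{..<2}. t (2 * i + j))"
      proof -
        have "(\<lambda>i. \<Sum>j\<in>{i * 2..<i * 2 + 2}. t j) sums (\<Sum>i. t i)"
          by (rule sums_group) (auto intro!: summable_sums)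
        then have "(\<Sum>i. t i) = (\<Sum>i. \<Sum>j\<in>{i * 2..<i * 2 + 2}. t j)" by (simp add: sums_unique)
        moreover have "(\<Sum>j\<in>{i * 2..<i * 2 + 2}. t j) = (\<Sum>j\<in>{..<2}. t (2 * i + j))" for i
          by (simp add: numeral_2_eq_2 mult.commute)
        ultimately show ?thesis by (simp add: nn_integral_count_space_nat)
      qed
      also have "\<dots> = (\<Sum>i. t (2 * i) + t (2 * i + 1))" by (simp add: numeral_2_eq_2)
      also have "\<dots> = (\<Sum>i. t (2 * i)) + (\<Sum>i. t (2 * i + 1))" by (intro suminf_add[symmetric]) auto
      finally show ?thesis .
    qed
    also have "\<dots> \<le> (cont \<rho> A + ennreal (e / 2)) + (cont \<rho> B + ennreal (e / 2))"
      unfolding te to using 1(3) 2(3) by (intro add_mono) auto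
    also have "\<dots> = cont \<rho> A + cont \<rho> B + ennreal e"
    proof -
      have "ennreal e = ennreal (e / 2) + ennreal (e / 2)" using e by (subst ennreal_plus[symmetric]) auto
      then show ?thesis by (simp add: ac_simps)
    qed
    finally show "cont \<rho> (A \<union> B) \<le> cont \<rho> A + cont \<rho> B + ennreal e" .
  qed
  then have "cont \<rho> (A \<union> B) \<le> hausdorff_fm d f A + hausdorff_fm d f B" if "\<rho> > 0" for \<rho>
    unfolding H using that by (meson SUP_upper add_mono greaterThan_iff order_trans)
  then show ?thesis unfolding H[of "A \<union> B"] by (intro SUP_least) auto
qed

text \<open>The centres in a cover are arbitrary points of the space, not points of
  \<open>F\<close>, so pulling a cover back needs a preimage of every centre. Surjectivity provides
  it.\<close>

lemma hausdorff_fm_bij: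
  fixes \<Phi> :: "'a \<Rightarrow> 'b"
  assumes "bij \<Phi>" and iso: "\<And>x y. d (\<Phi> x) (\<Phi> y) = d' x y"
  shows "hausdorff_fm d f (\<Phi> ` F) = hausdorff_fm d' f F"
proof -
  let ?S = "\<lambda>r. (\<Sum>i. ennreal (if r i > 0 then f (r i) else 0))"
  have "(INF cr \<in> {(c :: nat \<Rightarrow> 'b, r :: nat \<Rightarrow> real).
         (\<forall>i. 0 \<le> r i \<and> r i < \<rho>) \<and> \<Phi> ` F \<subseteq> (\<Union>i. {z. d (c i) z < r i})}. ?S (snd cr))
     = (INF cr \<in> {(c :: nat \<Rightarrow> 'a, r :: nat \<Rightarrow> real).
         (\<forall>i. 0 \<le> r i \<and> r i < \<rho>) \<and> F \<subseteq> (\<Union>i. {z. d' (c i) z < r i})}. ?S (snd cr))"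
    (is "(INF cr \<in> ?A. _) = (INF cr \<in> ?B. _)") for \<rho>
  proof (rule antisym)
    show "(INF cr \<in> ?A. ?S (snd cr)) \<le> (INF cr \<in> ?B. ?S (snd cr))"
    proof (rule INF_mono)
      fix cr assume "cr \<in> ?B"
      then obtain c r where cr: "cr = (c, r)" "\<forall>i. 0 \<le> r i \<and> r i < \<rho>" "F \<subseteq> (\<Union>i. {z. d' (c i) z < r i})"
        by blast
      have "\<Phi> ` F \<subseteq> (\<Union>i. {z. d ((\<Phi> \<circ> c) i) z < r i})"
      proof (rule image_subsetI)
        fix x assume "x \<in> F"
        then obtain i where "d' (c i) x < r i" using cr(3) by blast
        then show "\<Phi> x \<in> (\<Union>i. {z. d ((\<Phi> \<circ> c) i) z < r i})" by (auto simp: iso)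
      qed
      then have "(\<Phi> \<circ> c, r) \<in> ?A" using cr(2) by blast
      then show "\<exists>cr'\<in>?A. ?S (snd cr') \<le> ?S (snd cr)" unfolding cr(1)
        by (rule bexI[rotated]) (simp only: snd_conv order_refl)
    qed
    show "(INF cr \<in> ?B. ?S (snd cr)) \<le> (INF cr \<in> ?A. ?S (snd cr))"
    proof (rule INF_mono)
      fix cr assume "cr \<in> ?A"
      then obtain c r where cr: "cr = (c, r)" "\<forall>i. 0 \<le> r i \<and> r i < \<rho>" "\<Phi> ` F \<subseteq> (\<Union>i. {z. d (c i) z < r i})"
        by blast
      have inv: "d' (inv_into UNIV \<Phi> a) z = d a (\<Phi> z)" for a z
        using iso[of "inv_into UNIV \<Phi> a" z] surj_f_inv_f[OF bij_is_surj[OF assms(1)]] by simp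
      have "F \<subseteq> (\<Union>i. {z. d' ((inv_into UNIV \<Phi> \<circ> c) i) z < r i})"
        using cr(3) by (auto simp: inv image_subset_iff)
      then have "(inv_into UNIV \<Phi> \<circ> c, r) \<in> ?B" using cr(2) by blast
      then show "\<exists>cr'\<in>?B. ?S (snd cr') \<le> ?S (snd cr)" unfolding cr(1)
        by (rule bexI[rotated]) (simp only: snd_conv order_refl)
    qed
  qed
  then show ?thesis unfolding hausdorff_fm_def by simp
qed

section \<open>Null sets of the plane in the max norm\<close>

definition plane_dist :: "real \<times> real \<Rightarrow> real \<times> real \<Rightarrow> real" where
  "plane_dist x y = max \<bar>fst x - fst y\<bar> \<bar>snd x - snd y\<bar>"

lemma plane_dist_ball_subset: "r \<ge> 0 \<Longrightarrow> {z. plane_dist c z < r} \<subseteq> ball c (2 * r)"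
proof
  fix z assume r: "r \<ge> 0" "z \<in> {z. plane_dist c z < r}"
  have "dist c z \<le> dist (fst c) (fst z) + dist (snd c) (snd z)"
    unfolding dist_prod_def by (rule sqrt_sum_squares_le_sum) auto
  also have "\<dots> < 2 * r" using r by (simp add: plane_dist_def dist_real_def)
  finally show "z \<in> ball c (2 * r)" by simp
qed

text \<open>Where f(r) is at most a multiple of r^2, a square costs at most a multiple of its area.
  So \<open>N\<close> is covered by non-overlapping dyadic squares inside an open set of tiny area,
  and the squares are enclosed in balls of the max norm.\<close>

lemma hausdorff_fm_null_set:
  fixes f :: "real \<Rightarrow> real"
  assumes f: "\<And>r. 0 < r \<Longrightarrow> r \<le> 1 \<Longrightarrow> f r \<le> C * r\<^sup>2"
    and N: "negligible N" "N \<subseteq> cbox (0, 0) (1, 1)"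
  shows "hausdorff_fm plane_dist f N = 0"
proof -
  have C': "f r \<le> (\<bar>C\<bar> + 1) * r\<^sup>2" if "0 < r" "r \<le> 1" for r
    using f[OF that] by (smt (verit) mult_right_mono zero_le_power2)
  define C1 where "C1 = \<bar>C\<bar> + 1"
  have C1: "C1 > 0" unfolding C1_def by simp
  have "(INF cr \<in> {(c :: nat \<Rightarrow> real \<times> real, r :: nat \<Rightarrow> real).
         (\<forall>i. 0 \<le> r i \<and> r i < \<rho>) \<and> N \<subseteq> (\<Union>i. {z. plane_dist (c i) z < r i})}.
       (\<Sum>i. ennreal (if snd cr i > 0 then f (snd cr i) else 0))) = 0" (is "?I = 0") if \<rho>: "\<rho> > 0" for \<rho>
  proof -
    have le: "?I \<le> 0 + ennreal e" if e: "e > 0" for e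
    proof -
      have "N \<in> sets lebesgue" using N(1) by (simp add: negligible_iff_null_sets null_setsD2)
      from sets_lebesgue_outer_open[OF this, of "e / (4 * C1)"] e C1 obtain T where
        T: "open T" "N \<subseteq> T" "T - N \<in> lmeasurable" "emeasure lebesgue (T - N) < ennreal (e / (4 * C1))" by auto
      have Tm: "emeasure lborel T < ennreal (e / (4 * C1))"
      proof -
        have Ns: "N \<in> null_sets lebesgue" using N(1) by (simp add: negligible_iff_null_sets)
        have Ts: "T \<in> sets lebesgue" using T(1) by simp
        have "emeasure lebesgue (T - N) = emeasure lebesgue T" by (rule emeasure_Diff_null_set[OF Ns Ts])
        then show ?thesis using T(1,4) by simp
      qed
      \<comment> \<open>Sides below \<open>\<sigma>\<close> are admissible at scale
        \<open>\<rho>\<close> and lie in the range r \<le> 1 where the bound on \<open>f\<close> is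
        given.\<close>
      define \<sigma> where "\<sigma> = min (\<rho> / 2) (1 / 2)"
      have \<sigma>: "\<sigma> > 0" using \<rho> unfolding \<sigma>_def by simp
      \<comment> \<open>The covering squares are tagged by points of \<open>N\<close>, which lie in
        \<open>T\<close>, so only the first branch matters. The ball of radius 1 makes
        \<open>g\<close> a gauge elsewhere.\<close>
      define g where "g x = (if x \<in> T then T \<inter> ball x (\<sigma> / 2) else ball x 1)" for x
      have "gauge g" unfolding gauge_def g_def using T(1) \<sigma> by auto
      from covering_lemma[OF N(2) _ this] obtain \<D> where D: "countable \<D>" "\<Union>\<D> \<subseteq> cbox (0,0) (1,1)"
        "\<And>K. K \<in> \<D> \<Longrightarrow> interior K \<noteq> {} \<and> (\<exists>c d. K = cbox c d)"
        "pairwise (\<lambda>A B. interior A \<inter> interior B = {}) \<D>"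
        "\<And>K. K \<in> \<D> \<Longrightarrow> \<exists>x \<in> N \<inter> K. K \<subseteq> g x"
        "\<And>u v. cbox u v \<in> \<D> \<Longrightarrow> \<exists>n. \<forall>i \<in> Basis. v \<bullet> i - u \<bullet> i = ((1::real,1::real) \<bullet> i - (0,0) \<bullet> i) / 2^n"
        "N \<subseteq> \<Union>\<D>" by (auto simp: box_eq_empty Basis_prod_def)
      have sq: "\<exists>c s. 0 < s \<and> s < \<sigma> \<and> K \<subseteq> {z. plane_dist c z < s} \<and>
          emeasure lborel (interior K) = ennreal (s\<^sup>2) \<and> K \<subseteq> T" if K: "K \<in> \<D>" for K
      proof -
        obtain u v where uv: "K = cbox u v" using D(3)[OF K] by blast
        from D(6)[OF K[unfolded uv]] obtain n where
          "\<forall>i \<in> Basis. v \<bullet> i - u \<bullet> i = ((1::real,1::real) \<bullet> i - (0,0) \<bullet> i) / 2^n" by blast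
        then have side: "fst v - fst u = 1 / 2 ^ n" "snd v - snd u = 1 / 2 ^ n"
          by (auto simp: Basis_prod_def inner_prod_def)
        \<comment> \<open>The radius will be the full side, not half of it: the squares are closed
          and the balls open.\<close>
        define s :: real where "s = 1 / 2 ^ n"
        have s: "s > 0" unfolding s_def by simp
        obtain x where x: "x \<in> N" "x \<in> K" "K \<subseteq> g x" using D(5)[OF K] by blast
        have "x \<in> T" using x(1) T(2) by blast
        then have sub: "K \<subseteq> T \<inter> ball x (\<sigma> / 2)" using x(3) unfolding g_def by (simp only: if_True)
        have Kne: "u \<in> K" "v \<in> K" unfolding uv using side s
          by (auto simp: mem_box Basis_prod_def inner_prod_def s_def[symmetric])
        have "s \<le> dist u v"
        proof -
          have "fst v = fst u + s" using side by (simp add: s_def)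
          then have "s = dist (fst u) (fst v)" using s by (simp add: dist_real_def)
          also have "\<dots> \<le> dist u v" by (rule dist_fst_le)
          finally show ?thesis .
        qed
        also have "dist u v < \<sigma>"
        proof -
          have "dist x u < \<sigma> / 2" "dist x v < \<sigma> / 2" using sub Kne by (meson IntE mem_ball subsetD)+
          then show ?thesis using dist_triangle3[of u v x] by linarith
        qed
        finally have "s < \<sigma>" .
        moreover have "K \<subseteq> {z. plane_dist ((fst u + fst v) / 2, (snd u + snd v) / 2) z < s}"
        proof
          fix z assume "z \<in> K"
          then have "fst u \<le> fst z" "fst z \<le> fst v" "snd u \<le> snd z" "snd z \<le> snd v"
            unfolding uv by (auto simp: mem_box Basis_prod_def inner_prod_def)
          moreover have "fst v = fst u + s" "snd v = snd u + s" using side by (simp_all add: s_def)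
          ultimately have "\<bar>(fst u + fst v) / 2 - fst z\<bar> < s \<and> \<bar>(snd u + snd v) / 2 - snd z\<bar> < s"
            using s by (simp add: abs_less_iff field_simps)
          then show "z \<in> {z. plane_dist ((fst u + fst v) / 2, (snd u + snd v) / 2) z < s}"
            by (simp add: plane_dist_def)
        qed
        moreover have "emeasure lborel (interior K) = ennreal (s\<^sup>2)"
        proof -
          have "emeasure lborel (interior K) = emeasure lborel (box u v)" unfolding uv by (simp add: interior_cbox)
          also have "\<dots> = (\<Prod>b\<in>Basis. (v - u) \<bullet> b)"
            using side s by (intro emeasure_lborel_box) (auto simp: Basis_prod_def inner_prod_def s_def[symmetric])
          also have "\<dots> = ennreal (s\<^sup>2)"
          proof -
            have "(\<Prod>b\<in>Basis. (v - u) \<bullet> b) = (fst v - fst u) * (snd v - snd u)"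
              unfolding Basis_prod_def by (subst prod.union_disjoint) (auto simp: inner_prod_def)
            then show ?thesis using side unfolding s_def by (simp add: power2_eq_square)
          qed
          finally show ?thesis .
        qed
        ultimately show ?thesis using s sub by blast
      qed
      then obtain c s where cs: "\<And>K. K \<in> \<D> \<Longrightarrow> 0 < s K \<and> s K < \<sigma> \<and> K \<subseteq> {z. plane_dist (c K) z < s K} \<and>
          emeasure lborel (interior K) = ennreal ((s K)\<^sup>2) \<and> K \<subseteq> T" by metis
      \<comment> \<open>\<open>\<D>\<close> may be finite. Indices outside \<open>J\<close> receive
        radius 0, an empty ball of cost 0.\<close>
      define J where "J = to_nat_on \<D> ` \<D>"
      define k where "k = from_nat_into \<D>"
      have kJ: "k i \<in> \<D>" if "i \<in> J" for i using that D(1) unfolding J_def k_def by auto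
      have kinj: "i = j" if "i \<in> J" "j \<in> J" "k i = k j" for i j
        using that D(1) unfolding J_def k_def by auto
      have kex: "\<exists>i\<in>J. k i = K" if "K \<in> \<D>" for K
        using that D(1) unfolding J_def k_def by (intro bexI[of _ "to_nat_on \<D> K"]) auto
      define r where "r i = (if i \<in> J then s (k i) else 0)" for i
      \<comment> \<open>Adjacent squares share edges, so areas are added over the interiors, which
        are disjoint.\<close>
      define I where "I i = (if i \<in> J then interior (k i) else {})" for i
      have "?I \<le> (\<Sum>i. ennreal (if r i > 0 then f (r i) else 0))"
      proof (rule INF_lower2[of "(c \<circ> k, r)"])
        have "0 \<le> r i \<and> r i < \<rho>" for i
          using cs[OF kJ, of i] \<rho> unfolding r_def \<sigma>_def by (auto simp: less_imp_le)
        moreover have "N \<subseteq> (\<Union>i. {z. plane_dist ((c \<circ> k) i) z < r i})"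
        proof
          fix x assume "x \<in> N"
          then obtain K where K: "K \<in> \<D>" "x \<in> K" using D(7) by auto
          then obtain i where i: "i \<in> J" "k i = K" using kex by blast
          then have "x \<in> {z. plane_dist ((c \<circ> k) i) z < r i}" using cs[OF K(1)] K(2) unfolding r_def by auto
          then show "x \<in> (\<Union>i. {z. plane_dist ((c \<circ> k) i) z < r i})" by blast
        qed
        ultimately show "(c \<circ> k, r) \<in> {(c :: nat \<Rightarrow> real \<times> real, r :: nat \<Rightarrow> real).
         (\<forall>i. 0 \<le> r i \<and> r i < \<rho>) \<and> N \<subseteq> (\<Union>i. {z. plane_dist (c i) z < r i})}" by simp
      qed (simp only: snd_conv order_refl)
      also have "\<dots> \<le> (\<Sum>i. ennreal C1 * emeasure lborel (I i))"
      proof (intro suminf_le allI)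
        fix i
        show "ennreal (if r i > 0 then f (r i) else 0) \<le> ennreal C1 * emeasure lborel (I i)"
        proof (cases "i \<in> J")
          case True
          note h = cs[OF kJ[OF True]]
          have "f (s (k i)) \<le> C1 * (s (k i))\<^sup>2" unfolding C1_def
            using h by (intro C') (auto simp: \<sigma>_def)
          then have "ennreal (f (s (k i))) \<le> ennreal C1 * ennreal ((s (k i))\<^sup>2)"
            using C1 by (simp add: ennreal_mult[symmetric] ennreal_leI)
          then show ?thesis using h True unfolding r_def I_def by simp
        qed (simp add: r_def)
      qed auto
      also have "\<dots> = ennreal C1 * (\<Sum>i. emeasure lborel (I i))" by simp
      also have "(\<Sum>i. emeasure lborel (I i)) = emeasure lborel (\<Union>i. I i)"
      proof (rule suminf_emeasure)
        show "range I \<subseteq> sets lborel" unfolding I_def by auto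
        show "disjoint_family I"
        proof (unfold disjoint_family_on_def, intro ballI impI)
          fix i j :: nat assume "i \<noteq> j"
          show "I i \<inter> I j = {}"
          proof (cases "i \<in> J \<and> j \<in> J")
            case True
            then have "k i \<in> \<D>" "k j \<in> \<D>" "k i \<noteq> k j" using kJ kinj[of i j] \<open>i \<noteq> j\<close> by auto
            then have "interior (k i) \<inter> interior (k j) = {}" using D(4) unfolding pairwise_def by blast
            then show ?thesis using True unfolding I_def by simp
          qed (auto simp: I_def)
        qed
      qed
      also have "\<dots> \<le> emeasure lborel T"
      proof (rule emeasure_mono)
        have "interior (k i) \<subseteq> T" if "i \<in> J" for i using cs[OF kJ[OF that]] interior_subset by blast
        then show "(\<Union>i. I i) \<subseteq> T" unfolding I_def by (auto split: if_splits)
      qed (use T(1) in auto)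
      also have "\<dots> \<le> ennreal (e / (4 * C1))" using Tm by simp
      also have "ennreal C1 * ennreal (e / (4 * C1)) = ennreal (e / 4)"
        using C1 e by (simp add: ennreal_mult[symmetric])
      also have "\<dots> \<le> ennreal e" using e by (intro ennreal_leI) auto
      finally show ?thesis by (simp add: mult_left_mono)
    qed
    have "?I \<le> 0" by (rule ennreal_le_epsilon) (rule le)
    then show ?thesis by simp
  qed
  then show ?thesis unfolding hausdorff_fm_def by simp
qed

section \<open>Mass transference in the plane\<close>

text \<open>Mass \<open>R\<^sup>2\<close> spread uniformly over \<open>W\<close> gives every ball of radius \<open>s < R\<close> mass at most \<open>\<eta> f(s)\<close>.\<close>
definition fine_piece :: "(real \<Rightarrow> real) \<Rightarrow> real \<Rightarrow> (real \<times> real) set \<Rightarrow> real \<times> real \<Rightarrow> bool" where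
  "fine_piece f \<eta> U x \<longleftrightarrow> (\<forall>\<delta>>0. \<exists>a R W. 0 < R \<and> R < \<delta> \<and> x \<in> cball a R \<and> open W \<and> W \<noteq> {} \<and>
     closure W \<subseteq> U \<inter> ball a (R / 2) \<and>
     (\<forall>z s. 0 < s \<longrightarrow> s < R \<longrightarrow> R\<^sup>2 * measure lborel (W \<inter> ball z s) \<le> \<eta> * f s * measure lborel W))"

section \<open>Areas of discs and measures of bounded density\<close>

lemma content_ball_plane: "r \<ge> 0 \<Longrightarrow> measure lborel (ball (a::real \<times> real) r) = pi * r\<^sup>2"
  by (simp add: content_ball unit_ball_vol_2 power2_eq_square)

lemma content_cball_plane: "r \<ge> 0 \<Longrightarrow> measure lborel (cball (a::real \<times> real) r) = pi * r\<^sup>2"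
  by (simp add: content_cball unit_ball_vol_2 power2_eq_square)

lemma emeasure_le_of_null_Diff:
  assumes "A \<in> sets M" "B \<in> sets M" "emeasure M (B - A) = 0"
  shows "emeasure M B \<le> emeasure M A"
proof -
  have "emeasure M B \<le> emeasure M (A \<union> (B - A))"
    by (rule emeasure_mono) (use assms in auto)
  also have "\<dots> \<le> emeasure M A + emeasure M (B - A)"
    by (rule emeasure_subadditive) (use assms in auto)
  finally show ?thesis using assms(3) by simp
qed

lemma measure_le_of_density_bound:
  fixes B :: "'a::euclidean_space set"
  assumes "\<And>B. B \<in> sets borel \<Longrightarrow> emeasure \<mu> B \<le> ennreal D * emeasure lborel B" "D \<ge> 0"
    and B: "B \<in> sets borel" "bounded B"
  shows "measure \<mu> B \<le> D * measure lborel B"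
proof -
  have fin: "emeasure lborel B < \<infinity>" using emeasure_bounded_finite[OF B(2)] .
  have "emeasure \<mu> B \<le> ennreal D * emeasure lborel B" using assms by auto
  also have "\<dots> = ennreal (D * measure lborel B)"
    using fin assms(2) by (simp add: emeasure_eq_ennreal_measure ennreal_mult)
  finally show ?thesis
    unfolding measure_def[of \<mu>] using assms(2) by (intro enn2real_leI) auto
qed

lemma measure_step_density:
  fixes W :: "'l \<Rightarrow> 'a::euclidean_space set"
  assumes F: "finite F" and c: "\<And>l. l \<in> F \<Longrightarrow> c l \<ge> 0"
    and W: "\<And>l. l \<in> F \<Longrightarrow> open (W l)" "\<And>l. l \<in> F \<Longrightarrow> bounded (W l)" and B: "B \<in> sets borel"
  shows "emeasure (density lborel (\<lambda>x. \<Sum>l\<in>F. ennreal (c l) * indicator (W l) x)) B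
       = ennreal (\<Sum>l\<in>F. c l * measure lborel (W l \<inter> B))" (is "emeasure ?\<mu> B = _")
    and "measure (density lborel (\<lambda>x. \<Sum>l\<in>F. ennreal (c l) * indicator (W l) x)) B
       = (\<Sum>l\<in>F. c l * measure lborel (W l \<inter> B))"
proof -
  have Wb: "W l \<in> sets borel" if "l \<in> F" for l using W that by auto
  have "emeasure ?\<mu> B = (\<integral>\<^sup>+x. (\<Sum>l\<in>F. ennreal (c l) * indicator (W l) x) * indicator B x \<partial>lborel)"
    using B Wb by (subst emeasure_density) auto
  also have "\<dots> = (\<integral>\<^sup>+x. (\<Sum>l\<in>F. ennreal (c l) * indicator (W l \<inter> B) x) \<partial>lborel)"
    by (intro nn_integral_cong) (auto simp: sum_distrib_right indicator_def intro!: sum.cong)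
  also have "\<dots> = (\<Sum>l\<in>F. \<integral>\<^sup>+x. ennreal (c l) * indicator (W l \<inter> B) x \<partial>lborel)"
    using B Wb by (subst nn_integral_sum) auto
  also have "\<dots> = (\<Sum>l\<in>F. ennreal (c l) * emeasure lborel (W l \<inter> B))"
    using B Wb by (intro sum.cong refl nn_integral_cmult_indicator) auto
  also have "\<dots> = (\<Sum>l\<in>F. ennreal (c l * measure lborel (W l \<inter> B)))"
  proof (intro sum.cong refl)
    fix l assume l: "l \<in> F"
    have "emeasure lborel (W l \<inter> B) < \<infinity>"
      using emeasure_bounded_finite[of "W l \<inter> B"] W(2)[OF l] bounded_Int by blast
    then show "ennreal (c l) * emeasure lborel (W l \<inter> B) = ennreal (c l * measure lborel (W l \<inter> B))"
      using c[OF l] by (simp add: emeasure_eq_ennreal_measure ennreal_mult)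
  qed
  also have "\<dots> = ennreal (\<Sum>l\<in>F. c l * measure lborel (W l \<inter> B))"
    using c by (subst sum_ennreal) auto
  finally show eq: "emeasure ?\<mu> B = \<dots>" .
  show "measure ?\<mu> B = (\<Sum>l\<in>F. c l * measure lborel (W l \<inter> B))"
    unfolding measure_def[of ?\<mu>] eq using c by (simp add: sum_nonneg)
qed

text \<open>Truncates the countable family produced by Vitali's theorem. Finiteness keeps the
  density of the redistributed measure bounded and puts the closure of the union inside the union of
  the closures.\<close>

lemma finite_subfamily_measure:
  assumes "finite_measure \<mu>" "countable C" "\<And>i. i \<in> C \<Longrightarrow> S i \<in> sets \<mu>" "(e::real) > 0"
  obtains F where "finite F" "F \<subseteq> C" "measure \<mu> (\<Union>i\<in>F. S i) \<ge> measure \<mu> (\<Union>i\<in>C. S i) - e"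
proof (cases "C = {}")
  case True
  then show ?thesis using assms that[of "{}"] by auto
next
  case False
  interpret finite_measure \<mu> by fact
  define g where "g = from_nat_into C"
  have rg: "range g = C" unfolding g_def using False assms(2) by (rule range_from_nat_into)
  define A where "A n = (\<Union>i\<le>n. S (g i))" for n :: nat
  have sA: "range A \<subseteq> sets \<mu>" unfolding A_def using assms(3) rg by (intro image_subsetI sets.finite_UN) auto
  have "incseq A" unfolding A_def by (rule incseq_SucI) (auto simp: atMost_Suc)
  from finite_Lim_measure_incseq[OF sA this]
  have "(\<lambda>n. measure \<mu> (A n)) \<longlonglongrightarrow> measure \<mu> (\<Union>n. A n)" .
  moreover have "(\<Union>n. A n) = (\<Union>i\<in>C. S i)" unfolding A_def rg[symmetric] by auto
  ultimately have "(\<lambda>n. measure \<mu> (A n)) \<longlonglongrightarrow> measure \<mu> (\<Union>i\<in>C. S i)" by simp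
  then have "\<forall>\<^sub>F n in sequentially. measure \<mu> (A n) > measure \<mu> (\<Union>i\<in>C. S i) - e"
    using assms(4) by (intro order_tendstoD) auto
  then obtain n where "measure \<mu> (A n) > measure \<mu> (\<Union>i\<in>C. S i) - e"
    by (meson eventually_sequentially order_refl)
  moreover have "A n = (\<Union>i\<in>g ` {..n}. S i)" unfolding A_def by auto
  ultimately show ?thesis using rg by (intro that[of "g ` {..n}"]) auto
qed

text \<open>Each ball of a finite disjoint Vitali family keeps its mass, but the mass is moved onto
  the fine piece inside it. The new mass of a ball of radius s is then bounded at three scales. For
  s \<ge> \<open>s1\<close> only a thin layer around the ball can contribute extra mass, and C' - C
  pays for it. For smaller s, either all pieces met come from Vitali balls of radius at most 4s, and
  the old density bound on a ball of radius 9s suffices; or a piece of a larger Vitali ball is met,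
  it is then the only one, and \<open>fine_piece\<close> applies. The last two cases give the
  constant 1, so nothing accumulates at small scales.\<close>

lemma mass_transference_step:
  fixes \<mu> :: "(real \<times> real) measure" and f :: "real \<Rightarrow> real"
  assumes fpos: "\<And>s. s > 0 \<Longrightarrow> f s > 0"
    and fmono: "\<And>s t. 0 < s \<Longrightarrow> s \<le> t \<Longrightarrow> f s \<le> f t"
    and flim: "filterlim (\<lambda>s. f s / s\<^sup>2) at_top (at_right 0)"
    and sets_mu: "sets \<mu> = sets borel"
    and D: "D > 0" "\<And>B. B \<in> sets borel \<Longrightarrow> emeasure \<mu> B \<le> ennreal D * emeasure lborel B"
    and G: "open G" "bounded G" "emeasure \<mu> (- G) = 0"
    and s0: "s0 > 0" and frost: "\<And>z s. 0 < s \<Longrightarrow> s \<le> s0 \<Longrightarrow> measure \<mu> (ball z s) \<le> C * f s"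
    and C: "1 \<le> C" "C < C'" and e: "e > 0"
    and pieces: "\<And>\<eta>. \<eta> > 0 \<Longrightarrow> AE x in lborel. x \<in> G \<longrightarrow> fine_piece f \<eta> U x"
  obtains \<mu>' D' G' where "sets \<mu>' = sets borel" "D' > 0"
    "\<And>B. B \<in> sets borel \<Longrightarrow> emeasure \<mu>' B \<le> ennreal D' * emeasure lborel B"
    "open G'" "bounded G'" "emeasure \<mu>' (- G') = 0" "closure G' \<subseteq> G \<inter> U"
    "\<And>z s. 0 < s \<Longrightarrow> s \<le> s0 \<Longrightarrow> measure \<mu>' (ball z s) \<le> C' * f s"
    "measure \<mu>' UNIV \<ge> measure \<mu> UNIV - e"
proof -
  have space_mu: "space \<mu> = UNIV" using sets_eq_imp_space_eq[OF sets_mu] by simp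
  have Gs: "G \<in> sets \<mu>" using G(1) sets_mu by simp
  have split_mu: "emeasure \<mu> UNIV = emeasure \<mu> G"
  proof (rule antisym)
    show "emeasure \<mu> UNIV \<le> emeasure \<mu> G"
      by (rule emeasure_le_of_null_Diff) (use Gs sets_mu G(3) in \<open>simp_all add: Compl_eq_Diff_UNIV\<close>)
    show "emeasure \<mu> G \<le> emeasure \<mu> UNIV"
      by (rule emeasure_mono) (use sets_mu in simp_all)
  qed
  have "emeasure \<mu> G < \<infinity>"
  proof -
    have "emeasure \<mu> G \<le> ennreal D * emeasure lborel G" using D(2) G(1) by auto
    also have "\<dots> < \<infinity>" using emeasure_bounded_finite[OF G(2)] by (simp add: ennreal_mult_less_top)
    finally show ?thesis .
  qed
  then interpret mu: finite_measure \<mu>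
    using split_mu space_mu by (intro finite_measureI) auto
  have mle: "measure \<mu> B \<le> D * measure lborel B" if "B \<in> sets borel" "bounded B" for B
    using measure_le_of_density_bound[OF D(2) _ that] D(1) by auto
  \<comment> \<open>A ball of radius 9s has area 81 \<pi> s^2; 100 is a round number above
    81.\<close>
  define K where "K = 100 * pi * D"
  have K: "K > 0" unfolding K_def using D(1) by simp
  have "\<forall>\<^sub>F s in at_right 0. f s / s\<^sup>2 \<ge> K" using flim by (simp add: filterlim_at_top)
  then obtain b where b: "b > 0" "\<And>s. 0 < s \<Longrightarrow> s < b \<Longrightarrow> f s / s\<^sup>2 \<ge> K"
    unfolding eventually_at_right_field by auto
  define s1 where "s1 = min (b / 2) s0"
  have s1: "0 < s1" "s1 \<le> s0" "\<And>s. 0 < s \<Longrightarrow> s \<le> s1 \<Longrightarrow> K * s\<^sup>2 \<le> f s"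
  proof -
    show "0 < s1" "s1 \<le> s0" unfolding s1_def using b s0 by auto
    fix s assume s: "0 < s" "s \<le> s1"
    have "f s / s\<^sup>2 \<ge> K" using s b by (intro b(2)) (auto simp: s1_def)
    then show "K * s\<^sup>2 \<le> f s" using s by (simp add: field_simps)
  qed
  \<comment> \<open>With \<delta> \<le> 1 the layer of width 2\<delta> around a ball of radius s
    \<le> \<open>s0\<close> has area at most 4 \<pi> \<delta> (s0 + 1), hence mass at most (C' - C)
    f(s1).\<close>
  define \<delta> where "\<delta> = min 1 ((C' - C) * f s1 / (4 * D * pi * (s0 + 1)))"
  have d: "\<delta> > 0" "\<delta> \<le> 1" unfolding \<delta>_def using C fpos[OF s1(1)] D(1) s0 by auto
  have "\<delta> \<le> (C' - C) * f s1 / (4 * D * pi * (s0 + 1))" unfolding \<delta>_def by simp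
  moreover have "4 * D * pi * (s0 + 1) > 0" using D(1) s0 by auto
  ultimately have d2: "\<delta> * (4 * D * pi * (s0 + 1)) \<le> (C' - C) * f s1" by (simp only: pos_le_divide_eq)
  have enlarge: "measure \<mu> (ball z (s + 2 * \<delta>)) \<le> C' * f s" if s: "s1 \<le> s" "s \<le> s0" for z s
  proof -
    have sp: "s > 0" using s s1 by auto
    have sub: "ball z s \<subseteq> ball z (s + 2 * \<delta>)" using d by auto
    have "measure \<mu> (ball z (s + 2 * \<delta>)) = measure \<mu> (ball z s) + measure \<mu> (ball z (s + 2 * \<delta>) - ball z s)"
      using sub sets_mu by (subst mu.finite_measure_Diff) auto
    also have "measure \<mu> (ball z (s + 2 * \<delta>) - ball z s) \<le> D * measure lborel (ball z (s + 2 * \<delta>) - ball z s)"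
      by (intro mle) (auto intro: bounded_subset[OF bounded_ball])
    also have "measure lborel (ball z (s + 2 * \<delta>) - ball z s) = measure lborel (ball z (s + 2 * \<delta>)) - measure lborel (ball z s)"
      using sub emeasure_lborel_ball_finite[of z "s + 2 * \<delta>"] by (intro measure_Diff) auto
    also have "\<dots> = pi * (4 * s * \<delta> + 4 * \<delta>\<^sup>2)"
      using sp d by (simp add: content_ball_plane power2_eq_square algebra_simps)
    also have "D * \<dots> \<le> \<delta> * (4 * D * pi * (s0 + 1))"
    proof -
      have "4 * s * \<delta> + 4 * \<delta>\<^sup>2 \<le> 4 * \<delta> * (s0 + 1)"
      proof -
        have "4 * \<delta> * s + 4 * \<delta> * \<delta> \<le> 4 * \<delta> * s0 + 4 * \<delta> * 1"
          using d s by (intro add_mono mult_left_mono) auto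
        then show ?thesis by (simp add: power2_eq_square algebra_simps)
      qed
      then have "D * pi * (4 * s * \<delta> + 4 * \<delta>\<^sup>2) \<le> D * pi * (4 * \<delta> * (s0 + 1))"
        using D(1) by (intro mult_left_mono) auto
      then show ?thesis by (simp add: algebra_simps)
    qed
    also have "\<dots> \<le> (C' - C) * f s1" by (rule d2)
    also have "\<dots> \<le> (C' - C) * f s" using fmono[OF s1(1) s(1)] C by (intro mult_left_mono) auto
    also have "measure \<mu> (ball z s) \<le> C * f s" using frost sp s by auto
    finally show ?thesis by (simp add: algebra_simps)
  qed
  \<comment> \<open>A Vitali ball of radius R has mass at most \<pi> D R^2, so this \<eta> turns the
    bound in \<open>fine_piece\<close> into exactly f(s).\<close>
  define \<eta> where "\<eta> = 1 / (pi * D)"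
  have eta: "\<eta> > 0" unfolding \<eta>_def using D(1) by simp
  define \<K> where "\<K> = {(a, R, W). 0 < R \<and> R < \<delta> \<and> cball a R \<subseteq> G \<and> open W \<and> W \<noteq> {} \<and>
     closure W \<subseteq> U \<inter> ball a (R / 2) \<and>
     (\<forall>z s. 0 < s \<longrightarrow> s < R \<longrightarrow> R\<^sup>2 * measure lborel (W \<inter> ball z s) \<le> \<eta> * f s * measure lborel W)}"
  define ce where "ce l = fst l" for l :: "(real \<times> real) \<times> real \<times> (real \<times> real) set"
  define ra where "ra l = fst (snd l)" for l :: "(real \<times> real) \<times> real \<times> (real \<times> real) set"
  define W where "W l = snd (snd l)" for l :: "(real \<times> real) \<times> real \<times> (real \<times> real) set"
  have Kp: "0 < ra l" "ra l < \<delta>" "cball (ce l) (ra l) \<subseteq> G" "open (W l)" "W l \<noteq> {}"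
    "closure (W l) \<subseteq> U \<inter> ball (ce l) (ra l / 2)"
    "\<And>z s. 0 < s \<Longrightarrow> s < ra l \<Longrightarrow> (ra l)\<^sup>2 * measure lborel (W l \<inter> ball z s) \<le> \<eta> * f s * measure lborel (W l)"
    if "l \<in> \<K>" for l using that unfolding \<K>_def ce_def ra_def W_def by auto
  \<comment> \<open>\<open>S\<close> is not known to be measurable. Vitali's theorem accepts any
    set, and its conclusion is then transferred to the Borel set \<open>G\<close> minus the
    balls.\<close>
  define S where "S = {x \<in> G. fine_piece f \<eta> U x}"
  have fineS: "\<exists>l. l \<in> \<K> \<and> x \<in> cball (ce l) (ra l) \<and> ra l < d" if x: "x \<in> S" and "d > 0" for x d
  proof -
    obtain r where r: "r > 0" "ball x r \<subseteq> G" using G(1) x unfolding S_def open_contains_ball by auto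
    have "min (min d \<delta>) (r / 2) > 0" using r \<open>d > 0\<close> d by auto
    then obtain a R V where h: "0 < R" "R < min (min d \<delta>) (r / 2)" "x \<in> cball a R" "open V" "V \<noteq> {}"
      "closure V \<subseteq> U \<inter> ball a (R / 2)"
      "\<forall>z s. 0 < s \<longrightarrow> s < R \<longrightarrow> R\<^sup>2 * measure lborel (V \<inter> ball z s) \<le> \<eta> * f s * measure lborel V"
      using x unfolding S_def fine_piece_def by blast
    have "cball a R \<subseteq> ball x r"
    proof
      fix w assume "w \<in> cball a R"
      then show "w \<in> ball x r" using h(2,3) dist_triangle[of x w a] by (auto simp: dist_commute)
    qed
    then have "(a, R, V) \<in> \<K>" using h r unfolding \<K>_def by auto
    then show ?thesis using h by (intro exI[of _ "(a,R,V)"]) (auto simp: ce_def ra_def)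
  qed
  obtain CC where CC: "countable CC" "CC \<subseteq> \<K>"
     "pairwise (\<lambda>i j. disjnt (cball (ce i) (ra i)) (cball (ce j) (ra j))) CC"
     "negligible (S - (\<Union>i \<in> CC. cball (ce i) (ra i)))"
    using Vitali_covering_theorem_cballs[of \<K> ra S ce] Kp(1) fineS by blast
  have "emeasure \<mu> (G - (\<Union>i\<in>CC. cball (ce i) (ra i))) = 0"
  proof -
    have ae: "AE x in lborel. x \<in> G \<longrightarrow> x \<in> S" using pieces[OF eta] unfolding S_def by auto
    have "AE x in lebesgue. x \<notin> S - (\<Union>i \<in> CC. cball (ce i) (ra i))"
      using CC(4) unfolding negligible_iff_null_sets by (rule AE_not_in)
    then have "AE x in lborel. x \<notin> S - (\<Union>i \<in> CC. cball (ce i) (ra i))"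
      using AE_completion_iff by blast
    with ae have ae2: "AE x in lborel. x \<notin> G - (\<Union>i\<in>CC. cball (ce i) (ra i))" by eventually_elim auto
    have bo: "G - (\<Union>i\<in>CC. cball (ce i) (ra i)) \<in> sets borel"
      using G(1) by (intro sets.Diff sets.countable_UN'[OF CC(1)]) auto
    have "emeasure lborel (G - (\<Union>i\<in>CC. cball (ce i) (ra i))) = 0"
      using AE_iff_null_sets[of "G - (\<Union>i\<in>CC. cball (ce i) (ra i))" lborel] ae2 bo by auto
    then show ?thesis using D(2)[OF bo] by simp
  qed
  then have cover: "measure \<mu> UNIV \<le> measure \<mu> (\<Union>i\<in>CC. cball (ce i) (ra i))"
  proof -
    assume z: "emeasure \<mu> (G - (\<Union>i\<in>CC. cball (ce i) (ra i))) = 0"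
    have "(\<Union>i\<in>CC. cball (ce i) (ra i)) \<in> sets \<mu>" unfolding sets_mu
      by (rule sets.countable_UN'[OF CC(1)]) auto
    from emeasure_le_of_null_Diff[OF this Gs z]
    show ?thesis unfolding split_mu[symmetric] by (simp add: mu.emeasure_eq_measure)
  qed
  obtain F where F: "finite F" "F \<subseteq> CC"
    and Fm: "measure \<mu> (\<Union>i\<in>F. cball (ce i) (ra i)) \<ge> measure \<mu> (\<Union>i\<in>CC. cball (ce i) (ra i)) - e"
    by (rule finite_subfamily_measure[OF mu.finite_measure_axioms CC(1), where S = "\<lambda>i. cball (ce i) (ra i)" and e = e])
       (use sets_mu e in auto)
  have FK: "l \<in> \<K>" if "l \<in> F" for l using that F CC by auto
  have disjF: "disjoint_family_on (\<lambda>l. cball (ce l) (ra l)) F'" if "F' \<subseteq> F" for F'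
    using that CC(3) F(2) unfolding disjoint_family_on_def pairwise_def disjnt_def by blast
  have sum_balls: "(\<Sum>l\<in>F'. measure \<mu> (cball (ce l) (ra l))) = measure \<mu> (\<Union>l\<in>F'. cball (ce l) (ra l))"
    if "F' \<subseteq> F" for F'
    using that F(1) sets_mu disjF[OF that]
    by (subst mu.finite_measure_finite_Union) (auto intro: finite_subset)
  define m where "m l = measure \<mu> (cball (ce l) (ra l))" for l
  define c where "c l = m l / measure lborel (W l)" for l
  have Wbd: "bounded (W l)" and Wsub: "W l \<subseteq> ball (ce l) (ra l / 2)" if "l \<in> F" for l
    using Kp(6)[OF FK[OF that]] closure_subset[of "W l"] by (auto intro: bounded_subset[OF bounded_ball])
  have Wcball: "W l \<subseteq> cball (ce l) (ra l)" if "l \<in> F" for l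
    using Wsub[OF that] ball_subset_cball[of "ce l" "ra l"] subset_ball[of "ra l / 2" "ra l" "ce l"]
      Kp(1)[OF FK[OF that]] by force
  have Wpos: "measure lborel (W l) > 0" if "l \<in> F" for l
  proof -
    have "emeasure lborel (W l) < \<infinity>" using emeasure_bounded_finite[OF Wbd[OF that]] .
    moreover have "emeasure lborel (W l) \<noteq> 0"
    proof
      assume "emeasure lborel (W l) = 0"
      then have "negligible (W l)" using Kp(4)[OF FK[OF that]]
        by (simp add: negligible_iff_emeasure0)
      then show False using open_not_negligible Kp(4,5)[OF FK[OF that]] by auto
    qed
    ultimately show ?thesis
      by (metis emeasure_eq_ennreal_measure ennreal_0 infinity_ennreal_def linorder_not_less order_le_less top.not_eq_extremum zero_less_measure_iff)
  qed
  have mnn: "m l \<ge> 0" for l unfolding m_def by simp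
  have cnn: "c l \<ge> 0" for l unfolding c_def by (simp add: mnn)
  have cW: "c l * measure lborel (W l) = m l" if "l \<in> F" for l using Wpos[OF that] unfolding c_def by simp
  have mD: "m l \<le> D * pi * (ra l)\<^sup>2" if "l \<in> F" for l
    using mle[of "cball (ce l) (ra l)"] Kp(1)[OF FK[OF that]] unfolding m_def by (simp add: content_cball_plane)
  define \<mu>' where "\<mu>' = density lborel (\<lambda>x. \<Sum>l\<in>F. ennreal (c l) * indicator (W l) x)"
  have dens: "emeasure \<mu>' B = ennreal (\<Sum>l\<in>F. c l * measure lborel (W l \<inter> B))"
    "measure \<mu>' B = (\<Sum>l\<in>F. c l * measure lborel (W l \<inter> B))" if "B \<in> sets borel" for B
    using measure_step_density[where F = F and c = c and W = W, OF F(1) cnn Kp(4)[OF FK] Wbd that]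
    unfolding \<mu>'_def by auto
  \<comment> \<open>The summand 1 keeps \<open>D'\<close> positive even if \<open>F\<close> is
    empty.\<close>
  define D' where "D' = (\<Sum>l\<in>F. c l) + 1"
  define G' where "G' = (\<Union>l\<in>F. W l)"
  show ?thesis
  proof (rule that[of \<mu>' D' G'])
    show "sets \<mu>' = sets borel" unfolding \<mu>'_def by simp
    show "D' > 0" unfolding D'_def using cnn by (simp add: add_nonneg_pos sum_nonneg)
    show "open G'" unfolding G'_def using Kp(4)[OF FK] by auto
    show "bounded G'" unfolding G'_def using Wbd F(1) by auto
    show "emeasure \<mu>' (- G') = 0"
    proof -
      have "W l \<inter> - G' = {}" if "l \<in> F" for l using that unfolding G'_def by auto
      then show ?thesis using \<open>open G'\<close> by (subst dens) auto
    qed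
    show "closure G' \<subseteq> G \<inter> U"
    proof -
      have "closure G' \<subseteq> (\<Union>l\<in>F. closure (W l))" unfolding G'_def
        using F(1) closure_subset by (intro closure_minimal closed_UN) (auto simp: subset_iff)
      moreover have "closure (W l) \<subseteq> G \<inter> U" if "l \<in> F" for l
      proof -
        have "ball (ce l) (ra l / 2) \<subseteq> cball (ce l) (ra l)" using Kp(1)[OF FK[OF that]] by auto
        then show ?thesis using Kp(6,3)[OF FK[OF that]] by blast
      qed
      ultimately show ?thesis by blast
    qed
    show "emeasure \<mu>' B \<le> ennreal D' * emeasure lborel B" if B: "B \<in> sets borel" for B
    proof (cases "emeasure lborel B = \<infinity>")
      case True
      then show ?thesis using \<open>D' > 0\<close> by (simp add: ennreal_mult_top)
    next
      case False
      have "(\<Sum>l\<in>F. c l * measure lborel (W l \<inter> B)) \<le> (\<Sum>l\<in>F. c l * measure lborel B)"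
        using B Kp(4)[OF FK] False by (intro sum_mono mult_left_mono cnn measure_mono_fmeasurable) (auto simp: fmeasurable_def less_top)
      also have "\<dots> \<le> D' * measure lborel B" unfolding D'_def by (simp add: sum_distrib_right[symmetric] mult_right_mono)
      finally have "emeasure \<mu>' B \<le> ennreal (D' * measure lborel B)"
        by (subst dens(1)[OF B]) (rule ennreal_leI)
      also have "\<dots> = ennreal D' * emeasure lborel B"
        using False \<open>D' > 0\<close> by (simp add: ennreal_mult emeasure_eq_ennreal_measure)
      finally show ?thesis .
    qed
    show "measure \<mu>' UNIV \<ge> measure \<mu> UNIV - e"
    proof -
      have "measure \<mu>' UNIV = (\<Sum>l\<in>F. m l)" using cW by (subst dens(2)) auto
      also have "\<dots> = measure \<mu> (\<Union>l\<in>F. cball (ce l) (ra l))"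
        unfolding m_def by (rule sum_balls) simp
      finally show ?thesis using Fm cover by linarith
    qed
    fix z s assume s: "0 < s" "s \<le> s0"
    define L where "L = {l \<in> F. W l \<inter> ball z s \<noteq> {}}"
    have LF: "L \<subseteq> F" unfolding L_def by auto
    have mu'eq: "measure \<mu>' (ball z s) = (\<Sum>l\<in>L. c l * measure lborel (W l \<inter> ball z s))"
      unfolding L_def using F(1) by (subst dens(2)) (auto intro!: sum.mono_neutral_right)
    have le_m: "c l * measure lborel (W l \<inter> ball z s) \<le> m l" if "l \<in> F" for l
    proof -
      have "measure lborel (W l \<inter> ball z s) \<le> measure lborel (W l)"
        using Kp(4)[OF FK[OF that]] emeasure_bounded_finite[OF Wbd[OF that]]
        by (intro measure_mono_fmeasurable) (auto simp: fmeasurable_def)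
      then show ?thesis using cW[OF that] cnn[of l] by (metis mult_left_mono)
    qed
    \<comment> \<open>Every piece met carries the mass of its whole Vitali ball. These balls are
      disjoint and reach at most 2t beyond the ball of radius s, so the new mass is bounded by old
      mass on a slightly larger ball.\<close>
    have multi: "measure \<mu>' (ball z s) \<le> measure \<mu> (ball z (s + 2 * t))" if t: "\<And>l. l \<in> L \<Longrightarrow> ra l \<le> t" for t
    proof -
      have "measure \<mu>' (ball z s) \<le> (\<Sum>l\<in>L. m l)"
        unfolding mu'eq using le_m LF by (intro sum_mono) auto
      also have "\<dots> = measure \<mu> (\<Union>l\<in>L. cball (ce l) (ra l))" unfolding m_def by (rule sum_balls[OF LF])
      also have "\<dots> \<le> measure \<mu> (ball z (s + 2 * t))"
      proof (rule mu.finite_measure_mono)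
        show "(\<Union>l\<in>L. cball (ce l) (ra l)) \<subseteq> ball z (s + 2 * t)"
        proof
          fix w assume "w \<in> (\<Union>l\<in>L. cball (ce l) (ra l))"
          then obtain l where l: "l \<in> L" "dist (ce l) w \<le> ra l" by (meson UN_E mem_cball)
          then obtain v where v: "v \<in> W l" "dist z v < s" unfolding L_def mem_Collect_eq
            by (meson disjoint_iff mem_ball)
          have "l \<in> F" using l(1) LF by blast
          then have "dist (ce l) v \<le> ra l" using v(1) Wcball[of l] by (meson mem_cball subsetD)
          then have "dist v w \<le> ra l + ra l"
            using dist_triangle3[of v w "ce l"] l(2) by linarith
          then show "w \<in> ball z (s + 2 * t)" using dist_triangle[of z w v] v(2) t[OF l(1)] by auto
        qed
      qed (use sets_mu in auto)
      finally show ?thesis .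
    qed
    show "measure \<mu>' (ball z s) \<le> C' * f s"
    proof (cases "s1 \<le> s")
      case True
      have "measure \<mu>' (ball z s) \<le> measure \<mu> (ball z (s + 2 * \<delta>))"
        by (rule multi) (meson Kp(2) FK LF less_imp_le subsetD)
      then show ?thesis using enlarge[OF True s(2)] by (rule order_trans)
    next
      case False
      then have sl: "s < s1" by simp
      have fs: "f s \<le> C' * f s" using C fpos[OF s(1)] by simp
      show ?thesis
      proof (cases "\<forall>l\<in>L. ra l \<le> 4 * s")
        case True
        then have "measure \<mu>' (ball z s) \<le> measure \<mu> (ball z (s + 2 * (4 * s)))" by (intro multi) blast
        also have "\<dots> \<le> D * (pi * (s + 2 * (4 * s))\<^sup>2)"
          using mle[of "ball z (s + 2 * (4 * s))"] s by (simp add: content_ball_plane)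
        also have "\<dots> \<le> K * s\<^sup>2" unfolding K_def using D(1) by (simp add: power2_eq_square)
        also have "\<dots> \<le> f s" using s1(3) s sl by auto
        finally show ?thesis using fs by linarith
      next
        case False
        then obtain l0 where l0: "l0 \<in> L" "ra l0 > 4 * s" by (meson not_le)
        then obtain v where v: "v \<in> W l0" "dist z v < s" unfolding L_def mem_Collect_eq
          by (meson disjoint_iff mem_ball)
        have l0F: "l0 \<in> F" using l0(1) LF by blast
        have "dist (ce l0) v < ra l0 / 2" using v(1) Wsub[OF l0F] by (meson mem_ball subsetD)
        \<comment> \<open>This fixes the threshold 4s: the piece lies in the half ball of radius
          \<open>ra l0 / 2\<close>, and 2s < \<open>ra l0 / 2\<close>. The small ball therefore
          stays in one Vitali ball and meets no other piece.\<close>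
        have inc: "ball z s \<subseteq> cball (ce l0) (ra l0)"
        proof
          fix w assume "w \<in> ball z s"
          then have "dist v w < 2 * s" using dist_triangle3[of v w z] v(2) by auto
          then show "w \<in> cball (ce l0) (ra l0)"
            using dist_triangle[of "ce l0" w v] \<open>dist (ce l0) v < ra l0 / 2\<close> l0(2) by auto
        qed
        have "L = {l0}"
        proof -
          have "l = l0" if "l \<in> L" for l
          proof (rule ccontr)
            assume ne: "l \<noteq> l0"
            have "l \<in> F" using that LF by auto
            then have "W l \<subseteq> cball (ce l) (ra l)" by (rule Wcball)
            moreover have "cball (ce l) (ra l) \<inter> cball (ce l0) (ra l0) = {}"
              using disjF[OF order_refl] \<open>l \<in> F\<close> l0F ne unfolding disjoint_family_on_def by blast
            ultimately show False using inc that unfolding L_def by blast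
          qed
          then show ?thesis using l0(1) by blast
        qed
        then have "measure \<mu>' (ball z s) = c l0 * measure lborel (W l0 \<inter> ball z s)" using mu'eq by simp
        also have "\<dots> = m l0 * measure lborel (W l0 \<inter> ball z s) / measure lborel (W l0)" unfolding c_def by simp
        also have "\<dots> \<le> D * pi * (ra l0)\<^sup>2 * measure lborel (W l0 \<inter> ball z s) / measure lborel (W l0)"
          using mD[OF l0F] by (intro divide_right_mono mult_right_mono) auto
        also have "\<dots> = D * pi * ((ra l0)\<^sup>2 * measure lborel (W l0 \<inter> ball z s)) / measure lborel (W l0)" by simp
        also have "\<dots> \<le> D * pi * (\<eta> * f s * measure lborel (W l0)) / measure lborel (W l0)"
          using D(1) s l0 Kp(7)[OF FK[OF l0F], of s z] by (intro divide_right_mono mult_left_mono) auto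
        also have "\<dots> = f s" unfolding \<eta>_def using D(1) Wpos[OF l0F] by simp
        finally show ?thesis using fs by linarith
      qed
    qed
  qed
qed

section \<open>Iterated redistribution of mass\<close>

lemma emeasure_finite_of_density_bound:
  fixes \<mu> :: "'a::euclidean_space measure"
  assumes "\<And>B. B \<in> sets borel \<Longrightarrow> emeasure \<mu> B \<le> ennreal D * emeasure lborel B"
    and "B \<in> sets borel" "bounded B"
  shows "emeasure \<mu> B = ennreal (measure \<mu> B)"
proof -
  have "emeasure \<mu> B \<le> ennreal D * emeasure lborel B" using assms by auto
  also have "\<dots> < \<infinity>" using emeasure_bounded_finite[OF assms(3)] by (simp add: ennreal_mult_less_top)
  finally show ?thesis by (intro emeasure_eq_ennreal_measure) auto
qed

text \<open>The invariant of the iteration, for a triple of measure, density bound and open carrier.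
  The density bound \<open>D\<close> is free to grow from stage to stage, while the Frostman bound
  with \<open>s0\<close> and \<open>C\<close> is meant to hold for all stages at once.\<close>

definition mass_stage :: "(real \<Rightarrow> real) \<Rightarrow> real \<Rightarrow> real \<Rightarrow> (real \<times> real) set \<Rightarrow> real \<Rightarrow>
    (real \<times> real) measure \<times> real \<times> (real \<times> real) set \<Rightarrow> bool" where
  "mass_stage f s0 C G0 m = (\<lambda>(\<mu>, D, G). sets \<mu> = sets borel \<and> D > 0 \<and>
     (\<forall>B\<in>sets borel. emeasure \<mu> B \<le> ennreal D * emeasure lborel B) \<and>
     open G \<and> bounded G \<and> G \<subseteq> G0 \<and> emeasure \<mu> (- G) = 0 \<and>
     (\<forall>z s. 0 < s \<longrightarrow> s \<le> s0 \<longrightarrow> measure \<mu> (ball z s) \<le> C * f s) \<and> m \<le> measure \<mu> UNIV)"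

lemma mass_stage_mono:
  assumes h: "mass_stage f s0 C G0 m X" and "C \<le> C'" "m' \<le> m" "\<And>s. s > 0 \<Longrightarrow> f s > 0"
  shows "mass_stage f s0 C' G0 m' X"
proof -
  obtain \<mu> D G where X: "X = (\<mu>, D, G)" by (cases X) auto
  have "measure \<mu> (ball z s) \<le> C' * f s" if s: "0 < s" "s \<le> s0" for z s
  proof -
    have "measure \<mu> (ball z s) \<le> C * f s" using h s unfolding X mass_stage_def by blast
    also have "\<dots> \<le> C' * f s" using assms(2) assms(4)[OF s(1)] by (intro mult_right_mono) auto
    finally show ?thesis .
  qed
  moreover have "m' \<le> measure \<mu> UNIV" using h assms(3) unfolding X mass_stage_def by auto
  ultimately show ?thesis using h unfolding X mass_stage_def by blast
qed

text \<open>Both losses are geometric: the Frostman constant runs through 2 - 2^(-n), starting at 1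
  and staying below 2, and the mass through M (1/2 + 2^(-n-1)), starting at M and staying above M/2.
  The scale \<open>s0\<close> is fixed by the initial stage alone, where mass M spread uniformly
  over a set of area 1 requires M \<pi> s^2 \<le> f(s).\<close>

lemma mass_stages:
  fixes f :: "real \<Rightarrow> real" and G0 :: "(real \<times> real) set"
  assumes fpos: "\<And>s. s > 0 \<Longrightarrow> f s > 0"
    and fmono: "\<And>s t. 0 < s \<Longrightarrow> s \<le> t \<Longrightarrow> f s \<le> f t"
    and flim: "filterlim (\<lambda>s. f s / s\<^sup>2) at_top (at_right 0)"
    and pieces: "\<And>k \<eta>. \<eta> > 0 \<Longrightarrow> AE x in lborel. x \<in> G0 \<longrightarrow> fine_piece f \<eta> (U k) x"
    and G0: "open G0" "bounded G0" "measure lborel G0 = 1" and M: "M > 0"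
  shows "\<exists>s0>0. \<exists>X. (\<forall>k. mass_stage f s0 2 G0 (M / 2) (X k)) \<and>
    (\<forall>k::nat. closure (snd (snd (X (Suc k)))) \<subseteq> snd (snd (X k)) \<inter> U k)"
proof -
  have "\<forall>\<^sub>F s in at_right 0. f s / s\<^sup>2 \<ge> M * pi" using flim by (simp add: filterlim_at_top)
  then obtain b where b: "b > 0" "\<And>s. 0 < s \<Longrightarrow> s < b \<Longrightarrow> f s / s\<^sup>2 \<ge> M * pi"
    unfolding eventually_at_right_field by auto
  define s0 where "s0 = b / 2"
  have s0: "s0 > 0" unfolding s0_def using b by simp
  define P where "P n = mass_stage f s0 (2 - 1 / 2 ^ n) G0 (M * (1 / 2 + 1 / 2 ^ Suc n))" for n :: nat
  define Q where "Q n x y \<longleftrightarrow> closure (snd (snd y)) \<subseteq> snd (snd x) \<inter> U n"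
    for n and x y :: "(real \<times> real) measure \<times> real \<times> (real \<times> real) set"
  have "\<exists>X. \<forall>n. P n (X n) \<and> Q n (X n) (X (Suc n))"
  proof (rule dependent_nat_choice)
    \<comment> \<open>A step density with a single step, so that the same evaluation lemma
      applies.\<close>
    define \<mu> where "\<mu> = density lborel (\<lambda>x. \<Sum>l\<in>{()}. ennreal M * indicator G0 x)"
    have dens: "emeasure \<mu> B = ennreal (M * measure lborel (G0 \<inter> B))"
      "measure \<mu> B = M * measure lborel (G0 \<inter> B)" if "B \<in> sets borel" for B
      using measure_step_density[where F = "{()}" and c = "\<lambda>_. M" and W = "\<lambda>_. G0" and B = B] that M G0
      unfolding \<mu>_def by auto
    have "P 0 (\<mu>, M, G0)"
      unfolding P_def mass_stage_def prod.case
    proof (intro conjI ballI allI impI)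
      show "sets \<mu> = sets borel" unfolding \<mu>_def by simp
      show "emeasure \<mu> (- G0) = 0" using G0 by (subst dens) auto
      show "M * (1 / 2 + 1 / 2 ^ Suc 0) \<le> measure \<mu> UNIV" using G0 by (subst dens) auto
      fix B :: "(real \<times> real) set" assume B: "B \<in> sets borel"
      have fin: "emeasure lborel (G0 \<inter> B) < \<infinity>"
        using G0(2) by (intro emeasure_bounded_finite bounded_Int) auto
      have "emeasure \<mu> B = ennreal M * emeasure lborel (G0 \<inter> B)"
        using fin M by (subst dens(1)[OF B]) (simp add: emeasure_eq_ennreal_measure ennreal_mult)
      also have "\<dots> \<le> ennreal M * emeasure lborel B"
        using B by (intro mult_left_mono emeasure_mono) auto
      finally show "emeasure \<mu> B \<le> ennreal M * emeasure lborel B" .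
    next
      fix z s assume s: "0 < s" "s \<le> s0"
      have "measure \<mu> (ball z s) = M * measure lborel (G0 \<inter> ball z s)" by (rule dens) simp
      also have "\<dots> \<le> M * measure lborel (ball z s)"
        using M G0(1) emeasure_lborel_ball_finite[of z s]
        by (intro mult_left_mono measure_mono_fmeasurable) (auto simp: fmeasurable_def)
      also have "\<dots> = M * pi * s\<^sup>2" using s by (simp add: content_ball_plane)
      also have "\<dots> \<le> f s" using b(2)[of s] s b(1) by (simp add: s0_def field_simps)
      finally show "measure \<mu> (ball z s) \<le> (2 - 1 / 2 ^ 0) * f s" by simp
    qed (use M G0 in auto)
    then show "\<exists>x. P 0 x" by blast
  next
    fix X n assume PX: "P n X"
    obtain \<mu> D G where X: "X = (\<mu>, D, G)" by (cases X) auto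
    have h: "sets \<mu> = sets borel" "D > 0" "\<And>B. B \<in> sets borel \<Longrightarrow> emeasure \<mu> B \<le> ennreal D * emeasure lborel B"
      "open G" "bounded G" "G \<subseteq> G0" "emeasure \<mu> (- G) = 0"
      "\<And>z s. 0 < s \<Longrightarrow> s \<le> s0 \<Longrightarrow> measure \<mu> (ball z s) \<le> (2 - 1 / 2 ^ n) * f s"
      "M * (1 / 2 + 1 / 2 ^ Suc n) \<le> measure \<mu> UNIV"
      using PX unfolding P_def X mass_stage_def by auto
    have C: "1 \<le> (2 - 1 / 2 ^ n :: real)" "2 - 1 / 2 ^ n < (2 - 1 / 2 ^ Suc n :: real)"
      by (auto simp: field_simps)
    \<comment> \<open>The difference of two consecutive masses: M / 2^(n+1) - M / 2^(n+2).\<close>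
    have e: "M / 2 ^ (n + 2) > 0" using M by simp
    have pc: "AE x in lborel. x \<in> G \<longrightarrow> fine_piece f \<eta> (U n) x" if "\<eta> > 0" for \<eta>
      using pieces[OF that, of n] h(6) by (auto elim!: eventually_mono)
    obtain \<mu>' D' G' where r: "sets \<mu>' = sets borel" "D' > 0"
      "\<And>B. B \<in> sets borel \<Longrightarrow> emeasure \<mu>' B \<le> ennreal D' * emeasure lborel B"
      "open G'" "bounded G'" "emeasure \<mu>' (- G') = 0" "closure G' \<subseteq> G \<inter> U n"
      "\<And>z s. 0 < s \<Longrightarrow> s \<le> s0 \<Longrightarrow> measure \<mu>' (ball z s) \<le> (2 - 1 / 2 ^ Suc n) * f s"
      "measure \<mu>' UNIV \<ge> measure \<mu> UNIV - M / 2 ^ (n + 2)"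
      by (rule mass_transference_step[OF fpos fmono flim h(1-5,7) s0 h(8) C e pc]) blast+
    have "M * (1 / 2 + 1 / 2 ^ Suc (Suc n)) = M * (1 / 2 + 1 / 2 ^ Suc n) - M / 2 ^ (n + 2)"
      by (simp add: field_simps)
    then have "M * (1 / 2 + 1 / 2 ^ Suc (Suc n)) \<le> measure \<mu>' UNIV" using r(9) h(9) by linarith
    moreover have "G' \<subseteq> G0" using r(7) h(6) closure_subset[of G'] by blast
    ultimately have "P (Suc n) (\<mu>', D', G')"
      unfolding P_def mass_stage_def prod.case using r by blast
    then show "\<exists>y. P (Suc n) y \<and> Q n X y" using r(7) unfolding Q_def X
      by (intro exI[of _ "(\<mu>', D', G')"]) auto
  qed
  then obtain X where X: "\<And>n. P n (X n)" "\<And>n. Q n (X n) (X (Suc n))" by blast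
  show ?thesis
  proof (intro exI[of _ s0] conjI s0 exI[of _ X] allI)
    show "closure (snd (snd (X (Suc k)))) \<subseteq> snd (snd (X k)) \<inter> U k" for k
      using X(2)[of k] unfolding Q_def .
    show "mass_stage f s0 2 G0 (M / 2) (X k)" for k
      by (rule mass_stage_mono[OF X(1)[of k, unfolded P_def]]) (use M fpos in \<open>auto simp: algebra_simps\<close>)
  qed
qed

text \<open>A mass distribution principle that avoids a limit measure. Given a cover by open balls,
  the nested compact sets \<open>K n\<close> have their intersection inside \<open>F\<close>, so
  some \<open>K n\<close> already lies in the union of the balls. The measure of that one stage is
  then compared with the cost of the cover.\<close>

theorem mass_transference:
  fixes f :: "real \<Rightarrow> real" and dd :: "real \<times> real \<Rightarrow> real \<times> real \<Rightarrow> real"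
  assumes fpos: "\<And>s. s > 0 \<Longrightarrow> f s > 0"
    and fmono: "\<And>s t. 0 < s \<Longrightarrow> s \<le> t \<Longrightarrow> f s \<le> f t"
    and fdouble: "\<And>s. s > 0 \<Longrightarrow> f (2 * s) \<le> 4 * f s"
    and flim: "filterlim (\<lambda>s. f s / s\<^sup>2) at_top (at_right 0)"
    and dd: "\<And>c r. r \<ge> 0 \<Longrightarrow> {z. dd c z < r} \<subseteq> ball c (2 * r)"
    and pieces: "\<And>k \<eta>. \<eta> > 0 \<Longrightarrow> AE x in lborel. x \<in> G0 \<longrightarrow> fine_piece f \<eta> (U k) x"
    and G0: "open G0" "bounded G0" "measure lborel G0 = 1"
  shows "hausdorff_fm dd f (G0 \<inter> (\<Inter>k::nat. U k)) = \<infinity>"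
proof -
  define F where "F = G0 \<inter> (\<Inter>k::nat. U k)"
  have main: "ennreal M \<le> hausdorff_fm dd f F" if M: "M > 0" for M
  proof -
    \<comment> \<open>The stages retain half of 16M, that is 8M. A ball of radius 2r has mass at
      most 2 f(2r) \<le> 8 f(r), so the factor 8 cancels.\<close>
    have M16: "16 * M > 0" using M by simp
    have "\<exists>s0>0. \<exists>X. (\<forall>k. mass_stage f s0 2 G0 (16 * M / 2) (X k)) \<and>
        (\<forall>k::nat. closure (snd (snd (X (Suc k)))) \<subseteq> snd (snd (X k)) \<inter> U k)"
      by (rule mass_stages[OF fpos fmono flim pieces G0 M16]) assumption+
    then obtain s0 and X :: "nat \<Rightarrow> (real \<times> real) measure \<times> real \<times> (real \<times> real) set" where s0: "s0 > 0"
      and X0: "(\<forall>k. mass_stage f s0 2 G0 (16 * M / 2) (X k)) \<and>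
        (\<forall>k::nat. closure (snd (snd (X (Suc k)))) \<subseteq> snd (snd (X k)) \<inter> U k)"
      by (elim exE conjE) blast
    have X: "mass_stage f s0 2 G0 (16 * M / 2) (X k)"
      "closure (snd (snd (X (Suc k)))) \<subseteq> snd (snd (X k)) \<inter> U k" for k
      using X0 by auto
    have bnd: "ennreal M \<le> (\<Sum>i. ennreal (if r i > 0 then f (r i) else 0))"
      if r: "\<forall>i. 0 \<le> r i \<and> r i < s0 / 2" and cov: "F \<subseteq> (\<Union>i. {z. dd (c i) z < r i})" for c r
    proof -
      \<comment> \<open>Euclidean balls of twice the radius contain the given ones. Radii below
        \<open>s0 / 2\<close> keep the doubled radius within the range of the Frostman
        bound.\<close>
      define V where "V i = ball (c i) (2 * r i)" for i :: nat
      define K where "K n = closure (snd (snd (X (Suc n))))" for n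
      have "{z. dd (c i) z < r i} \<subseteq> V i" for i unfolding V_def using dd r by simp
      then have FV: "F \<subseteq> (\<Union>i. V i)" using cov by (meson SUP_mono' order_trans)
      have "\<exists>n. K n \<subseteq> (\<Union>i. V i)"
      proof (rule ccontr)
        assume no: "\<not> (\<exists>n. K n \<subseteq> (\<Union>i. V i))"
        have Kdec: "K (Suc n) \<subseteq> K n" for n
          using X(2)[of "Suc n"] closure_subset unfolding K_def by blast
        have "\<Inter> (range (\<lambda>n. K n - (\<Union>i. V i))) \<noteq> {}"
        proof (rule compact_nest)
          show "compact (K n - (\<Union>i. V i))" for n
          proof (rule compact_diff)
            have "bounded (snd (snd (X (Suc n))))" using X(1)[of "Suc n"] unfolding mass_stage_def
              by (auto split: prod.splits)
            then show "compact (K n)" unfolding K_def by (simp add: compact_closure)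
            show "open (\<Union>i. V i)" unfolding V_def by auto
          qed
          show "K n - (\<Union>i. V i) \<noteq> {}" for n using no by blast
          show "K n - (\<Union>i. V i) \<subseteq> K m - (\<Union>i. V i)" if "m \<le> n" for m n
            using lift_Suc_antimono_le[of K, OF Kdec that] by blast
        qed
        then obtain x where x: "\<And>n. x \<in> K n" "x \<notin> (\<Union>i. V i)" by blast
        have "x \<in> U n" for n using x(1)[of n] X(2)[of n] unfolding K_def by blast
        moreover have "x \<in> G0"
        proof -
          have "snd (snd (X 0)) \<subseteq> G0" using X(1)[of 0] unfolding mass_stage_def
            by (auto split: prod.splits)
          then show ?thesis using x(1)[of 0] X(2)[of 0] unfolding K_def by blast
        qed
        ultimately have "x \<in> F" unfolding F_def by blast
        then show False using x(2) FV by blast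
      qed
      then obtain n where n: "K n \<subseteq> (\<Union>i. V i)" by blast
      obtain \<mu> D G where Xn: "X (Suc n) = (\<mu>, D, G)" by (cases "X (Suc n)") auto
      have h: "sets \<mu> = sets borel" "\<And>B. B \<in> sets borel \<Longrightarrow> emeasure \<mu> B \<le> ennreal D * emeasure lborel B"
        "open G" "bounded G" "emeasure \<mu> (- G) = 0"
        "\<And>z s. 0 < s \<Longrightarrow> s \<le> s0 \<Longrightarrow> measure \<mu> (ball z s) \<le> 2 * f s"
        "8 * M \<le> measure \<mu> UNIV"
        using X(1)[of "Suc n"] unfolding Xn mass_stage_def by auto
      have GV: "G \<subseteq> (\<Union>i. V i)" using n closure_subset[of G] unfolding K_def Xn by auto
      have bV: "V i \<in> sets borel" for i unfolding V_def by simp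
      have "emeasure \<mu> UNIV \<le> emeasure \<mu> G"
        by (rule emeasure_le_of_null_Diff) (use h in \<open>simp_all add: Compl_eq_Diff_UNIV\<close>)
      also have "\<dots> \<le> emeasure \<mu> (\<Union>i. V i)" using GV bV h(1) by (intro emeasure_mono) auto
      also have "\<dots> \<le> (\<Sum>i. emeasure \<mu> (V i))"
        using bV h(1) by (intro emeasure_subadditive_countably) auto
      also have "\<dots> \<le> (\<Sum>i. ennreal 8 * ennreal (if r i > 0 then f (r i) else 0))"
      proof (rule suminf_le)
        fix i
        show "emeasure \<mu> (V i) \<le> ennreal 8 * ennreal (if r i > 0 then f (r i) else 0)"
        proof (cases "r i > 0")
          case True
          have "emeasure \<mu> (V i) = ennreal (measure \<mu> (V i))"
            by (rule emeasure_finite_of_density_bound[OF h(2) bV]) (auto simp: V_def)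
          also have "measure \<mu> (V i) \<le> 2 * f (2 * r i)"
            unfolding V_def using True r by (intro h(6)) (auto simp: field_simps less_imp_le)
          also have "\<dots> \<le> 8 * f (r i)" using fdouble[OF True] by simp
          finally show ?thesis using True fpos[OF True] by (simp add: ennreal_mult[symmetric] ennreal_leI del: ennreal_numeral)
        next
          case False
          then have "r i = 0" using r by (meson antisym not_le_imp_less)
          then show ?thesis unfolding V_def by simp
        qed
      qed auto
      also have "\<dots> = ennreal 8 * (\<Sum>i. ennreal (if r i > 0 then f (r i) else 0))" by simp
      finally have le: "emeasure \<mu> UNIV \<le> ennreal 8 * (\<Sum>i. ennreal (if r i > 0 then f (r i) else 0))" .
      have "ennreal 8 * ennreal M = ennreal (8 * M)"
        using M by (simp add: ennreal_mult del: ennreal_numeral)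
      also have "\<dots> \<le> ennreal (measure \<mu> UNIV)" using h(7) by (rule ennreal_leI)
      also have "\<dots> \<le> emeasure \<mu> UNIV" unfolding measure_def
        by (cases "emeasure \<mu> UNIV") auto
      also note le
      finally show ?thesis by (subst (asm) ennreal_mult_le_mult_iff) auto
    qed
    then have "ennreal M \<le> (INF cr \<in> {(c :: nat \<Rightarrow> real \<times> real, r :: nat \<Rightarrow> real).
         (\<forall>i. 0 \<le> r i \<and> r i < s0 / 2) \<and> F \<subseteq> (\<Union>i. {z. dd (c i) z < r i})}.
       (\<Sum>i. ennreal (if snd cr i > 0 then f (snd cr i) else 0)))"
      by (intro INF_greatest bnd) (auto simp: case_prod_beta)
    also have "\<dots> \<le> hausdorff_fm dd f F"
      unfolding hausdorff_fm_def using s0 by (intro SUP_upper) auto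
    finally show ?thesis .
  qed
  have "hausdorff_fm dd f F = \<infinity>"
  proof (rule ccontr)
    assume "hausdorff_fm dd f F \<noteq> \<infinity>"
    then obtain x where x: "hausdorff_fm dd f F = ennreal x" "x \<ge> 0"
      by (cases "hausdorff_fm dd f F") auto
    then show False using main[of "x + 1"] by (simp del: ennreal_plus)
  qed
  then show ?thesis unfolding F_def by simp
qed

section \<open>Limsup sets of quasi-independent events\<close>

text \<open>Expand the integral of the square of \<Sum> w_i 1_(A_i) - a 1_E, which is nonnegative.
  This is Cauchy-Schwarz with the parameter \<open>a\<close> left to be optimised later.\<close>

lemma weighted_second_moment_bound:
  fixes A :: "'i \<Rightarrow> 'a set"
  assumes I: "finite I" and A: "\<And>i. i \<in> I \<Longrightarrow> A i \<in> fmeasurable M" and E: "E \<in> fmeasurable M"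
  shows "2 * a * (\<Sum>i\<in>I. w i * measure M (A i \<inter> E))
    \<le> (\<Sum>i\<in>I. \<Sum>j\<in>I. w i * w j * measure M (A i \<inter> A j)) + a\<^sup>2 * measure M E"
proof -
  let ?g = "\<lambda>x. (\<Sum>i\<in>I. w i * indicator (A i) x)"
  have int: "integrable M (indicator (A i \<inter> B) :: 'a \<Rightarrow> real)" if "i \<in> I" "B \<in> sets M" for i B
    using A[OF that(1)] that(2) fmeasurable_Int_fmeasurable[of "A i" M B] by (auto simp: fmeasurable_def)
  have intE: "integrable M (indicator E :: 'a \<Rightarrow> real)" using E by (auto simp: fmeasurable_def)
  have Es: "E \<in> sets M" and As: "\<And>i. i \<in> I \<Longrightarrow> A i \<in> sets M" using E A by auto
  have sq: "(?g x - a * indicator E x)\<^sup>2 =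
      (\<Sum>i\<in>I. \<Sum>j\<in>I. w i * w j * indicator (A i \<inter> A j) x) - 2 * a * (\<Sum>i\<in>I. w i * indicator (A i \<inter> E) x)
      + a\<^sup>2 * indicator E x" for x
  proof -
    have "(?g x)\<^sup>2 = (\<Sum>i\<in>I. \<Sum>j\<in>I. w i * w j * indicator (A i \<inter> A j) x)"
      unfolding power2_eq_square sum_product by (intro sum.cong refl) (auto simp: indicator_def)
    moreover have "?g x * indicator E x = (\<Sum>i\<in>I. w i * indicator (A i \<inter> E) x)"
      unfolding sum_distrib_right by (intro sum.cong refl) (auto simp: indicator_def)
    moreover have "(indicator E x :: real)\<^sup>2 = indicator E x" by (auto simp: indicator_def)
    moreover have "(u - a * v)\<^sup>2 = u\<^sup>2 - 2 * a * (u * v) + a\<^sup>2 * v\<^sup>2" for u v :: real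
      by (simp add: power2_eq_square algebra_simps)
    ultimately show ?thesis by simp
  qed
  have "0 \<le> (\<integral>x. (?g x - a * indicator E x)\<^sup>2 \<partial>M)" by simp
  also have "\<dots> = (\<Sum>i\<in>I. \<Sum>j\<in>I. w i * w j * measure M (A i \<inter> A j))
      - 2 * a * (\<Sum>i\<in>I. w i * measure M (A i \<inter> E)) + a\<^sup>2 * measure M E"
  proof -
    have i1: "integrable M (\<lambda>x. \<Sum>i\<in>I. \<Sum>j\<in>I. w i * w j * indicator (A i \<inter> A j) x)"
      using int As by (intro Bochner_Integration.integrable_sum integrable_mult_right) auto
    have i2: "integrable M (\<lambda>x. 2 * a * (\<Sum>i\<in>I. w i * indicator (A i \<inter> E) x))"
      using int Es by (intro integrable_mult_right Bochner_Integration.integrable_sum) auto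
    have i3: "integrable M (\<lambda>x. a\<^sup>2 * indicator E x)" using intE by (intro integrable_mult_right)
    have "(\<integral>x. (?g x - a * indicator E x)\<^sup>2 \<partial>M)
       = (\<integral>x. (\<Sum>i\<in>I. \<Sum>j\<in>I. w i * w j * indicator (A i \<inter> A j) x) \<partial>M)
       - (\<integral>x. 2 * a * (\<Sum>i\<in>I. w i * indicator (A i \<inter> E) x) \<partial>M) + (\<integral>x. a\<^sup>2 * indicator E x \<partial>M)"
      unfolding sq using i1 i2 i3 by (simp only: Bochner_Integration.integral_add Bochner_Integration.integral_diff Bochner_Integration.integrable_diff)
    also have "(\<integral>x. (\<Sum>i\<in>I. \<Sum>j\<in>I. w i * w j * indicator (A i \<inter> A j) x) \<partial>M)
       = (\<Sum>i\<in>I. \<Sum>j\<in>I. w i * w j * measure M (A i \<inter> A j))"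
    proof -
      have "(\<integral>x. (\<Sum>i\<in>I. \<Sum>j\<in>I. w i * w j * indicator (A i \<inter> A j) x) \<partial>M)
         = (\<Sum>i\<in>I. \<Sum>j\<in>I. \<integral>x. w i * w j * indicator (A i \<inter> A j) x \<partial>M)"
        using int As by (subst Bochner_Integration.integral_sum,
          intro Bochner_Integration.integrable_sum integrable_mult_right, auto)
      also have "\<dots> = (\<Sum>i\<in>I. \<Sum>j\<in>I. w i * w j * measure M (A i \<inter> A j))"
        using As by (intro sum.cong refl) (simp add: Int_absorb1 sets.sets_into_space le_infI1)
      finally show ?thesis .
    qed
    also have "(\<integral>x. 2 * a * (\<Sum>i\<in>I. w i * indicator (A i \<inter> E) x) \<partial>M) = 2 * a * (\<Sum>i\<in>I. w i * measure M (A i \<inter> E))"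
    proof -
      have "(\<integral>x. (\<Sum>i\<in>I. w i * indicator (A i \<inter> E) x) \<partial>M) = (\<Sum>i\<in>I. \<integral>x. w i * indicator (A i \<inter> E) x \<partial>M)"
        using int Es by (intro Bochner_Integration.integral_sum integrable_mult_right) auto
      also have "\<dots> = (\<Sum>i\<in>I. w i * measure M (A i \<inter> E))"
        using sets.sets_into_space[OF Es] by (intro sum.cong refl) (simp add: Int_absorb2 le_infI2)
      finally show ?thesis by simp
    qed
    also have "(\<integral>x. a\<^sup>2 * indicator E x \<partial>M) = a\<^sup>2 * measure M E"
      using Es by (simp add: Int_absorb1 sets.sets_into_space)
    finally show ?thesis .
  qed
  finally show ?thesis by simp
qed

text \<open>If all but finitely many events miss \<open>Z\<close>, the weighted sum over
  \<open>B\<close> lives on E = B - Z up to a constant. By the second moment bound its integral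
  there is at most S sqrt(C |E|) in order of magnitude, and C |E| < \<beta>^2 makes this smaller
  than \<beta> S by a fixed proportion of S. As S tends to infinity, this contradicts the lower
  bound.\<close>

lemma quasi_independent_not_avoidable:
  fixes A :: "'i \<Rightarrow> 'a set" and S :: "nat \<Rightarrow> real"
  assumes X: "X \<in> fmeasurable M" and A: "\<And>i. A i \<in> sets M" "\<And>i. A i \<subseteq> X" and w: "\<And>i. w i \<ge> 0"
    and I: "\<And>n. finite (I n)" and S: "filterlim S at_top sequentially"
    and Z: "Z \<in> sets M" "Z \<subseteq> X" and B: "B \<in> sets M" "B \<subseteq> X" and \<beta>: "\<beta> > 0" and C: "C > 0"
    and CB: "C * measure M (B - Z) < \<beta>\<^sup>2"
    and low: "\<forall>\<^sub>F n in sequentially. \<beta> * S n \<le> (\<Sum>i\<in>I n. w i * measure M (A i \<inter> B))"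
    and upp: "\<forall>\<^sub>F n in sequentially. (\<Sum>i\<in>I n. \<Sum>j\<in>I n. w i * w j * measure M (A i \<inter> A j)) \<le> C * (S n)\<^sup>2"
    and J: "finite J" "\<And>i. i \<notin> J \<Longrightarrow> A i \<inter> Z = {}"
  shows False
proof -
  have fm: "Y \<in> fmeasurable M" if "Y \<in> sets M" "Y \<subseteq> X" for Y using fmeasurableI2[OF X that(2,1)] .
  define E where "E = B - Z"
  have E: "E \<in> fmeasurable M" unfolding E_def using B Z by (intro fm) auto
  define K where "K = (\<Sum>i\<in>J. w i * measure M X)"
  \<comment> \<open>The margin \<beta> - (\<beta>/2 + C |E| / (2\<beta>)) left over after the
    estimate on \<open>E\<close>; it is positive exactly when C |E| < \<beta>^2.\<close>
  define \<gamma> where "\<gamma> = \<beta> / 2 - C * measure M E / (2 * \<beta>)"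
  have \<gamma>: "\<gamma> > 0" using CB \<beta> unfolding \<gamma>_def E_def by (simp add: field_simps power2_eq_square)
  have "\<forall>\<^sub>F n in sequentially. S n > 0" "\<forall>\<^sub>F n in sequentially. S n > K / \<gamma>"
    using S by (simp_all add: filterlim_at_top_dense)
  with low upp have "\<forall>\<^sub>F n in sequentially. False"
  proof eventually_elim
    case (elim n)
    \<comment> \<open>With this value C S^2 / (2a) equals S \<beta>/2, half of the assumed lower
      bound.\<close>
    define a where "a = S n * C / \<beta>"
    have a: "a > 0" unfolding a_def using elim C \<beta> by simp
    have split: "measure M (A i \<inter> B) \<le> measure M (A i \<inter> E) + measure M (A i \<inter> Z)" for i
    proof -
      have "measure M (A i \<inter> B) \<le> measure M ((A i \<inter> E) \<union> (A i \<inter> Z))"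
        using A B Z E by (intro measure_mono_fmeasurable fm) (auto simp: E_def)
      also have "\<dots> \<le> measure M (A i \<inter> E) + measure M (A i \<inter> Z)"
        using A B Z E by (intro measure_Un_le) auto
      finally show ?thesis .
    qed
    have "\<beta> * S n \<le> (\<Sum>i\<in>I n. w i * measure M (A i \<inter> B))" using elim by simp
    also have "\<dots> \<le> (\<Sum>i\<in>I n. w i * measure M (A i \<inter> E)) + (\<Sum>i\<in>I n. w i * measure M (A i \<inter> Z))"
      unfolding sum.distrib[symmetric] distrib_left[symmetric] using split w by (intro sum_mono mult_left_mono) auto
    also have "(\<Sum>i\<in>I n. w i * measure M (A i \<inter> Z)) \<le> K"
    proof -
      have "(\<Sum>i\<in>I n. w i * measure M (A i \<inter> Z)) = (\<Sum>i\<in>I n \<inter> J. w i * measure M (A i \<inter> Z))"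
        using I J by (intro sum.mono_neutral_right) auto
      also have "\<dots> \<le> (\<Sum>i\<in>I n \<inter> J. w i * measure M X)"
        using w A Z X by (intro sum_mono mult_left_mono measure_mono_fmeasurable) auto
      also have "\<dots> \<le> K" unfolding K_def using w J by (intro sum_mono2) auto
      finally show ?thesis .
    qed
    also have "(\<Sum>i\<in>I n. w i * measure M (A i \<inter> E)) \<le> S n * \<beta> / 2 + S n * C * measure M E / (2 * \<beta>)"
    proof -
      have "2 * a * (\<Sum>i\<in>I n. w i * measure M (A i \<inter> E)) \<le> C * (S n)\<^sup>2 + a\<^sup>2 * measure M E"
        using weighted_second_moment_bound[of "I n" A M E a w] I A E fm elim(2) by fastforce
      then have "(\<Sum>i\<in>I n. w i * measure M (A i \<inter> E)) \<le> (C * (S n)\<^sup>2 + a\<^sup>2 * measure M E) / (2 * a)"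
        using a by (simp add: field_simps)
      also have "\<dots> = S n * \<beta> / 2 + S n * C * measure M E / (2 * \<beta>)"
        using elim C \<beta> unfolding a_def by (simp add: field_simps power2_eq_square)
      finally show ?thesis .
    qed
    finally have "S n * \<gamma> \<le> K" unfolding \<gamma>_def by (simp add: algebra_simps)
    moreover have "S n * \<gamma> > K" using elim \<gamma> by (simp add: field_simps)
    ultimately show False by simp
  qed
  then show False by simp
qed

text \<open>A point lying in only finitely many events belongs to \<open>Z J\<close> for the finite
  set J of their indices. The index type is countable, so there are countably many J and each
  \<open>Z J\<close> can be treated alone. The test set \<open>B\<close> may depend on
  \<open>Z\<close>, which lets rough correlation bounds still lead to full measure.\<close>

theorem quasi_independent_limsup_full:
  fixes A :: "'i::countable \<Rightarrow> 'a set" and S :: "nat \<Rightarrow> real"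
  assumes X: "X \<in> fmeasurable M" and A: "\<And>i. A i \<in> sets M" "\<And>i. A i \<subseteq> X" and w: "\<And>i. w i \<ge> 0"
    and I: "\<And>n. finite (I n)" and S: "filterlim S at_top sequentially"
    and test: "\<And>Z. Z \<in> sets M \<Longrightarrow> Z \<subseteq> X \<Longrightarrow> measure M Z > 0 \<Longrightarrow> \<exists>B\<in>sets M. B \<subseteq> X \<and> (\<exists>\<beta>>0. \<exists>C>0.
      C * measure M (B - Z) < \<beta>\<^sup>2 \<and>
      (\<forall>\<^sub>F n in sequentially. \<beta> * S n \<le> (\<Sum>i\<in>I n. w i * measure M (A i \<inter> B))) \<and>
      (\<forall>\<^sub>F n in sequentially. (\<Sum>i\<in>I n. \<Sum>j\<in>I n. w i * w j * measure M (A i \<inter> A j)) \<le> C * (S n)\<^sup>2))"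
  shows "AE x in M. x \<in> X \<longrightarrow> infinite {i. x \<in> A i}"
proof -
  define Z where "Z J = X - (\<Union>i\<in>-J. A i)" for J
  have Zs: "Z J \<in> sets M" for J
    unfolding Z_def using X A(1) by (intro sets.Diff sets.countable_UN') auto
  have ZX: "Z J \<subseteq> X" for J unfolding Z_def by auto
  have null: "Z J \<in> null_sets M" if J: "finite J" for J
  proof (rule ccontr)
    assume "Z J \<notin> null_sets M"
    moreover have "Z J \<in> fmeasurable M" using fmeasurableI2[OF X ZX Zs] .
    ultimately have "measure M (Z J) \<noteq> 0" using Zs emeasure_eq_measure2[of "Z J" M] by (auto intro: null_setsI)
    then have "measure M (Z J) > 0" by (simp add: zero_less_measure_iff)
    from test[OF Zs ZX this] obtain B \<beta> C where h: "B \<in> sets M" "B \<subseteq> X" "\<beta> > 0" "C > 0"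
      "C * measure M (B - Z J) < \<beta>\<^sup>2"
      "\<forall>\<^sub>F n in sequentially. \<beta> * S n \<le> (\<Sum>i\<in>I n. w i * measure M (A i \<inter> B))"
      "\<forall>\<^sub>F n in sequentially. (\<Sum>i\<in>I n. \<Sum>j\<in>I n. w i * w j * measure M (A i \<inter> A j)) \<le> C * (S n)\<^sup>2" by blast
    have "A i \<inter> Z J = {}" if "i \<notin> J" for i using that unfolding Z_def by auto
    from quasi_independent_not_avoidable[OF X A w I S Zs ZX h J this] show False .
  qed
  have "AE x in M. \<forall>J\<in>{J. finite J}. x \<notin> Z J"
    using null by (intro AE_ball_countable' AE_not_in countable_Collect_finite) auto
  then show ?thesis
  proof eventually_elim
    case (elim x)
    show ?case
    proof (intro impI notI)
      assume "x \<in> X" "finite {i. x \<in> A i}"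
      then have "x \<in> Z {i. x \<in> A i}" unfolding Z_def by auto
      then show False using elim \<open>finite {i. x \<in> A i}\<close> by blast
    qed
  qed
qed

section \<open>Integrals of periodic functions\<close>

text \<open>The half-open interval lets consecutive periods tile the line exactly, and values in
  \<open>ennreal\<close> free Fubini from integrability conditions.\<close>

definition unit_integral :: "(real \<Rightarrow> ennreal) \<Rightarrow> ennreal" where
  "unit_integral h = (\<integral>\<^sup>+x. h x * indicator {0..<1} x \<partial>lborel)"

lemma periodic_int:
  fixes h :: "real \<Rightarrow> 'b"
  assumes "\<And>x. h (x + 1) = h x"
  shows "h (x + of_int n) = h x"
proof -
  have nat: "h (x + real n) = h x" for x n
  proof (induction n)
    case (Suc n)
    have "h (x + real (Suc n)) = h ((x + real n) + 1)" by (simp add: ac_simps)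
    then show ?case using Suc assms by simp
  qed simp
  show ?thesis
  proof (cases "n \<ge> 0")
    case True
    then show ?thesis using nat[of x "nat n"] by simp
  next
    case False
    then show ?thesis using nat[of "x + of_int n" "nat (- n)"] by simp
  qed
qed

lemma nn_integral_shift:
  fixes h :: "real \<Rightarrow> ennreal"
  assumes [measurable]: "h \<in> borel_measurable borel"
  shows "(\<integral>\<^sup>+x. h x * indicator {a + t..<b + t} x \<partial>lborel) = (\<integral>\<^sup>+x. h (x + t) * indicator {a..<b} x \<partial>lborel)"
  by (subst nn_integral_real_affine[where c = 1 and t = t])
     (auto simp: ac_simps intro!: nn_integral_cong split: split_indicator)

lemma nn_integral_split:
  fixes h :: "real \<Rightarrow> ennreal"
  assumes [measurable]: "h \<in> borel_measurable borel" and "a \<le> b" "b \<le> c"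
  shows "(\<integral>\<^sup>+x. h x * indicator {a..<c} x \<partial>lborel) =
    (\<integral>\<^sup>+x. h x * indicator {a..<b} x \<partial>lborel) + (\<integral>\<^sup>+x. h x * indicator {b..<c} x \<partial>lborel)"
  using assms(2,3) by (subst nn_integral_add[symmetric]) (auto intro!: nn_integral_cong split: split_indicator)

text \<open>Cut at the integer in (a, a + 1] and move the right-hand part back by one
  period.\<close>

lemma nn_integral_period:
  fixes h :: "real \<Rightarrow> ennreal"
  assumes [measurable]: "h \<in> borel_measurable borel" and per: "\<And>x. h (x + 1) = h x"
  shows "(\<integral>\<^sup>+x. h x * indicator {a..<a + 1} x \<partial>lborel) = unit_integral h"
proof -
  define m :: real where "m = of_int \<lfloor>a\<rfloor>"
  have m: "m \<le> a" "a \<le> m + 1" unfolding m_def by linarith+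
  have sh: "(\<integral>\<^sup>+x. h x * indicator {u + of_int n..<v + of_int n} x \<partial>lborel) = (\<integral>\<^sup>+x. h x * indicator {u..<v} x \<partial>lborel)" for u v n
    by (subst nn_integral_shift) (simp_all add: periodic_int[of h, OF per])
  have "(\<integral>\<^sup>+x. h x * indicator {a..<a + 1} x \<partial>lborel) =
      (\<integral>\<^sup>+x. h x * indicator {a..<m + 1} x \<partial>lborel) + (\<integral>\<^sup>+x. h x * indicator {m + 1..<a + 1} x \<partial>lborel)"
    using m by (intro nn_integral_split) auto
  also have "(\<integral>\<^sup>+x. h x * indicator {m + 1..<a + 1} x \<partial>lborel) = (\<integral>\<^sup>+x. h x * indicator {m..<a} x \<partial>lborel)"
    using sh[of m 1 a] by simp
  also have "(\<integral>\<^sup>+x. h x * indicator {a..<m + 1} x \<partial>lborel) + (\<integral>\<^sup>+x. h x * indicator {m..<a} x \<partial>lborel) =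
      (\<integral>\<^sup>+x. h x * indicator {m..<m + 1} x \<partial>lborel)"
    using m by (subst nn_integral_split[of h m a "m + 1"]) (auto simp: ac_simps)
  also have "\<dots> = unit_integral h" using sh[of 0 "\<lfloor>a\<rfloor>" 1] unfolding m_def unit_integral_def by (simp add: ac_simps)
  finally show ?thesis .
qed

lemma nn_integral_periods:
  fixes h :: "real \<Rightarrow> ennreal"
  assumes [measurable]: "h \<in> borel_measurable borel" and per: "\<And>x. h (x + 1) = h x"
  shows "(\<integral>\<^sup>+x. h x * indicator {a..<a + real n} x \<partial>lborel) = of_nat n * unit_integral h"
proof (induction n)
  case (Suc n)
  have "(\<integral>\<^sup>+x. h x * indicator {a..<a + real (Suc n)} x \<partial>lborel) =
     (\<integral>\<^sup>+x. h x * indicator {a..<a + real n} x \<partial>lborel) + (\<integral>\<^sup>+x. h x * indicator {a + real n..<a + real n + 1} x \<partial>lborel)"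
    by (subst nn_integral_split[of h a "a + real n"]) (auto simp: ac_simps)
  also have "\<dots> = of_nat n * unit_integral h + unit_integral h"
    unfolding Suc by (subst nn_integral_period[OF assms]) simp
  finally show ?case by (simp add: algebra_simps)
qed simp

lemma nn_integral_scale:
  fixes h :: "real \<Rightarrow> ennreal"
  assumes [measurable]: "h \<in> borel_measurable borel" and c: "c > 0"
  shows "(\<integral>\<^sup>+x. h x * indicator {t + c * a..<t + c * b} x \<partial>lborel)
    = ennreal c * (\<integral>\<^sup>+x. h (t + c * x) * indicator {a..<b} x \<partial>lborel)"
proof -
  have i: "indicator {t + c * a..<t + c * b} (t + c * x) = (indicator {a..<b} x :: ennreal)" for x
    using c by (auto simp: indicator_def)
  show ?thesis using c by (subst nn_integral_real_affine[where c = c and t = t]) (auto simp: i)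
qed

text \<open>The map x -> t + n x runs through n periods, and this factor n cancels the one from the
  change of variables.\<close>

lemma unit_integral_affine_pos:
  fixes h :: "real \<Rightarrow> ennreal"
  assumes [measurable]: "h \<in> borel_measurable borel" and per: "\<And>x. h (x + 1) = h x" and n: "n > 0"
  shows "unit_integral (\<lambda>x. h (t + real n * x)) = unit_integral h"
proof -
  have "of_nat n * unit_integral h = (\<integral>\<^sup>+x. h x * indicator {t..<t + real n} x \<partial>lborel)"
    by (rule nn_integral_periods[OF assms(1,2), symmetric])
  also have "\<dots> = ennreal (real n) * unit_integral (\<lambda>x. h (t + real n * x))"
    using nn_integral_scale[of h "real n" t 0 1] n unfolding unit_integral_def by simp
  finally show ?thesis using n
    by (simp add: ennreal_of_nat_eq_real_of_nat ennreal_mult_cancel_left)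
qed

lemma unit_integral_reflect:
  fixes h :: "real \<Rightarrow> ennreal"
  assumes [measurable]: "h \<in> borel_measurable borel" and per: "\<And>x. h (x + 1) = h x"
  shows "unit_integral (\<lambda>x. h (- x)) = unit_integral h"
proof -
  have "unit_integral h = (\<integral>\<^sup>+x. h (- x) * indicator {0..<1} (- x) \<partial>lborel)"
    unfolding unit_integral_def by (subst nn_integral_real_affine[where c = "-1" and t = 0]) auto
  also have "\<dots> = (\<integral>\<^sup>+x. h (- x) * indicator {-1..<0} x \<partial>lborel)"
  \<comment> \<open>Reflection moves the closed end of the interval to the other side, so equality
    holds only off the two endpoints.\<close>
  proof (rule nn_integral_cong_AE)
    have "AE x in lborel. x \<noteq> (0::real)" "AE x in lborel. x \<noteq> (-1::real)"
      by (rule AE_lborel_singleton)+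
    then show "AE x in lborel. h (- x) * indicator {0..<1} (- x) = h (- x) * indicator {-1..<0::real} x"
      by eventually_elim (auto split: split_indicator)
  qed
  also have "\<dots> = unit_integral (\<lambda>x. h (- x))"
  proof -
    have "h (- (x + 1)) = h (- x)" for x using per[of "- x - 1"] by simp
    then show ?thesis using nn_integral_period[of "\<lambda>x. h (- x)" "-1"] by simp
  qed
  finally show ?thesis ..
qed

lemma unit_integral_affine:
  fixes h :: "real \<Rightarrow> ennreal"
  assumes [measurable]: "h \<in> borel_measurable borel" and per: "\<And>x. h (x + 1) = h x" and n: "n \<noteq> 0"
  shows "unit_integral (\<lambda>x. h (t + of_int n * x)) = unit_integral h"
proof (cases "n > 0")
  case True
  then show ?thesis using unit_integral_affine_pos[of h "nat n" t] per by simp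
next
  case False
  have "unit_integral (\<lambda>x. h (t + of_int n * x)) = unit_integral (\<lambda>x. h (t + of_int n * (- x)))"
  proof (rule unit_integral_reflect[symmetric])
    show "h (t + of_int n * (x + 1)) = h (t + of_int n * x)" for x
      using periodic_int[of h "t + of_int n * x" n, OF per] by (simp add: algebra_simps)
  qed simp
  also have "\<dots> = unit_integral h"
    using unit_integral_affine_pos[of h "nat (- n)" t] per False n by simp
  finally show ?thesis .
qed

section \<open>Neighbourhoods modulo 1\<close>

definition near :: "real \<Rightarrow> real \<Rightarrow> real \<Rightarrow> bool" where
  "near y \<psi> x \<longleftrightarrow> (\<exists>p::int. \<bar>x + of_int p - y\<bar> < \<psi>)"

abbreviation simultaneous_hits :: "(nat \<Rightarrow> real) \<Rightarrow> real \<Rightarrow> real \<Rightarrow> real \<times> real \<Rightarrow> nat set" where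
  "simultaneous_hits \<psi> y1 y2 x \<equiv> {q. q > 0 \<and> near y1 (\<psi> q) (real q * fst x) \<and> near y2 (\<psi> q) (real q * snd x)}"

text \<open>A totative j of k satisfies j \<le> k, so (k, j) has max norm k. As
  \<open>totatives 0\<close> is empty, the zero vector never occurs.\<close>

abbreviation linear_form_hits :: "(nat \<Rightarrow> real) \<Rightarrow> real \<Rightarrow> real \<times> real \<Rightarrow> (nat \<times> nat) set" where
  "linear_form_hits \<psi> y x \<equiv> {(k, j). j \<in> totatives k \<and> near y (\<psi> k) (real k * fst x + real j * snd x)}"

lemma near_periodic: "near y \<psi> (x + 1) = near y \<psi> x"
proof -
  have "\<exists>p::int. \<bar>x + of_int p - y\<bar> < \<psi>" if "\<bar>x + 1 + of_int p - y\<bar> < \<psi>" for p :: int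
    using that by (intro exI[of _ "p + 1"]) (simp add: ac_simps)
  moreover have "\<exists>p::int. \<bar>x + 1 + of_int p - y\<bar> < \<psi>" if "\<bar>x + of_int p - y\<bar> < \<psi>" for p :: int
    using that by (intro exI[of _ "p - 1"]) (simp add: ac_simps)
  ultimately show ?thesis unfolding near_def by blast
qed

lemma near_of_int: "near y \<psi> (x + of_int n) = near y \<psi> x"
  by (rule periodic_int) (rule near_periodic)

lemma open_near: "open {x. near y \<psi> x}"
proof -
  have "{x. near y \<psi> x} = (\<Union>p::int. {x. \<bar>x + of_int p - y\<bar> < \<psi>})" unfolding near_def by auto
  also have "open \<dots>" by (intro open_UN ballI open_Collect_less continuous_intros)
  finally show ?thesis .
qed

lemma near_measurable [measurable]: "Measurable.pred borel (near y \<psi>)"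
  using open_near[of y \<psi>] by (auto simp: pred_def)

text \<open>On the period centred at y only the translate p = 0 can come within \<psi> \<le> 1/2, so
  the set is a single interval there.\<close>

lemma unit_integral_near:
  assumes "0 \<le> \<psi>" "\<psi> \<le> 1/2"
  shows "unit_integral (\<lambda>x. indicator {x. near y \<psi> x} x) = ennreal (2 * \<psi>)"
proof -
  have "unit_integral (\<lambda>x. indicator {x. near y \<psi> x} x) =
     (\<integral>\<^sup>+x. indicator {x. near y \<psi> x} x * indicator {y - 1/2..<y - 1/2 + 1} x \<partial>lborel)"
    by (rule nn_integral_period[symmetric]) (auto simp: near_periodic indicator_def)
  also have "\<dots> = (\<integral>\<^sup>+x. indicator {y - \<psi><..<y + \<psi>} x \<partial>lborel)"
  proof (intro nn_integral_cong)
    fix x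
    have "near y \<psi> x \<longleftrightarrow> \<bar>x - y\<bar> < \<psi>" if "y - 1/2 \<le> x" "x < y - 1/2 + 1"
    proof
      assume "near y \<psi> x"
      then obtain p :: int where p: "\<bar>x + of_int p - y\<bar> < \<psi>" unfolding near_def by blast
      then have "\<bar>of_int p :: real\<bar> < 1" using that assms by linarith
      then have "p = 0" by linarith
      then show "\<bar>x - y\<bar> < \<psi>" using p by simp
    qed (auto simp: near_def intro: exI[of _ 0])
    then show "indicator {x. near y \<psi> x} x * indicator {y - 1/2..<y - 1/2 + 1} x = (indicator {y - \<psi><..<y + \<psi>} x :: ennreal)"
      using assms by (auto simp: indicator_def abs_less_iff)
  qed
  also have "\<dots> = ennreal (2 * \<psi>)" using assms by simp
  finally show ?thesis .
qed

section \<open>Iterated integrals over the torus\<close>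

definition torus :: "(real \<times> real) set" where "torus = {0..<1} \<times> {0..<1}"

lemma torus_fmeasurable: "torus \<in> fmeasurable lborel" "measure lborel torus = 1"
proof -
  have "emeasure lborel torus = emeasure lborel {0..<1::real} * emeasure lborel {0..<1::real}"
    unfolding torus_def lborel_prod[symmetric] by (intro lborel.emeasure_pair_measure_Times) auto
  then have "emeasure lborel torus = 1" by simp
  moreover have "torus \<in> sets lborel" unfolding torus_def by (simp add: borel_Times)
  ultimately show "torus \<in> fmeasurable lborel" "measure lborel torus = 1"
    by (auto simp: fmeasurable_def measure_def)
qed

lemma unit_integral_measurable [measurable]:
  assumes [measurable]: "(\<lambda>(u, v). H u v) \<in> borel_measurable (borel \<Otimes>\<^sub>M borel)"
  shows "(\<lambda>u. unit_integral (\<lambda>v. H u v)) \<in> borel_measurable borel"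
  unfolding unit_integral_def by measurable

lemma unit_integral_swap:
  assumes [measurable]: "(\<lambda>(u, v). H u v) \<in> borel_measurable (borel \<Otimes>\<^sub>M borel)"
  shows "unit_integral (\<lambda>u. unit_integral (\<lambda>v. H u v)) = unit_integral (\<lambda>v. unit_integral (\<lambda>u. H u v))"
proof -
  have "unit_integral (\<lambda>u. unit_integral (\<lambda>v. H u v)) =
      (\<integral>\<^sup>+u. \<integral>\<^sup>+v. H u v * indicator {0..<1} v * indicator {0..<1} u \<partial>lborel \<partial>lborel)"
    unfolding unit_integral_def by (simp add: nn_integral_multc)
  also have "\<dots> = (\<integral>\<^sup>+v. \<integral>\<^sup>+u. H u v * indicator {0..<1} v * indicator {0..<1} u \<partial>lborel \<partial>lborel)"
    by (intro lborel_pair.Fubini') measurable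
  also have "\<dots> = (\<integral>\<^sup>+v. \<integral>\<^sup>+u. (H u v * indicator {0..<1} u) * indicator {0..<1} v \<partial>lborel \<partial>lborel)"
    by (simp add: ac_simps)
  also have "\<dots> = unit_integral (\<lambda>v. unit_integral (\<lambda>u. H u v))"
    unfolding unit_integral_def by (simp add: nn_integral_multc)
  finally show ?thesis .
qed

lemma emeasure_torus:
  assumes [measurable]: "{x. P (fst x) (snd x)} \<in> sets borel"
  shows "emeasure lborel {x \<in> torus. P (fst x) (snd x)}
    = unit_integral (\<lambda>u. unit_integral (\<lambda>v. indicator {x. P (fst x) (snd x)} (u, v)))"
proof -
  let ?S = "{x. P (fst x) (snd x)}"
  have [measurable]: "?S \<in> sets (borel \<Otimes>\<^sub>M borel)" by (subst borel_prod) (rule assms)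
  have eq: "{x \<in> torus. P (fst x) (snd x)} = ?S \<inter> torus" by auto
  have "emeasure lborel {x \<in> torus. P (fst x) (snd x)} = (\<integral>\<^sup>+x. indicator (?S \<inter> torus) x \<partial>lborel)"
    unfolding eq
    using assms torus_fmeasurable(1) by (subst nn_integral_indicator) (auto simp: fmeasurable_def)
  also have "\<dots> = (\<integral>\<^sup>+x. indicator ?S x * indicator {0..<1} (snd x) * indicator {0..<1} (fst x) \<partial>(lborel \<Otimes>\<^sub>M lborel))"
    unfolding lborel_prod by (intro nn_integral_cong) (auto simp: torus_def indicator_def)
  also have "\<dots> = (\<integral>\<^sup>+u. \<integral>\<^sup>+v. indicator ?S (u, v) * indicator {0..<1} v * indicator {0..<1} u \<partial>lborel \<partial>lborel)"
  proof -
    have "(indicator ?S :: _ \<Rightarrow> ennreal) \<in> borel_measurable (lborel \<Otimes>\<^sub>M lborel)"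
      unfolding lborel_prod using assms by simp
    moreover have "(\<lambda>x. indicator {0..<1::real} (snd x) :: ennreal) \<in> borel_measurable (lborel \<Otimes>\<^sub>M lborel)"
      "(\<lambda>x. indicator {0..<1::real} (fst x) :: ennreal) \<in> borel_measurable (lborel \<Otimes>\<^sub>M lborel)"
      by (intro measurable_compose[OF measurable_snd] measurable_compose[OF measurable_fst]; simp)+
    ultimately have "(\<lambda>x. indicator ?S x * indicator {0..<1} (snd x) * indicator {0..<1} (fst x) :: ennreal)
        \<in> borel_measurable (lborel \<Otimes>\<^sub>M lborel)" by (intro borel_measurable_times_ennreal)
    from lborel.nn_integral_fst[OF this] show ?thesis by simp
  qed
  also have "\<dots> = unit_integral (\<lambda>u. unit_integral (\<lambda>v. indicator ?S (u, v)))"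
    unfolding unit_integral_def by (simp add: nn_integral_multc)
  finally show ?thesis .
qed

lemma unit_integral_shift:
  fixes h :: "real \<Rightarrow> ennreal"
  assumes "h \<in> borel_measurable borel" "\<And>x. h (x + 1) = h x"
  shows "unit_integral (\<lambda>x. h (x + t)) = unit_integral h"
  using unit_integral_affine_pos[OF assms, of 1 t] by (simp add: add.commute)

lemma unit_integral_cmult:
  fixes h :: "real \<Rightarrow> ennreal"
  assumes "h \<in> borel_measurable borel"
  shows "unit_integral (\<lambda>x. c * h x) = c * unit_integral h"
  unfolding unit_integral_def using assms by (simp add: mult.assoc nn_integral_cmult)

lemma unit_integral_const: "unit_integral (\<lambda>x. c) = c"
  unfolding unit_integral_def by (simp add: nn_integral_cmult_indicator)

text \<open>Translating by \<open>s (- j, k)\<close> fixes the first factor and shifts the second one by \<open>s (k j' - j k')\<close>;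
  averaging over \<open>s\<close> separates the two.\<close>
lemma unit_integral_independent:
  fixes F G :: "real \<Rightarrow> ennreal" and k j k' j' :: int
  assumes [measurable]: "F \<in> borel_measurable borel" "G \<in> borel_measurable borel"
    and per: "\<And>x. F (x + 1) = F x" "\<And>x. G (x + 1) = G x"
    and det: "k * j' \<noteq> j * k'" and j: "j \<noteq> 0"
  shows "unit_integral (\<lambda>u. unit_integral (\<lambda>v. F (of_int k * u + of_int j * v) * G (of_int k' * u + of_int j' * v)))
    = unit_integral F * unit_integral G"
proof -
  define H where "H u v = F (of_int k * u + of_int j * v) * G (of_int k' * u + of_int j' * v)" for u v
  have Hm [measurable]: "(\<lambda>(u, v). H u v) \<in> borel_measurable (borel \<Otimes>\<^sub>M borel)"
    unfolding H_def by measurable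
  have Hm1 [measurable]: "(\<lambda>v. H u (v + c)) \<in> borel_measurable borel" for u c
    unfolding H_def by measurable
  have Hper: "H (u + 1) v = H u v" "H u (v + 1) = H u v" for u v
    using periodic_int[of F, OF per(1), of "of_int k * u + of_int j * v" k]
      periodic_int[of G, OF per(2), of "of_int k' * u + of_int j' * v" k']
      periodic_int[of F, OF per(1), of "of_int k * u + of_int j * v" j]
      periodic_int[of G, OF per(2), of "of_int k' * u + of_int j' * v" j']
    unfolding H_def by (simp_all add: algebra_simps)
  \<comment> \<open>The determinant of the two integer vectors. It is nonzero, so s -> \<Delta> s
    again covers the circle uniformly and the average over s replaces \<open>G\<close> by its
    integral.\<close>
  define \<Delta> where "\<Delta> = k * j' - j * k'"
  have shifted: "unit_integral (\<lambda>u. unit_integral (\<lambda>v. H u v))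
      = unit_integral (\<lambda>u. unit_integral (\<lambda>v. F (of_int k * u + of_int j * v) *
          G (of_int k' * u + of_int j' * v + of_int \<Delta> * s)))" for s
  proof -
    have "unit_integral (\<lambda>u. unit_integral (\<lambda>v. H u v))
        = unit_integral (\<lambda>u. unit_integral (\<lambda>v. H (u + (- (of_int j * s))) v))"
      by (rule unit_integral_shift[symmetric]) (auto simp: Hper)
    also have "\<dots> = unit_integral (\<lambda>u. unit_integral (\<lambda>v. H (u + (- (of_int j * s))) (v + of_int k * s)))"
      using Hm1[of _ 0] by (subst unit_integral_shift) (auto simp: Hper)
    also have "\<dots> = unit_integral (\<lambda>u. unit_integral (\<lambda>v. F (of_int k * u + of_int j * v) *
          G (of_int k' * u + of_int j' * v + of_int \<Delta> * s)))"
      unfolding H_def \<Delta>_def by (simp add: algebra_simps)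
    finally show ?thesis .
  qed
  have "unit_integral (\<lambda>u. unit_integral (\<lambda>v. H u v))
      = unit_integral (\<lambda>s. unit_integral (\<lambda>u. unit_integral (\<lambda>v. F (of_int k * u + of_int j * v) *
          G (of_int k' * u + of_int j' * v + of_int \<Delta> * s))))"
    unfolding shifted[symmetric] unit_integral_const ..
  also have "\<dots> = unit_integral (\<lambda>u. unit_integral (\<lambda>s. unit_integral (\<lambda>v. F (of_int k * u + of_int j * v) *
          G (of_int k' * u + of_int j' * v + of_int \<Delta> * s))))"
    unfolding unit_integral_def by (intro unit_integral_swap[unfolded unit_integral_def]) measurable
  also have "\<dots> = unit_integral (\<lambda>u. unit_integral (\<lambda>v. unit_integral (\<lambda>s. F (of_int k * u + of_int j * v) *
          G (of_int k' * u + of_int j' * v + of_int \<Delta> * s))))"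
    by (intro arg_cong[where f = unit_integral] ext unit_integral_swap) measurable
  also have "\<dots> = unit_integral (\<lambda>u. unit_integral (\<lambda>v. F (of_int k * u + of_int j * v) * unit_integral G))"
  proof -
    have "unit_integral (\<lambda>s. F (of_int k * u + of_int j * v) * G (of_int k' * u + of_int j' * v + of_int \<Delta> * s))
        = F (of_int k * u + of_int j * v) * unit_integral G" for u v
    proof -
      have "\<Delta> \<noteq> 0" using det unfolding \<Delta>_def by simp
      from unit_integral_affine[of G \<Delta>, OF _ per(2) this] show ?thesis
        by (subst unit_integral_cmult) simp_all
    qed
    then show ?thesis by simp
  qed
  also have "\<dots> = unit_integral (\<lambda>u. unit_integral G * unit_integral (\<lambda>v. F (of_int k * u + of_int j * v)))"
    by (subst mult.commute, subst unit_integral_cmult) simp_all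
  \<comment> \<open>For fixed u, the map v -> k u + j v covers the circle uniformly because j
    \<noteq> 0.\<close>
  also have "\<dots> = unit_integral (\<lambda>u. unit_integral G * unit_integral F)"
    using j per(1) by (subst unit_integral_affine) simp_all
  also have "\<dots> = unit_integral F * unit_integral G" by (simp add: unit_integral_const mult.commute)
  finally show ?thesis unfolding H_def .
qed

section \<open>Linear forms: full measure\<close>

lemma sets_near_linear: "{x :: real \<times> real. near y c (a * fst x + b * snd x)} \<in> sets borel"
proof -
  have "open ((\<lambda>x :: real \<times> real. a * fst x + b * snd x) -` {t. near y c t})"
    by (intro open_vimage open_near continuous_intros)
  then show ?thesis by (simp add: vimage_def)
qed

lemma near_of_half: "c > 1 / 2 \<Longrightarrow> near y c x"
  unfolding near_def using of_int_round_abs_le[of "y - x"]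
  by (intro exI[of _ "round (y - x)"]) (simp add: abs_if split: if_splits)

text \<open>Radii above 1/2 hit every point, and 1 is a totative of every positive k. This disposes
  of the radii for which the neighbourhoods no longer have measure 2\<psi>.\<close>

lemma infinite_linear_form_hits:
  assumes "infinite {k. \<psi> k > 1 / 2}"
  shows "infinite (linear_form_hits \<psi> y x)"
proof -
  have "infinite ((\<lambda>k. (k, 1 :: nat)) ` ({k. \<psi> k > 1 / 2} - {0}))"
    using assms by (subst finite_image_iff) (auto simp: inj_on_def)
  moreover have "(\<lambda>k. (k, 1 :: nat)) ` ({k. \<psi> k > 1 / 2} - {0}) \<subseteq> linear_form_hits \<psi> y x"
    by (auto simp: totatives_def near_of_half)
  ultimately show ?thesis by (rule infinite_super[rotated])
qed

lemma infinite_simultaneous_hits: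
  assumes "infinite {q. \<psi> q > 1 / 2}"
  shows "infinite (simultaneous_hits \<psi> y1 y2 x)"
proof (rule infinite_super)
  show "infinite ({q. \<psi> q > 1 / 2} - {0})" using assms by simp
qed (auto simp: near_of_half)

lemma near_zero: "c \<le> 0 \<Longrightarrow> \<not> near y c x"
  unfolding near_def by (simp add: not_less) (meson abs_ge_zero order_trans)

text \<open>Proportional primitive vectors with positive first entry coincide. This supplies the
  nonzero determinant for two different hits.\<close>

lemma coprime_cross_mult:
  fixes k j k' j' :: nat
  assumes "coprime j k" "coprime j' k'" "k > 0" "k' > 0" "k * j' = j * k'"
  shows "k = k' \<and> j = j'"
proof -
  have "k dvd j * k'" "k' dvd j' * k" using assms(5) by (metis dvd_triv_left, metis dvd_triv_right mult.commute)
  then have "k dvd k'" "k' dvd k"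
    using assms(1,2) by (simp_all add: coprime_dvd_mult_right_iff coprime_commute)
  then have "k = k'" by (rule dvd_antisym)
  then show ?thesis using assms(3,5) by simp
qed

lemma filterlim_partial_sums_at_top:
  fixes a :: "nat \<Rightarrow> real"
  assumes "\<not> summable a" "\<And>n. a n \<ge> 0"
  shows "filterlim (\<lambda>n. \<Sum>i\<le>n. a i) at_top sequentially"
proof (rule ccontr)
  have mono: "mono (\<lambda>n. \<Sum>i\<le>n. a i)" using assms(2) by (intro monoI sum_mono2) auto
  assume "\<not> filterlim (\<lambda>n. \<Sum>i\<le>n. a i) at_top sequentially"
  then obtain b where b: "\<not> (\<forall>\<^sub>F n in sequentially. b \<le> (\<Sum>i\<le>n. a i))"
    unfolding filterlim_at_top by blast
  have "(\<Sum>i\<le>n. a i) \<le> b" for n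
  proof (rule ccontr)
    assume "\<not> (\<Sum>i\<le>n. a i) \<le> b"
    then have "\<forall>m\<ge>n. b \<le> (\<Sum>i\<le>m. a i)" using monoD[OF mono, of n] by force
    then show False using b unfolding eventually_sequentially by blast
  qed
  then have "summable a" by (rule bounded_imp_summable[OF assms(2)])
  then show False using assms(1) by simp
qed

text \<open>Pairwise independence makes the second moment at most S^2 + S. So \<open>C\<close> may
  be taken as close to 1 as desired, and the whole torus with \<beta> = 1 serves as test set for
  every \<open>Z\<close> of positive measure.\<close>

lemma linear_form_limsup_full_small:
  assumes psi: "\<And>k. 0 \<le> \<psi> k" "\<And>k. \<psi> k \<le> 1 / 2" and div: "\<not> summable (\<lambda>k. real (totient k) * \<psi> k)"
  shows "AE x in lborel. x \<in> torus \<longrightarrow>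
    infinite (linear_form_hits \<psi> y x)"
proof -
  define P where "P i x \<longleftrightarrow> near y (\<psi> (fst i)) (real (fst i) * fst x + real (snd i) * snd x)"
    for i :: "nat \<times> nat" and x :: "real \<times> real"
  define A where "A i = (if snd i \<in> totatives (fst i) then {x \<in> torus. P i x} else {})" for i
  define I where "I n = Sigma {..n} totatives" for n :: nat
  define S where "S n = (\<Sum>i\<in>I n. measure lborel (A i))" for n
  have Ps: "{x. P i x} \<in> sets borel" for i unfolding P_def by (rule sets_near_linear)
  have As: "A i \<in> sets lborel" and AX: "A i \<subseteq> torus" for i
  proof -
    have "{x \<in> torus. P i x} = torus \<inter> {x. P i x}" by auto
    moreover have "torus \<inter> {x. P i x} \<in> sets borel" using Ps[of i] torus_fmeasurable(1) by (intro sets.Int) (auto simp: fmeasurable_def)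
    ultimately show "A i \<in> sets lborel" unfolding A_def by simp
    show "A i \<subseteq> torus" unfolding A_def by auto
  qed
  have finI: "finite (I n)" for n unfolding I_def by auto
  let ?F = "\<lambda>k. indicator {t. near y (\<psi> k) t} :: real \<Rightarrow> ennreal"
  have Fm: "?F k \<in> borel_measurable borel" for k using open_near by (intro borel_measurable_indicator) auto
  have Fper: "?F k (t + 1) = ?F k t" for k t by (auto simp: indicator_def near_periodic)
  have mA: "measure lborel (A (k, j)) = 2 * \<psi> k" if kj: "j \<in> totatives k" for k j
  proof -
    have "emeasure lborel (A (k, j)) = unit_integral (\<lambda>u. unit_integral (\<lambda>v. indicator {x. P (k, j) x} (u, v)))"
      using kj emeasure_torus[of "\<lambda>u v. P (k, j) (u, v)"] Ps[of "(k, j)"] unfolding A_def by simp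
    \<comment> \<open>The measure of one event is the degenerate case of independence with the
      constant function 1 along the vector (1, 0); the determinant condition becomes j \<noteq>
      0.\<close>
    also have "\<dots> = unit_integral (\<lambda>u. unit_integral (\<lambda>v. ?F k (of_int (int k) * u + of_int (int j) * v)
        * (\<lambda>_. 1) (of_int 1 * u + of_int 0 * v)))"
      by (intro arg_cong[where f = unit_integral] ext) (auto simp: P_def indicator_def)
    also have "\<dots> = unit_integral (?F k) * unit_integral (\<lambda>_. 1)"
      by (rule unit_integral_independent[where k = "int k" and j = "int j" and k' = 1 and j' = 0, OF Fm _ Fper])
        (use kj in \<open>auto simp: totatives_def\<close>)
    also have "\<dots> = ennreal (2 * \<psi> k)"
      using unit_integral_near[of "\<psi> k" y] psi by (simp add: unit_integral_const)
    finally show ?thesis using psi by (simp add: measure_def)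
  qed
  have mAA: "measure lborel (A i \<inter> A i') = measure lborel (A i) * measure lborel (A i')"
    if "i \<in> I n" "i' \<in> I n" "i \<noteq> i'" for i i' n
  proof -
    obtain k j k' j' where i: "i = (k, j)" "i' = (k', j')" by (cases i, cases i') auto
    have kj: "j \<in> totatives k" "j' \<in> totatives k'" using that unfolding I_def i by auto
    have pos: "k > 0" "k' > 0" "j > 0" using kj by (auto simp: totatives_def intro: Nat.gr0I)
    have "k * j' \<noteq> j * k'"
    proof
      assume "k * j' = j * k'"
      then have "k = k' \<and> j = j'" using kj pos by (intro coprime_cross_mult) (auto simp: totatives_def)
      then show False using that(3) i by simp
    qed
    then have det: "int k * int j' \<noteq> int j * int k'" by (metis of_nat_eq_iff of_nat_mult)
    have eq: "A i \<inter> A i' = {x \<in> torus. P i (fst x, snd x) \<and> P i' (fst x, snd x)}"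
      using kj unfolding A_def i by auto
    have "{x. P i (fst x, snd x) \<and> P i' (fst x, snd x)} = {x. P i x} \<inter> {x. P i' x}" by auto
    then have sts: "{x. P i (fst x, snd x) \<and> P i' (fst x, snd x)} \<in> sets borel" using Ps by auto
    have "emeasure lborel (A i \<inter> A i') = unit_integral (\<lambda>u. unit_integral (\<lambda>v.
        indicator {x. P i (fst x, snd x) \<and> P i' (fst x, snd x)} (u, v)))"
      unfolding eq by (rule emeasure_torus[OF sts])
    also have "\<dots> = unit_integral (\<lambda>u. unit_integral (\<lambda>v. ?F k (of_int (int k) * u + of_int (int j) * v)
        * ?F k' (of_int (int k') * u + of_int (int j') * v)))"
      unfolding i by (intro arg_cong[where f = unit_integral] ext) (auto simp: P_def indicator_def)
    also have "\<dots> = unit_integral (?F k) * unit_integral (?F k')"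
      using det pos by (intro unit_integral_independent Fm Fper) auto
    also have "\<dots> = ennreal (2 * \<psi> k * (2 * \<psi> k'))"
      unfolding unit_integral_near[OF psi] using psi(1) by (intro ennreal_mult[symmetric]) auto
    finally have "measure lborel (A i \<inter> A i') = 2 * \<psi> k * (2 * \<psi> k')"
      using psi by (simp add: measure_def)
    then show ?thesis using mA kj unfolding i by simp
  qed
  have Snn: "S n \<ge> 0" for n unfolding S_def by (simp add: sum_nonneg)
  have "S n = 2 * (\<Sum>k\<le>n. real (totient k) * \<psi> k)" for n
  proof -
    have "S n = (\<Sum>k\<le>n. \<Sum>j\<in>totatives k. measure lborel (A (k, j)))"
      unfolding S_def I_def by (subst sum.Sigma) auto
    also have "\<dots> = (\<Sum>k\<le>n. \<Sum>j\<in>totatives k. 2 * \<psi> k)" using mA by (intro sum.cong refl) auto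
    also have "\<dots> = (\<Sum>k\<le>n. 2 * (real (totient k) * \<psi> k))" by (simp add: totient_def ac_simps)
    finally show ?thesis by (simp add: sum_distrib_left)
  qed
  then have "S = (\<lambda>n. 2 * (\<Sum>k\<le>n. real (totient k) * \<psi> k))" by (rule ext)
  moreover have "filterlim (\<lambda>n. 2 * (\<Sum>k\<le>n. real (totient k) * \<psi> k)) at_top sequentially"
    using psi(1) by (intro filterlim_tendsto_pos_mult_at_top[OF tendsto_const] filterlim_partial_sums_at_top div) auto
  ultimately have S: "filterlim S at_top sequentially" by (simp only:)
  have "AE x in lborel. x \<in> torus \<longrightarrow> infinite {i. x \<in> A i}"
  proof (rule quasi_independent_limsup_full[OF torus_fmeasurable(1) As AX _ finI S, of "\<lambda>_. 1"])
    fix Z :: "(real \<times> real) set" assume Z: "Z \<in> sets lborel" "Z \<subseteq> torus" "0 < measure lborel Z"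
    define z where "z = measure lborel Z"
    have z: "z > 0" using Z unfolding z_def by simp
    have mZ: "measure lborel (torus - Z) = 1 - z"
      using torus_fmeasurable Z unfolding z_def by (subst measure_Diff) (auto simp: fmeasurable_def)
    \<comment> \<open>The choice C = 1 + z works because the complement of \<open>Z\<close> has
      measure 1 - z and 1 - z^2 < 1.\<close>
    have "(1 + z) * (1 - z) < 1\<^sup>2" using z by (simp add: algebra_simps)
    then have "(1 + z) * measure lborel (torus - Z) < 1\<^sup>2" unfolding mZ .
    moreover have "\<forall>\<^sub>F n in sequentially. 1 * S n \<le> (\<Sum>i\<in>I n. 1 * measure lborel (A i \<inter> torus))"
      using AX unfolding S_def by (simp add: Int_absorb2)
    moreover have "\<forall>\<^sub>F n in sequentially. (\<Sum>i\<in>I n. \<Sum>j\<in>I n. 1 * 1 * measure lborel (A i \<inter> A j)) \<le> (1 + z) * (S n)\<^sup>2"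
    proof -
      \<comment> \<open>From here on the diagonal contribution S is at most z S^2.\<close>
      have "\<forall>\<^sub>F n in sequentially. S n \<ge> 1 / z" using S by (simp add: filterlim_at_top)
      then show ?thesis
      proof eventually_elim
        case (elim n)
        have "(\<Sum>i\<in>I n. \<Sum>j\<in>I n. measure lborel (A i \<inter> A j))
            \<le> (\<Sum>i\<in>I n. \<Sum>j\<in>I n. measure lborel (A i) * measure lborel (A j) + (if i = j then measure lborel (A i) else 0))"
          using mAA by (intro sum_mono) auto
        also have "\<dots> = (S n)\<^sup>2 + S n"
          unfolding S_def power2_eq_square sum_product sum.distrib using finI by (simp add: sum.delta')
        finally have "(\<Sum>i\<in>I n. \<Sum>j\<in>I n. measure lborel (A i \<inter> A j)) \<le> (S n)\<^sup>2 + S n" .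
        moreover have "S n \<le> z * (S n)\<^sup>2"
        proof -
          have "1 * S n \<le> (z * S n) * S n" using elim z Snn by (intro mult_right_mono) (auto simp: field_simps)
          then show ?thesis by (simp add: power2_eq_square)
        qed
        ultimately show ?case by (simp add: algebra_simps)
      qed
    qed
    moreover have "torus \<in> sets lborel" using torus_fmeasurable(1) by (auto simp: fmeasurable_def)
    ultimately show "\<exists>B\<in>sets lborel. B \<subseteq> torus \<and> (\<exists>\<beta>>0. \<exists>C>0.
      C * measure lborel (B - Z) < \<beta>\<^sup>2 \<and>
      (\<forall>\<^sub>F n in sequentially. \<beta> * S n \<le> (\<Sum>i\<in>I n. 1 * measure lborel (A i \<inter> B))) \<and>
      (\<forall>\<^sub>F n in sequentially. (\<Sum>i\<in>I n. \<Sum>j\<in>I n. 1 * 1 * measure lborel (A i \<inter> A j)) \<le> C * (S n)\<^sup>2))"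
      using z by (intro bexI[of _ torus] conjI order_refl exI[of _ "1::real"] exI[of _ "1 + z"]) auto
  qed simp
  moreover have "{i. x \<in> A i} = (linear_form_hits \<psi> y x)"
    if "x \<in> torus" for x using that unfolding A_def P_def by auto
  ultimately show ?thesis by (auto elim!: eventually_mono)
qed

theorem linear_form_limsup_full:
  assumes psi: "\<And>k. 0 \<le> \<psi> k" and div: "\<not> summable (\<lambda>k. real (totient k) * \<psi> k)"
  shows "AE x in lborel. x \<in> torus \<longrightarrow>
    infinite (linear_form_hits \<psi> y x)"
proof (cases "infinite {k. \<psi> k > 1 / 2}")
  case True
  then show ?thesis using infinite_linear_form_hits by simp
next
  case False
  \<comment> \<open>Only finitely many radii exceed 1/2. Setting them to 0 preserves divergence and
    can only lose hits.\<close>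
  define \<psi>' where "\<psi>' k = (if \<psi> k > 1 / 2 then 0 else \<psi> k)" for k
  have "\<forall>\<^sub>F k in cofinite. \<psi>' k = \<psi> k"
    unfolding eventually_cofinite by (rule finite_subset[of _ "{k. \<psi> k > 1 / 2}"]) (use False in \<open>auto simp: \<psi>'_def\<close>)
  then have "\<forall>\<^sub>F k in sequentially. real (totient k) * \<psi>' k = real (totient k) * \<psi> k"
    unfolding cofinite_eq_sequentially by eventually_elim simp
  from summable_cong[OF this] div have "\<not> summable (\<lambda>k. real (totient k) * \<psi>' k)" by simp
  then have "AE x in lborel. x \<in> torus \<longrightarrow>
    infinite (linear_form_hits \<psi>' y x)"
    using psi by (intro linear_form_limsup_full_small) (auto simp: \<psi>'_def)
  moreover have "linear_form_hits \<psi>' y x \<subseteq> linear_form_hits \<psi> y x" for x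
    by (auto simp: \<psi>'_def near_zero split: if_splits)
  ultimately show ?thesis by (elim eventually_mono) (meson infinite_super)
qed

section \<open>Simultaneous approximation: full measure\<close>

lemma card_int_near: 
  assumes "h \<ge> 0"
  shows "finite {n :: int. \<bar>of_int n - c\<bar> < h}" "real (card {n :: int. \<bar>of_int n - c\<bar> < h}) \<le> 2 * h + 1"
proof -
  have sub: "{n :: int. \<bar>of_int n - c\<bar> < h} \<subseteq> {\<lfloor>c - h\<rfloor> + 1..\<lceil>c + h\<rceil> - 1}"
  proof
    fix n :: int assume "n \<in> {n :: int. \<bar>of_int n - c\<bar> < h}"
    then have "of_int n < c + h" "c - h < of_int n" by (auto simp: abs_less_iff)
    then have "n < \<lceil>c + h\<rceil>" "\<lfloor>c - h\<rfloor> < n" by (simp_all add: less_ceiling_iff floor_less_iff)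
    then show "n \<in> {\<lfloor>c - h\<rfloor> + 1..\<lceil>c + h\<rceil> - 1}" by simp
  qed
  then show fin: "finite {n :: int. \<bar>of_int n - c\<bar> < h}" by (rule finite_subset) simp
  have "card {n :: int. \<bar>of_int n - c\<bar> < h} \<le> nat (\<lceil>c + h\<rceil> - 1 - (\<lfloor>c - h\<rfloor> + 1) + 1)"
    using card_mono[OF _ sub] by simp
  also have "real (nat (\<lceil>c + h\<rceil> - 1 - (\<lfloor>c - h\<rfloor> + 1) + 1)) \<le> 2 * h + 1"
  proof -
    have "of_int \<lceil>c + h\<rceil> < c + h + 1" "of_int \<lfloor>c - h\<rfloor> > c - h - 1" by linarith+
    note f = this
    show ?thesis
    proof (cases "\<lceil>c + h\<rceil> - 1 - (\<lfloor>c - h\<rfloor> + 1) + 1 \<ge> 0")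
      case True
      then have "real (nat (\<lceil>c + h\<rceil> - 1 - (\<lfloor>c - h\<rfloor> + 1) + 1)) = of_int \<lceil>c + h\<rceil> - 1 - (of_int \<lfloor>c - h\<rfloor> + 1) + 1"
        by simp
      then show ?thesis using f by linarith
    qed (use assms in simp)
  qed
  finally show "real (card {n :: int. \<bar>of_int n - c\<bar> < h}) \<le> 2 * h + 1" by simp
qed

text \<open>With d = gcd(q,r) and r = r' d, the points t + q l / r modulo 1 are r' equally spaced
  points, each taken d times. An arc of length 2\<psi> contains at most 2 \<psi> r' + 1 of them. In
  the injection below, the quotient \<open>l div r'\<close> tells apart the d indices that give the
  same point.\<close>

lemma card_near_orbit:
  fixes q r :: nat
  assumes r: "r > 0" and psi: "\<psi> \<ge> 0"
  shows "real (card {l \<in> {..<r}. near y \<psi> (t + real q * (real l / real r))}) \<le> 2 * \<psi> * r + gcd q r"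
proof -
  define d where "d = gcd q r"
  have d: "d > 0" unfolding d_def using r by simp
  obtain q' r' where qr: "q = q' * d" "r = r' * d" and cop: "coprime q' r'"
    unfolding d_def using gcd_coprime_exists[of q r] r by auto
  have r': "r' > 0" using r qr by (auto intro: Nat.gr0I)
  \<comment> \<open>Multiplied by r', nearness to y says that the integer q' l + p r' lies within
    \<psi> r' of c.\<close>
  define c where "c = real r' * (y - t)"
  define L where "L = {l \<in> {..<r}. near y \<psi> (t + real q * (real l / real r))}"
  define N where "N = {n :: int. \<bar>of_int n - c\<bar> < \<psi> * r'}"
  have "\<exists>p :: int. int (q' * l) + p * int r' \<in> N" if "l \<in> L" for l
  proof -
    obtain p :: int where p: "\<bar>t + real q * (real l / real r) + of_int p - y\<bar> < \<psi>"
      using \<open>l \<in> L\<close> unfolding L_def near_def by auto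
    have "of_int (int (q' * l) + p * int r') - c = real r' * (t + real q * (real l / real r) + of_int p - y)"
      using d r' unfolding qr c_def by (simp add: field_simps)
    then have "\<bar>of_int (int (q' * l) + p * int r') - c\<bar> = real r' * \<bar>t + real q * (real l / real r) + of_int p - y\<bar>"
      by (simp add: abs_mult)
    also have "\<dots> < real r' * \<psi>" using p r' by simp
    finally show ?thesis unfolding N_def by (intro exI[of _ p]) (simp add: mult.commute)
  qed
  then obtain p where p: "\<And>l. l \<in> L \<Longrightarrow> int (q' * l) + p l * int r' \<in> N" by metis
  have "card L \<le> card (N \<times> {..<d})"
  proof (rule card_inj_on_le)
    show "finite (N \<times> {..<d})" unfolding N_def using card_int_near(1) psi by auto
    show "(\<lambda>l. (int (q' * l) + p l * int r', l div r')) ` L \<subseteq> N \<times> {..<d}"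
    proof (rule image_subsetI)
      fix l assume l: "l \<in> L"
      then have "l < r' * d" unfolding L_def qr by auto
      then have "l div r' < d" using r' by (simp add: div_less_iff_less_mult mult.commute)
      then show "(int (q' * l) + p l * int r', l div r') \<in> N \<times> {..<d}" using p[OF l] by simp
    qed
    show "inj_on (\<lambda>l. (int (q' * l) + p l * int r', l div r')) L"
    proof (rule inj_onI)
      fix l l' assume "(int (q' * l) + p l * int r', l div r') = (int (q' * l') + p l' * int r', l' div r')"
      then have e: "int (q' * l) + p l * int r' = int (q' * l') + p l' * int r'" "l div r' = l' div r'" by auto
      have "int q' * (int l - int l') = (p l' - p l) * int r'" using e(1) by (simp add: algebra_simps)
      then have "int r' dvd int q' * (int l - int l')" by simp
      moreover have "coprime (int r') (int q')" using cop by (simp add: coprime_commute)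
      ultimately have "int r' dvd int l - int l'" by (simp add: coprime_dvd_mult_right_iff)
      then have "int l mod int r' = int l' mod int r'" by (simp add: mod_eq_dvd_iff)
      then have "l mod r' = l' mod r'" by (metis of_nat_eq_iff of_nat_mod)
      then show "l = l'" using e(2) by (metis div_mult_mod_eq)
    qed
  qed
  then have "real (card L) \<le> real (card N) * real d" by (simp add: card_cartesian_product of_nat_mult[symmetric] del: of_nat_mult)
  also have "\<dots> \<le> (2 * (\<psi> * r') + 1) * real d"
    unfolding N_def using card_int_near(2)[of "\<psi> * r'" c] psi by (intro mult_right_mono) auto
  also have "\<dots> = 2 * \<psi> * (real r' * real d) + real d" by (simp add: algebra_simps)
  also have "real r' * real d = real r" using qr(2) by simp
  also have "real d = real (gcd q r)" unfolding d_def ..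
  finally show ?thesis unfolding L_def .
qed

text \<open>The second factor is invariant under translation by \<open>1 / r\<close>, so the first one may be replaced by its
  average over these translations.\<close>
lemma unit_integral_near_overlap:
  fixes q r :: nat
  assumes r: "r > 0" and psi: "0 \<le> \<psi>" and psi': "0 \<le> \<psi>'" "\<psi>' \<le> 1 / 2"
  shows "unit_integral (\<lambda>x. indicator {t. near y \<psi> t} (real q * x) * indicator {t. near y \<psi>' t} (real r * x))
    \<le> ennreal (2 * \<psi>' * (2 * \<psi> + real (gcd q r) / real r))"
proof -
  define F where "F = (indicator {t. near y \<psi> t} :: real \<Rightarrow> ennreal)"
  define G where "G = (indicator {t. near y \<psi>' t} :: real \<Rightarrow> ennreal)"
  have [measurable]: "F \<in> borel_measurable borel" "G \<in> borel_measurable borel"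
    unfolding F_def G_def using open_near by (auto intro!: borel_measurable_indicator)
  have per: "F (t + of_int n) = F t" "G (t + of_int n) = G t" for t n
    unfolding F_def G_def by (auto simp: indicator_def near_of_int)
  define h where "h x = F (real q * x) * G (real r * x)" for x
  have hm [measurable]: "h \<in> borel_measurable borel" unfolding h_def by measurable
  have hper: "h (x + 1) = h x" for x
    using per(1)[of "real q * x" "int q"] per(2)[of "real r * x" "int r"] unfolding h_def by (simp add: algebra_simps)
  have sh: "h (x + real l / real r) = F (real q * x + real q * (real l / real r)) * G (real r * x)" for x l
    using r per(2)[of "real r * x" "int l"] unfolding h_def by (simp add: algebra_simps)
  have "of_nat r * unit_integral h = (\<Sum>l<r. unit_integral (\<lambda>x. h (x + real l / real r)))"
    by (simp add: unit_integral_shift[OF hm hper])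
  also have "\<dots> = unit_integral (\<lambda>x. \<Sum>l<r. h (x + real l / real r))"
    unfolding unit_integral_def by (subst nn_integral_sum[symmetric]) (auto simp: sum_distrib_right)
  also have "\<dots> \<le> unit_integral (\<lambda>x. ennreal (2 * \<psi> * r + gcd q r) * G (real r * x))"
  proof -
    have "(\<Sum>l<r. h (x + real l / real r)) \<le> ennreal (2 * \<psi> * r + gcd q r) * G (real r * x)" for x
    proof -
      have "(\<Sum>l<r. h (x + real l / real r)) = (\<Sum>l<r. F (real q * x + real q * (real l / real r))) * G (real r * x)"
        unfolding sh by (simp add: sum_distrib_right)
      also have "(\<Sum>l<r. F (real q * x + real q * (real l / real r)))
          = of_nat (card {l \<in> {..<r}. near y \<psi> (real q * x + real q * (real l / real r))})"
        unfolding F_def indicator_def by (simp add: sum.If_cases Int_def)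
      also have "\<dots> \<le> ennreal (2 * \<psi> * r + gcd q r)"
        unfolding ennreal_of_nat_eq_real_of_nat using card_near_orbit[OF r psi] by (rule ennreal_leI)
      finally show ?thesis by (simp add: mult_right_mono)
    qed
    then show ?thesis unfolding unit_integral_def by (intro nn_integral_mono mult_right_mono) auto
  qed
  also have "\<dots> = ennreal (2 * \<psi> * r + gcd q r) * unit_integral (\<lambda>x. G (0 + real r * x))"
    by (subst unit_integral_cmult) auto
  also have "unit_integral (\<lambda>x. G (0 + real r * x)) = unit_integral G"
    using r per(2)[of _ 1] by (intro unit_integral_affine_pos) auto
  also have "unit_integral G = ennreal (2 * \<psi>')" unfolding G_def by (rule unit_integral_near[OF psi'])
  also have "ennreal (2 * \<psi> * r + gcd q r) * ennreal (2 * \<psi>') = ennreal (real r) * ennreal (2 * \<psi>' * (2 * \<psi> + real (gcd q r) / real r))"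
    using r psi psi' by (simp add: ennreal_mult[symmetric] field_simps del: ennreal_plus)
  finally have "ennreal (real r) * unit_integral h \<le> ennreal (real r) * ennreal (2 * \<psi>' * (2 * \<psi> + real (gcd q r) / real r))"
    by (simp add: ennreal_of_nat_eq_real_of_nat)
  then have "unit_integral h \<le> ennreal (2 * \<psi>' * (2 * \<psi> + real (gcd q r) / real r))"
    using r by (subst (asm) ennreal_mult_le_mult_iff) auto
  then show ?thesis unfolding h_def F_def G_def .
qed

text \<open>By Euler's product, \<phi>(n)/n has the factors 1 - 1/p of \<phi>(d)/d and possibly
  further ones, all at most 1.\<close>

lemma totient_ratio_le:
  assumes "d dvd n" "n > 0"
  shows "real (totient n) / real n \<le> real (totient d) / real d"
proof -
  have d: "d > 0" using assms by (auto intro: Nat.gr0I)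
  have sub: "prime_factors d \<subseteq> prime_factors n" using assms by (intro dvd_prime_factors) auto
  have "(\<Prod>p\<in>prime_factors n. 1 - 1 / real p) = (\<Prod>p\<in>prime_factors n - prime_factors d. 1 - 1 / real p) * (\<Prod>p\<in>prime_factors d. 1 - 1 / real p)"
    using sub by (intro prod.subset_diff) auto
  also have "\<dots> \<le> 1 * (\<Prod>p\<in>prime_factors d. 1 - 1 / real p)"
    by (intro mult_right_mono prod_le_1 prod_nonneg) (auto simp: in_prime_factors_iff dest: prime_gt_0_nat)
  finally show ?thesis using d assms(2) by (simp add: totient_formula2)
qed

text \<open>The weights \<open>\<phi>(q) / q\<close> are chosen so that this sum is bounded; it reduces to the identity
  \<open>\<Sum>d | r. \<phi>(d) = r\<close>.\<close>
lemma weighted_gcd_sum_le: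
  assumes r: "r > 0"
  shows "(\<Sum>q\<in>{1..r}. real (totient q) / real q * (real (gcd q r) / real r)\<^sup>2) \<le> 1"
proof -
  have "(\<Sum>q\<in>{1..r}. real (totient q) / real q * (real (gcd q r) / real r)\<^sup>2)
      \<le> (\<Sum>q\<in>{1..r}. real (totient (gcd q r)) * real (gcd q r) / (real r)\<^sup>2)"
  proof (intro sum_mono)
    fix q assume q: "q \<in> {1..r}"
    define d where "d = gcd q r"
    have d: "d > 0" "d dvd q" unfolding d_def using r by auto
    \<comment> \<open>After this replacement the summand depends on q only through d = gcd(q,r), so
      the q can be grouped by d.\<close>
    have "real (totient q) / real q * (real d / real r)\<^sup>2 \<le> real (totient d) / real d * (real d / real r)\<^sup>2"
      using q d by (intro mult_right_mono totient_ratio_le) auto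
    also have "\<dots> = real (totient d) * real d / (real r)\<^sup>2" using d by (simp add: power2_eq_square)
    finally show "real (totient q) / real q * (real (gcd q r) / real r)\<^sup>2
        \<le> real (totient (gcd q r)) * real (gcd q r) / (real r)\<^sup>2" unfolding d_def .
  qed
  also have "\<dots> = (\<Sum>d\<in>{d. d dvd r}. \<Sum>q\<in>{q \<in> {1..r}. gcd q r = d}. real (totient (gcd q r)) * real (gcd q r) / (real r)\<^sup>2)"
    using r by (intro sum.group[symmetric]) auto
  also have "\<dots> = (\<Sum>d\<in>{d. d dvd r}. real (card {q \<in> {1..r}. gcd q r = d}) * (real (totient d) * real d / (real r)\<^sup>2))"
    by (intro sum.cong refl) simp
  also have "\<dots> \<le> (\<Sum>d\<in>{d. d dvd r}. real (totient d) / real r)"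
  proof (intro sum_mono)
    fix d assume d: "d \<in> {d. d dvd r}"
    have d0: "d > 0" using d r by (auto intro: Nat.gr0I)
    have "{q \<in> {1..r}. gcd q r = d} = {q \<in> {0<..r}. gcd q r = d}" by auto
    then have "card {q \<in> {1..r}. gcd q r = d} = totient (r div d)"
      using card_gcd_eq_totient[OF r, of d] d by (simp only: mem_Collect_eq)
    \<comment> \<open>The crude bound r/d for the number of q is enough: it cancels d and leaves
      \<phi>(d)/r.\<close>
    also have "\<dots> \<le> r div d" by (rule totient_le)
    finally have "real (card {q \<in> {1..r}. gcd q r = d}) \<le> real r / real d"
      using d by (metis mem_Collect_eq of_nat_mono real_of_nat_div)
    then have "real (card {q \<in> {1..r}. gcd q r = d}) * (real (totient d) * real d / (real r)\<^sup>2)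
        \<le> real r / real d * (real (totient d) * real d / (real r)\<^sup>2)" by (intro mult_right_mono) auto
    also have "\<dots> = real (totient d) / real r" using d0 r by (simp add: power2_eq_square)
    finally show "real (card {q \<in> {1..r}. gcd q r = d}) * (real (totient d) * real d / (real r)\<^sup>2) \<le> real (totient d) / real r" .
  qed
  also have "\<dots> = 1" using r totient_divisor_sum[of r] by (simp add: sum_divide_distrib[symmetric] of_nat_sum[symmetric] del: of_nat_sum)
  finally show ?thesis .
qed

text \<open>An interval of length 1/N contains \<open>q div N\<close> full periods of x -> q x, each
  contributing 2\<psi>/q. For q \<ge> 2N this number is at least q/(2N), so at most half of the
  expected measure is lost.\<close>

lemma nn_integral_near_ge:
  fixes q N a :: nat
  assumes psi: "0 \<le> \<psi>" "\<psi> \<le> 1 / 2" and N: "N > 0" and q: "q \<ge> 2 * N"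
  shows "ennreal (\<psi> / N) \<le> (\<integral>\<^sup>+x. indicator {t. near y \<psi> t} (real q * x) * indicator {a / N..<(a + 1) / N} x \<partial>lborel)"
proof -
  define F where "F = (indicator {t. near y \<psi> t} :: real \<Rightarrow> ennreal)"
  have [measurable]: "F \<in> borel_measurable borel"
    unfolding F_def using open_near by (auto intro!: borel_measurable_indicator)
  have per: "F (t + 1) = F t" for t unfolding F_def by (auto simp: indicator_def near_periodic)
  have q0: "q > 0" using q N by auto
  define m where "m = q div N"
  have mq: "real m \<le> real q / real N" "real q / (2 * real N) \<le> real m"
  proof -
    have "m * N \<le> q" "q \<le> m * N + N"
      unfolding m_def using N div_times_less_eq_dividend[of q N] mod_less_divisor[of N q] div_mult_mod_eq[of q N] by linarith+
    then have "real m * real N \<le> real q" "real q \<le> real m * real N + real N"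
      by (metis of_nat_mono of_nat_mult) (metis \<open>q \<le> m * N + N\<close> of_nat_add of_nat_mono of_nat_mult)
    then show "real m \<le> real q / real N" and "real q / (2 * real N) \<le> real m"
      using N q by (simp_all add: field_simps)
  qed
  have "ennreal (real m) * ennreal (2 * \<psi>) = of_nat m * unit_integral F"
    unfolding F_def unit_integral_near[OF psi] by (simp add: ennreal_of_nat_eq_real_of_nat)
  also have "\<dots> = (\<integral>\<^sup>+x. F x * indicator {real q * (a / N)..<real q * (a / N) + real m} x \<partial>lborel)"
    by (rule nn_integral_periods[symmetric]) (auto simp: per)
  also have "\<dots> \<le> (\<integral>\<^sup>+x. F x * indicator {0 + real q * (a / N)..<0 + real q * ((a + 1) / N)} x \<partial>lborel)"
    using mq(1) by (intro nn_integral_mono mult_left_mono) (auto simp: indicator_def field_simps add_divide_distrib)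
  also have "\<dots> = ennreal (real q) * (\<integral>\<^sup>+x. F (0 + real q * x) * indicator {a / N..<(a + 1) / N} x \<partial>lborel)"
    using q0 by (intro nn_integral_scale) auto
  finally have le: "ennreal (real m) * ennreal (2 * \<psi>) \<le> ennreal (real q) * (\<integral>\<^sup>+x. F (real q * x) * indicator {a / N..<(a + 1) / N} x \<partial>lborel)"
    by simp
  have "ennreal (real q) * ennreal (\<psi> / N) \<le> ennreal (real m) * ennreal (2 * \<psi>)"
  proof -
    have "real q * (\<psi> / N) = real q / (2 * real N) * (2 * \<psi>)" by simp
    also have "\<dots> \<le> real m * (2 * \<psi>)" using mq(2) psi by (intro mult_right_mono) auto
    finally have "ennreal (real q * (\<psi> / N)) \<le> ennreal (real m * (2 * \<psi>))" by (rule ennreal_leI)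
    then show ?thesis using psi by (simp only: ennreal_mult of_nat_0_le_iff divide_nonneg_nonneg mult_nonneg_nonneg zero_le_numeral)
  qed
  from order_trans[OF this le] show ?thesis
    using q0 unfolding F_def by (subst (asm) ennreal_mult_le_mult_iff) auto
qed

section \<open>Grid cells of the torus\<close>

lemma emeasure_plane_Times:
  assumes "P \<in> sets borel" "Q \<in> sets borel"
  shows "emeasure lborel (P \<times> Q :: (real \<times> real) set) = emeasure lborel P * emeasure lborel Q"
  unfolding lborel_prod[symmetric] using assms by (intro lborel.emeasure_pair_measure_Times) auto

lemma measure_plane_Times:
  assumes "P \<in> sets borel" "Q \<in> sets borel"
  shows "measure lborel (P \<times> Q :: (real \<times> real) set) = measure lborel P * measure lborel Q"
  unfolding measure_def emeasure_plane_Times[OF assms] by (rule enn2real_mult)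

lemma measure_less_of_emeasure_less: "emeasure M A < ennreal c \<Longrightarrow> measure M A < c"
  unfolding measure_def by (cases "emeasure M A") (auto simp: ennreal_less_iff)

text \<open>Half-open squares, so that every point of the torus lies in exactly one cell of the
  grid.\<close>

definition cell :: "nat \<Rightarrow> nat \<times> nat \<Rightarrow> (real \<times> real) set" where
  "cell N ab = {real (fst ab) / real N..<(real (fst ab) + 1) / real N} \<times> {real (snd ab) / real N..<(real (snd ab) + 1) / real N}"

lemma cell_coordinate:
  assumes "N > 0" "0 \<le> t"
  shows "t \<in> {real a / real N..<(real a + 1) / real N} \<longleftrightarrow> a = nat \<lfloor>t * real N\<rfloor>"
proof -
  have "t \<in> {real a / real N..<(real a + 1) / real N} \<longleftrightarrow> real a \<le> t * real N \<and> t * real N < real a + 1"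
    using assms by (simp add: field_simps)
  also have "\<dots> \<longleftrightarrow> \<lfloor>t * real N\<rfloor> = int a" by (simp add: floor_eq_iff)
  also have "\<dots> \<longleftrightarrow> a = nat \<lfloor>t * real N\<rfloor>" using assms by (auto simp: nat_eq_iff)
  finally show ?thesis .
qed

lemma cell_borel: "cell N ab \<in> sets borel"
  unfolding cell_def by (simp add: borel_Times)

lemma cell_bounded: "bounded (cell N ab)"
  unfolding cell_def by (intro bounded_Times) (auto intro: bounded_subset[OF bounded_closed_interval])

lemma measure_cell: "N > 0 \<Longrightarrow> measure lborel (cell N ab) = 1 / (real N)\<^sup>2"
  unfolding cell_def by (simp add: measure_plane_Times power2_eq_square divide_right_mono diff_divide_distrib[symmetric])

lemma cell_nonneg: "x \<in> cell N ab \<Longrightarrow> 0 \<le> fst x \<and> 0 \<le> snd x"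
  unfolding cell_def by (auto intro: order_trans[rotated])

lemma mem_cell_iff:
  assumes "N > 0" "0 \<le> fst x" "0 \<le> snd x"
  shows "x \<in> cell N ab \<longleftrightarrow> ab = (nat \<lfloor>fst x * real N\<rfloor>, nat \<lfloor>snd x * real N\<rfloor>)"
  unfolding cell_def mem_Times_iff cell_coordinate[OF assms(1,2)] cell_coordinate[OF assms(1,3)]
  by (simp add: prod_eq_iff)

lemma cell_disjoint: "N > 0 \<Longrightarrow> disjoint_family (cell N)"
  unfolding disjoint_family_on_def using mem_cell_iff cell_nonneg by (metis disjoint_iff)

lemma cell_subset_torus:
  assumes "ab \<in> {..<N} \<times> {..<N}"
  shows "cell N ab \<subseteq> torus"
proof -
  have c: "(real a + 1) / real N \<le> 1" if "a < N" for a using that by (simp add: divide_le_eq_1)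
  show ?thesis
  proof
    fix x assume x: "x \<in> cell N ab"
    then have "fst x < (real (fst ab) + 1) / real N" "snd x < (real (snd ab) + 1) / real N"
      unfolding cell_def mem_Times_iff by simp_all
    moreover have "fst ab < N" "snd ab < N" using assms by auto
    ultimately have "fst x < 1" "snd x < 1" using c[of "fst ab"] c[of "snd ab"] by linarith+
    then show "x \<in> torus" using cell_nonneg[OF x] unfolding torus_def mem_Times_iff by simp
  qed
qed

lemma torus_covered:
  assumes N: "N > 0" and t: "t \<in> torus"
  shows "\<exists>ab \<in> {..<N} \<times> {..<N}. t \<in> cell N ab"
proof -
  have t': "0 \<le> fst t" "fst t < 1" "0 \<le> snd t" "snd t < 1" using t unfolding torus_def by auto
  have "nat \<lfloor>u * real N\<rfloor> < N" if "0 \<le> u" "u < 1" for u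
  proof -
    have "u * real N < real N" using that N by simp
    then have "\<lfloor>u * real N\<rfloor> < int N" by (simp add: floor_less_iff)
    then show ?thesis using N by simp
  qed
  then show ?thesis using mem_cell_iff[OF N t'(1,3)] t' by (metis lessThan_iff mem_Sigma_iff)
qed

lemma cell_dist:
  assumes "x \<in> cell N ab" "x' \<in> cell N ab"
  shows "dist x x' \<le> 2 / N"
proof -
  have "dist (fst x) (fst x') \<le> 1 / N" "dist (snd x) (snd x') \<le> 1 / N"
    using assms unfolding cell_def by (auto simp: dist_real_def abs_le_iff add_divide_distrib)
  moreover have "dist x x' \<le> dist (fst x) (fst x') + dist (snd x) (snd x')"
    unfolding dist_prod_def by (rule sqrt_sum_squares_le_sum) auto
  ultimately show ?thesis by simp
qed

text \<open>Lower bounds for the events are available on grid cells only, so \<open>Z\<close> is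
  replaced by a union of cells. Take a compact K inside \<open>Z\<close>, an open U around K with U
  - K small, and all cells meeting K; once the mesh is fine enough they stay inside U.\<close>

lemma grid_approximation:
  assumes Z: "Z \<in> sets lborel" "Z \<subseteq> torus" and z: "0 < measure lborel Z" and e: "e > 0"
  obtains N \<G> where "N > 0" "\<G> \<subseteq> {..<N} \<times> {..<N}"
    "measure lborel (\<Union>ab\<in>\<G>. cell N ab) \<ge> measure lborel Z / 2"
    "measure lborel ((\<Union>ab\<in>\<G>. cell N ab) - Z) < e"
proof -
  have fm: "Y \<in> fmeasurable lborel" if "Y \<in> sets lborel" "Y \<subseteq> torus" for Y
    using fmeasurableI2[OF torus_fmeasurable(1) that(2,1)] .
  have "Z \<in> sets lebesgue" using Z by simp
  have z2: "measure lborel Z / 2 > 0" using z by simp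
  obtain K where K: "closed K" "K \<subseteq> Z" "emeasure lebesgue (Z - K) < ennreal (measure lborel Z / 2)"
    by (rule sets_lebesgue_inner_closed[OF \<open>Z \<in> sets lebesgue\<close> z2]) (rule that)
  have "torus \<subseteq> {0..1} \<times> {0..1}" unfolding torus_def by auto
  then have "K \<subseteq> {0..1} \<times> {0..1}" using K(2) Z(2) by blast
  then have Kb: "bounded K" by (rule bounded_subset[rotated]) (intro bounded_Times bounded_closed_interval)
  then have Kc: "compact K" using K(1) by (simp add: compact_eq_bounded_closed)
  have Ks: "K \<in> sets borel" using K(1) by auto
  have KT: "K \<subseteq> torus" using K(2) Z(2) by auto
  have mK: "measure lborel K \<ge> measure lborel Z / 2"
  proof -
    have "emeasure lborel (Z - K) < ennreal (measure lborel Z / 2)" using K(3) Ks Z by simp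
    then have "measure lborel (Z - K) < measure lborel Z / 2"
      by (rule measure_less_of_emeasure_less)
    moreover have "measure lborel (Z - K) = measure lborel Z - measure lborel K"
      using fm[OF Z] Ks K(2) by (intro measure_Diff) (auto simp: fmeasurable_def)
    ultimately show ?thesis by simp
  qed
  have Kl: "K \<in> sets lebesgue" using Ks by simp
  obtain U where U: "open U" "K \<subseteq> U" "emeasure lebesgue (U - K) < ennreal e"
    by (rule sets_lebesgue_outer_open[OF Kl e]) (rule that)
  obtain \<delta> where \<delta>: "\<delta> > 0" "(\<Union>x\<in>K. ball x \<delta>) \<subseteq> U"
    by (rule compact_subset_open_imp_ball_epsilon_subset[OF Kc U(1,2)]) (rule that)
  obtain N :: nat where N': "2 / \<delta> < real N" using reals_Archimedean2 by blast
  have "real N > 0" by (rule less_trans[OF _ N']) (use \<delta>(1) in simp)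
  then have N: "N > 0" "2 / real N < \<delta>" using N' \<delta>(1) by (auto simp: field_simps)
  define \<G> where "\<G> = {ab \<in> {..<N} \<times> {..<N}. cell N ab \<inter> K \<noteq> {}}"
  define B where "B = (\<Union>ab\<in>\<G>. cell N ab)"
  have fG: "finite \<G>" unfolding \<G>_def by auto
  have Bs: "B \<in> sets borel" unfolding B_def using fG cell_borel by auto
  have BT: "B \<subseteq> torus" unfolding B_def \<G>_def using cell_subset_torus by blast
  have KB: "K \<subseteq> B"
  proof
    fix x assume x: "x \<in> K"
    then obtain ab where "ab \<in> {..<N} \<times> {..<N}" "x \<in> cell N ab" using torus_covered[OF N(1)] KT by blast
    then show "x \<in> B" using x unfolding B_def \<G>_def by blast
  qed
  have BU: "B \<subseteq> U"
  proof
    fix x assume "x \<in> B"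
    then obtain ab x' where "x \<in> cell N ab" "x' \<in> cell N ab" "x' \<in> K" unfolding B_def \<G>_def by blast
    then have "x \<in> ball x' \<delta>" using cell_dist[of x' N ab x] N(2) by auto
    then show "x \<in> U" using \<delta>(2) \<open>x' \<in> K\<close> by blast
  qed
  show ?thesis
  proof (rule that[OF N(1)])
    show "\<G> \<subseteq> {..<N} \<times> {..<N}" unfolding \<G>_def by auto
    have "measure lborel K \<le> measure lborel B"
      using KB Bs Ks fm[of B] BT by (intro measure_mono_fmeasurable) auto
    then show "measure lborel (\<Union>ab\<in>\<G>. cell N ab) \<ge> measure lborel Z / 2" using mK unfolding B_def by simp
    have "emeasure lborel (B - Z) \<le> emeasure lborel (U - K)"
      using BU K(2) U(1) Ks by (intro emeasure_mono) auto
    also have "\<dots> < ennreal e" using U Ks by simp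
    finally show "measure lborel ((\<Union>ab\<in>\<G>. cell N ab) - Z) < e"
      unfolding B_def[symmetric] by (rule measure_less_of_emeasure_less)
  qed
qed

text \<open>The correlation estimate holds only up to constants, so \<open>C\<close> does not come
  near 1 and the torus is too large a test set. Instead \<open>B\<close> is a union of grid cells
  lying almost inside \<open>Z\<close>. On a cell every event with q \<ge> 2N has at least a quarter
  of its expected measure, which yields \<beta> = |B|/2, while |B - Z| is small enough even for C =
  48.\<close>

lemma simultaneous_limsup_full_small:
  assumes psi: "\<And>q. 0 \<le> \<psi> q" "\<And>q. \<psi> q \<le> 1 / 2"
    and div: "\<not> summable (\<lambda>q. real (totient q) / real q * (\<psi> q)\<^sup>2)"
  shows "AE x in lborel. x \<in> torus \<longrightarrow>
    infinite (simultaneous_hits \<psi> y1 y2 x)"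
proof -
  define T where "T y q = {x \<in> {0..<1}. near y (\<psi> q) (real q * x)}" for y :: real and q :: nat
  define A where "A q = (if q > 0 then T y1 q \<times> T y2 q else {})" for q
  define w where "w q = real (totient q) / real q" for q
  define S where "S n = (\<Sum>q\<le>n. w q * (\<psi> q)\<^sup>2)" for n
  have w: "w q \<ge> 0" "w q \<le> 1" for q unfolding w_def using totient_le[of q] by (auto simp: divide_le_eq_1)
  have nb: "{x. near y (\<psi> q) (real q * x)} \<in> sets borel" for y q
  proof -
    have "open ((\<lambda>x. real q * x) -` {t. near y (\<psi> q) t})"
      by (intro open_vimage open_near continuous_intros)
    then show ?thesis by (simp add: vimage_def)
  qed
  have Ts: "T y q \<in> sets borel" for y q
  proof -
    have "T y q = {0..<1} \<inter> {x. near y (\<psi> q) (real q * x)}" unfolding T_def by auto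
    then show ?thesis using nb by simp
  qed
  have As: "A q \<in> sets lborel" for q unfolding A_def using Ts by (auto simp: borel_Times)
  have AX: "A q \<subseteq> torus" for q unfolding A_def T_def torus_def by auto
  have S: "filterlim S at_top sequentially"
    unfolding S_def w_def by (intro filterlim_partial_sums_at_top div) auto
  have overlap1: "measure lborel (T y q \<inter> T y r) \<le> 2 * \<psi> r * (2 * \<psi> q + real (gcd q r) / real r)"
    if "r > 0" for y q r
  proof -
    have "emeasure lborel (T y q \<inter> T y r) = (\<integral>\<^sup>+x. indicator (T y q \<inter> T y r) x \<partial>lborel)" using Ts by simp
    also have "\<dots> = unit_integral (\<lambda>x. indicator {t. near y (\<psi> q) t} (real q * x) * indicator {t. near y (\<psi> r) t} (real r * x))"
      unfolding unit_integral_def by (intro nn_integral_cong) (auto simp: T_def indicator_def)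
    also have "\<dots> \<le> ennreal (2 * \<psi> r * (2 * \<psi> q + real (gcd q r) / real r))"
      using that psi by (intro unit_integral_near_overlap) auto
    finally show ?thesis unfolding measure_def using psi
      by (intro enn2real_leI) auto
  qed
  \<comment> \<open>The gcd error of one overlap. It is useful when r is the larger index, since it
    carries r in the denominator.\<close>
  define b where "b q r = (\<psi> r)\<^sup>2 * (real (gcd q r) / real r)\<^sup>2" for q r
  have overlap: "measure lborel (A q \<inter> A r) \<le> 32 * (\<psi> q)\<^sup>2 * (\<psi> r)\<^sup>2 + 8 * b q r" if r: "r > 0" for q r
  proof (cases "q > 0")
    case True
    define t where "t = 2 * \<psi> r * (2 * \<psi> q + real (gcd q r) / real r)"
    have t: "t \<ge> 0" unfolding t_def using psi by simp
    have "A q \<inter> A r = (T y1 q \<inter> T y1 r) \<times> (T y2 q \<inter> T y2 r)" unfolding A_def using True r by auto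
    then have "measure lborel (A q \<inter> A r) = measure lborel (T y1 q \<inter> T y1 r) * measure lborel (T y2 q \<inter> T y2 r)"
      using Ts by (simp add: measure_plane_Times)
    also have "\<dots> \<le> t * t" unfolding t_def using overlap1[OF r] t[unfolded t_def] by (intro mult_mono) auto
    also have "\<dots> = (4 * \<psi> q * \<psi> r + 2 * (\<psi> r * (real (gcd q r) / real r)))\<^sup>2"
      unfolding t_def power2_eq_square by (simp add: algebra_simps)
    \<comment> \<open>The inequality (a + b)^2 \<le> 2a^2 + 2b^2 separates the independent part from
      the gcd error.\<close>
    also have "\<dots> \<le> 2 * (4 * \<psi> q * \<psi> r)\<^sup>2 + 2 * (2 * (\<psi> r * (real (gcd q r) / real r)))\<^sup>2"
      using sum_squares_bound[of "4 * \<psi> q * \<psi> r" "2 * (\<psi> r * (real (gcd q r) / real r))"]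
      by (simp add: power2_sum)
    also have "\<dots> = 32 * (\<psi> q)\<^sup>2 * (\<psi> r)\<^sup>2 + 8 * b q r" unfolding b_def by (simp add: power2_eq_square)
    finally show ?thesis .
  qed (auto simp: A_def b_def)
  have bsum: "(\<Sum>q\<le>r. w q * b q r) \<le> (\<psi> r)\<^sup>2" if "r > 0" for r
  proof -
    have "(\<Sum>q\<le>r. w q * b q r) = (\<Sum>q\<in>{1..r}. w q * b q r)"
      by (rule sum.mono_neutral_right) (auto simp: w_def)
    also have "\<dots> = (\<psi> r)\<^sup>2 * (\<Sum>q\<in>{1..r}. real (totient q) / real q * (real (gcd q r) / real r)\<^sup>2)"
      unfolding w_def b_def by (simp add: sum_distrib_left ac_simps)
    also have "\<dots> \<le> (\<psi> r)\<^sup>2 * 1" using weighted_gcd_sum_le[OF that] by (intro mult_left_mono) auto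
    finally show ?thesis by simp
  qed
  have second: "(\<Sum>q\<le>n. \<Sum>r\<le>n. w q * w r * measure lborel (A q \<inter> A r)) \<le> 32 * (S n)\<^sup>2 + 16 * S n" for n
  proof -
    \<comment> \<open>The error is recorded only for q \<le> r, the order in which the weights w_q
      make it summable. Adding c q r and c r q covers both orders of a pair.\<close>
    define c where "c q r = (if q \<le> r then w q * w r * b q r else 0)" for q r
    have c0: "c q r \<ge> 0" for q r unfolding c_def b_def using w by simp
    have "w q * w r * measure lborel (A q \<inter> A r)
        \<le> 32 * ((w q * (\<psi> q)\<^sup>2) * (w r * (\<psi> r)\<^sup>2)) + (8 * c q r + 8 * c r q)" for q r
    proof (cases "q = 0 \<or> r = 0")
      case True
      then show ?thesis using c0[of q r] c0[of r q] w by (auto simp: A_def)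
    next
      case False
      have ineq: "w q * w r * measure lborel (A q \<inter> A r) \<le> w q * w r * (32 * (\<psi> q)\<^sup>2 * (\<psi> r)\<^sup>2 + 8 * b q r)"
        "w q * w r * measure lborel (A q \<inter> A r) \<le> w q * w r * (32 * (\<psi> r)\<^sup>2 * (\<psi> q)\<^sup>2 + 8 * b r q)"
        using overlap[of r q] overlap[of q r] False w
        by (auto intro!: mult_left_mono simp: Int_commute)
      show ?thesis
      proof (cases "q \<le> r")
        case True
        then have "w q * w r * (32 * (\<psi> q)\<^sup>2 * (\<psi> r)\<^sup>2 + 8 * b q r) = 32 * ((w q * (\<psi> q)\<^sup>2) * (w r * (\<psi> r)\<^sup>2)) + 8 * c q r"
          unfolding c_def by (simp add: algebra_simps)
        then show ?thesis using ineq(1) c0[of r q] by linarith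
      next
        case False
        then have "w q * w r * (32 * (\<psi> r)\<^sup>2 * (\<psi> q)\<^sup>2 + 8 * b r q) = 32 * ((w q * (\<psi> q)\<^sup>2) * (w r * (\<psi> r)\<^sup>2)) + 8 * c r q"
          unfolding c_def by (simp add: algebra_simps)
        then show ?thesis using ineq(2) c0[of q r] by linarith
      qed
    qed
    then have "(\<Sum>q\<le>n. \<Sum>r\<le>n. w q * w r * measure lborel (A q \<inter> A r))
        \<le> (\<Sum>q\<le>n. \<Sum>r\<le>n. 32 * ((w q * (\<psi> q)\<^sup>2) * (w r * (\<psi> r)\<^sup>2)) + (8 * c q r + 8 * c r q))"
      by (intro sum_mono)
    also have "\<dots> = 32 * (S n)\<^sup>2 + (8 * (\<Sum>q\<le>n. \<Sum>r\<le>n. c q r) + 8 * (\<Sum>q\<le>n. \<Sum>r\<le>n. c r q))"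
      unfolding S_def power2_eq_square sum_product by (simp add: sum.distrib sum_distrib_left)
    also have "(\<Sum>q\<le>n. \<Sum>r\<le>n. c q r) = (\<Sum>r\<le>n. \<Sum>q\<le>n. c q r)" by (rule sum.swap)
    also have "8 * (\<Sum>r\<le>n. \<Sum>q\<le>n. c q r) + 8 * (\<Sum>q\<le>n. \<Sum>r\<le>n. c r q) = 16 * (\<Sum>r\<le>n. \<Sum>q\<le>n. c q r)" by simp
    also have "(\<Sum>r\<le>n. \<Sum>q\<le>n. c q r) \<le> S n"
      unfolding S_def
    proof (rule sum_mono)
      fix r assume r: "r \<in> {..n}"
      show "(\<Sum>q\<le>n. c q r) \<le> w r * (\<psi> r)\<^sup>2"
      proof (cases "r = 0")
        case False
        have "(\<Sum>q\<le>n. c q r) = (\<Sum>q\<le>r. c q r)"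
          using r by (intro sum.mono_neutral_right) (auto simp: c_def)
        also have "\<dots> = w r * (\<Sum>q\<le>r. w q * b q r)"
          unfolding sum_distrib_left by (intro sum.cong refl) (simp add: c_def)
        also have "\<dots> \<le> w r * (\<psi> r)\<^sup>2" using bsum False w by (intro mult_left_mono) auto
        finally show ?thesis .
      qed (simp add: c_def w_def)
    qed
    finally show ?thesis by simp
  qed
  have lower: "(\<psi> q)\<^sup>2 / (real N)\<^sup>2 \<le> measure lborel (A q \<inter> cell N ab)"
    if N: "N > 0" and q: "q \<ge> 2 * N" and ab: "ab \<in> {..<N} \<times> {..<N}" for N q ab
  proof -
    have one: "\<psi> q / N \<le> measure lborel (T y q \<inter> {real a / real N..<(real a + 1) / real N})" if "a < N" for y and a :: nat
    proof -
      have "(real a + 1) / real N \<le> 1" "0 \<le> real a / real N" using that N by (auto simp: field_simps)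
      then have sub: "{real a / real N..<(real a + 1) / real N} \<subseteq> {0..<1}" by auto
      have "ennreal (\<psi> q / N) \<le> (\<integral>\<^sup>+x. indicator {t. near y (\<psi> q) t} (real q * x) * indicator {real a / real N..<(real a + 1) / real N} x \<partial>lborel)"
        using nn_integral_near_ge[OF psi N q, where y = y and a = a] by (simp add: add.commute)
      also have "\<dots> = (\<integral>\<^sup>+x. indicator (T y q \<inter> {real a / real N..<(real a + 1) / real N}) x \<partial>lborel)"
        using sub by (intro nn_integral_cong) (auto simp: T_def indicator_def subset_iff)
      also have "\<dots> = emeasure lborel (T y q \<inter> {real a / real N..<(real a + 1) / real N})" using Ts by simp
      also have "\<dots> = ennreal (measure lborel (T y q \<inter> {real a / real N..<(real a + 1) / real N}))"
      proof (rule emeasure_eq_ennreal_measure)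
        have "bounded (T y q \<inter> {real a / real N..<(real a + 1) / real N})"
          by (rule bounded_subset[OF bounded_closed_interval[of "real a / real N" "(real a + 1) / real N"]]) auto
        then show "emeasure lborel (T y q \<inter> {real a / real N..<(real a + 1) / real N}) \<noteq> top_class.top"
          using emeasure_bounded_finite by fastforce
      qed
      finally show ?thesis by (subst (asm) ennreal_le_iff) auto
    qed
    have "q > 0" using N q by simp
    then have "A q \<inter> cell N ab = (T y1 q \<inter> {real (fst ab) / real N..<(real (fst ab) + 1) / real N}) \<times> (T y2 q \<inter> {real (snd ab) / real N..<(real (snd ab) + 1) / real N})"
      unfolding A_def cell_def by auto
    then have "measure lborel (A q \<inter> cell N ab) = measure lborel (T y1 q \<inter> {real (fst ab) / real N..<(real (fst ab) + 1) / real N})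
        * measure lborel (T y2 q \<inter> {real (snd ab) / real N..<(real (snd ab) + 1) / real N})"
      using Ts by (simp add: measure_plane_Times)
    moreover have "(\<psi> q / N) * (\<psi> q / N) \<le> measure lborel (T y1 q \<inter> {real (fst ab) / real N..<(real (fst ab) + 1) / real N})
        * measure lborel (T y2 q \<inter> {real (snd ab) / real N..<(real (snd ab) + 1) / real N})"
    proof (rule mult_mono)
      have "fst ab < N" "snd ab < N" using ab by auto
      then show "\<psi> q / N \<le> measure lborel (T y1 q \<inter> {real (fst ab) / real N..<(real (fst ab) + 1) / real N})"
        and "\<psi> q / N \<le> measure lborel (T y2 q \<inter> {real (snd ab) / real N..<(real (snd ab) + 1) / real N})"
        using one by blast+
    qed (use psi in simp_all)
    ultimately show ?thesis by (simp add: power2_eq_square)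
  qed
  have "AE x in lborel. x \<in> torus \<longrightarrow> infinite {q. x \<in> A q}"
  proof (rule quasi_independent_limsup_full[OF torus_fmeasurable(1) As AX w(1) _ S, of "\<lambda>n. {..n}"])
    fix Z :: "(real \<times> real) set" assume Z: "Z \<in> sets lborel" "Z \<subseteq> torus" "0 < measure lborel Z"
    define z where "z = measure lborel Z"
    have z: "z > 0" using Z unfolding z_def by simp
    \<comment> \<open>Since \<beta> \<ge> z/4, the constant 1000 is large enough: 48 z^2/1000 is
      below z^2/16.\<close>
    obtain N \<G> where G: "N > 0" "\<G> \<subseteq> {..<N} \<times> {..<N}"
      "measure lborel (\<Union>ab\<in>\<G>. cell N ab) \<ge> z / 2" "measure lborel ((\<Union>ab\<in>\<G>. cell N ab) - Z) < z\<^sup>2 / 1000"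
      using grid_approximation[OF Z, of "z\<^sup>2 / 1000"] z unfolding z_def by auto
    define B where "B = (\<Union>ab\<in>\<G>. cell N ab)"
    \<comment> \<open>The cells give |B| per unit of \<open>S\<close>; half of it is kept and the
      other half absorbs the finitely many q < 2N.\<close>
    define \<beta> where "\<beta> = measure lborel B / 2"
    have \<beta>: "\<beta> > 0" "\<beta> \<ge> z / 4" using G(3) z unfolding \<beta>_def B_def by auto
    have fG: "finite \<G>" using G(2) finite_subset by blast
    have Bs: "B \<in> sets lborel" unfolding B_def using fG cell_borel by auto
    have BT: "B \<subseteq> torus" unfolding B_def using cell_subset_torus G(2) by blast
    have disj: "disjoint_family_on (cell N) \<G>"
      using cell_disjoint[OF G(1)] unfolding disjoint_family_on_def by blast
    have fin: "emeasure lborel (cell N ab) \<noteq> \<infinity>" for ab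
      using emeasure_bounded_finite[OF cell_bounded] by (metis less_irrefl)
    have mB: "measure lborel B = card \<G> / (real N)\<^sup>2"
      unfolding B_def using fG disj cell_borel measure_cell[OF G(1)] fin by (subst measure_finite_Union) auto
    have AB: "(\<psi> q)\<^sup>2 * measure lborel B \<le> measure lborel (A q \<inter> B)" if q: "q \<ge> 2 * N" for q
    proof -
      have "(\<psi> q)\<^sup>2 * measure lborel B = (\<Sum>ab\<in>\<G>. (\<psi> q)\<^sup>2 / (real N)\<^sup>2)" unfolding mB by simp
      also have "\<dots> \<le> (\<Sum>ab\<in>\<G>. measure lborel (A q \<inter> cell N ab))"
        using lower[OF G(1) q] G(2) by (intro sum_mono) blast
      also have "\<dots> = measure lborel (\<Union>ab\<in>\<G>. A q \<inter> cell N ab)"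
      proof (rule measure_finite_Union[symmetric])
        show "disjoint_family_on (\<lambda>ab. A q \<inter> cell N ab) \<G>" using disj unfolding disjoint_family_on_def by blast
        show "emeasure lborel (A q \<inter> cell N ab) \<noteq> \<infinity>" for ab
        proof -
          have "emeasure lborel (A q \<inter> cell N ab) \<le> emeasure lborel (cell N ab)"
            using As cell_borel by (intro emeasure_mono) auto
          then show ?thesis using fin[of ab] by (auto simp: top_unique)
        qed
      qed (use fG As cell_borel in auto)
      also have "(\<Union>ab\<in>\<G>. A q \<inter> cell N ab) = A q \<inter> B" unfolding B_def by auto
      finally show ?thesis .
    qed
    have "48 * measure lborel (B - Z) < \<beta>\<^sup>2"
    proof -
      have "48 * measure lborel (B - Z) < 48 * (z\<^sup>2 / 1000)" using G(4) unfolding B_def by simp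
      also have "\<dots> \<le> (z / 4)\<^sup>2" by (simp add: power2_eq_square)
      also have "\<dots> \<le> \<beta>\<^sup>2" using \<beta> z by (intro power_mono) auto
      finally show ?thesis .
    qed
    moreover have "\<forall>\<^sub>F n in sequentially. \<beta> * S n \<le> (\<Sum>q\<le>n. w q * measure lborel (A q \<inter> B))"
    proof -
      define K where "K = (\<Sum>q<2 * N. w q * (\<psi> q)\<^sup>2) * measure lborel B"
      have "\<forall>\<^sub>F n in sequentially. S n \<ge> K / \<beta>" using S by (simp add: filterlim_at_top)
      then show ?thesis
      proof eventually_elim
        case (elim n)
        have "(2 * \<beta>) * S n = (\<Sum>q\<le>n. w q * (\<psi> q)\<^sup>2 * measure lborel B)"
          unfolding S_def \<beta>_def by (simp add: sum_distrib_left sum_distrib_right ac_simps)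
        also have "\<dots> \<le> (\<Sum>q\<le>n. w q * measure lborel (A q \<inter> B) + (if q < 2 * N then w q * (\<psi> q)\<^sup>2 * measure lborel B else 0))"
        proof (rule sum_mono)
          fix q
          show "w q * (\<psi> q)\<^sup>2 * measure lborel B \<le> w q * measure lborel (A q \<inter> B) + (if q < 2 * N then w q * (\<psi> q)\<^sup>2 * measure lborel B else 0)"
          proof (cases "q < 2 * N")
            case False
            then show ?thesis using mult_left_mono[OF AB w(1), of q] by (simp add: mult.assoc)
          qed (use w in simp)
        qed
        also have "\<dots> = (\<Sum>q\<le>n. w q * measure lborel (A q \<inter> B)) + (\<Sum>q\<in>{..n} \<inter> {..<2 * N}. w q * (\<psi> q)\<^sup>2 * measure lborel B)"
          by (simp add: sum.distrib sum.If_cases Int_def lessThan_def)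
        also have "(\<Sum>q\<in>{..n} \<inter> {..<2 * N}. w q * (\<psi> q)\<^sup>2 * measure lborel B) \<le> K"
          unfolding K_def sum_distrib_right using w by (intro sum_mono2) auto
        also have "K \<le> \<beta> * S n" using elim \<beta> by (simp add: field_simps)
        finally show ?case by simp
      qed
    qed
    moreover have "\<forall>\<^sub>F n in sequentially. (\<Sum>i\<le>n. \<Sum>j\<le>n. w i * w j * measure lborel (A i \<inter> A j)) \<le> 48 * (S n)\<^sup>2"
    proof -
      have "\<forall>\<^sub>F n in sequentially. S n \<ge> 1" using S by (simp add: filterlim_at_top)
      then show ?thesis
      proof eventually_elim
        case (elim n)
        \<comment> \<open>Here 48 = 32 + 16: once S n \<ge> 1, the linear term is dominated by the
          square.\<close>
        then have "S n * 1 \<le> S n * S n" by (intro mult_left_mono) auto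
        then show ?case using second[of n] by (simp add: power2_eq_square)
      qed
    qed
    ultimately show "\<exists>B\<in>sets lborel. B \<subseteq> torus \<and> (\<exists>\<beta>>0. \<exists>C>0.
      C * measure lborel (B - Z) < \<beta>\<^sup>2 \<and>
      (\<forall>\<^sub>F n in sequentially. \<beta> * S n \<le> (\<Sum>i\<le>n. w i * measure lborel (A i \<inter> B))) \<and>
      (\<forall>\<^sub>F n in sequentially. (\<Sum>i\<le>n. \<Sum>j\<le>n. w i * w j * measure lborel (A i \<inter> A j)) \<le> C * (S n)\<^sup>2))"
      using \<beta>(1) Bs BT by (intro bexI[of _ B] conjI exI[of _ \<beta>] exI[of _ "48::real"]) auto
  qed simp
  moreover have "{q. x \<in> A q} = (simultaneous_hits \<psi> y1 y2 x)"
    if "x \<in> torus" for x using that unfolding A_def T_def torus_def by auto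
  ultimately show ?thesis by (auto elim!: eventually_mono)
qed

theorem simultaneous_limsup_full:
  assumes psi: "\<And>q. 0 \<le> \<psi> q" and div: "\<not> summable (\<lambda>q. real (totient q) / real q * (\<psi> q)\<^sup>2)"
  shows "AE x in lborel. x \<in> torus \<longrightarrow>
    infinite (simultaneous_hits \<psi> y1 y2 x)"
proof (cases "infinite {q. \<psi> q > 1 / 2}")
  case True
  then show ?thesis using infinite_simultaneous_hits by simp
next
  case False
  define \<psi>' where "\<psi>' q = (if \<psi> q > 1 / 2 then 0 else \<psi> q)" for q
  have "\<forall>\<^sub>F q in cofinite. \<psi>' q = \<psi> q"
    unfolding eventually_cofinite by (rule finite_subset[of _ "{q. \<psi> q > 1 / 2}"]) (use False in \<open>auto simp: \<psi>'_def\<close>)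
  then have "\<forall>\<^sub>F q in sequentially. real (totient q) / real q * (\<psi>' q)\<^sup>2 = real (totient q) / real q * (\<psi> q)\<^sup>2"
    unfolding cofinite_eq_sequentially by eventually_elim simp
  from summable_cong[OF this] div have "\<not> summable (\<lambda>q. real (totient q) / real q * (\<psi>' q)\<^sup>2)" by simp
  then have "AE x in lborel. x \<in> torus \<longrightarrow>
    infinite (simultaneous_hits \<psi>' y1 y2 x)"
    using psi by (intro simultaneous_limsup_full_small) (auto simp: \<psi>'_def)
  moreover have "simultaneous_hits \<psi>' y1 y2 x \<subseteq> simultaneous_hits \<psi> y1 y2 x" for x :: "real \<times> real"
    by (auto simp: \<psi>'_def near_zero split: if_splits)
  ultimately show ?thesis by (elim eventually_mono) (meson infinite_super)
qed

section \<open>Approximation neighbourhoods as fine pieces\<close>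

text \<open>Every real is within distance 1 of a translate of y, so radii may be truncated at 1.
  After division by q the neighbourhoods then shrink with q, however large the enlarged radius
  is.\<close>

lemma near_min_one: "near y c x \<Longrightarrow> near y (min c 1) x"
  by (cases "c \<le> 1") (auto simp: near_of_half)

text \<open>A sheared rectangle: every slice at a fixed second coordinate is an interval of length
  2w, so Fubini gives the area of the rectangle.\<close>

lemma parallelogram:
  fixes w h t c b :: real
  assumes "w \<ge> 0" "h \<ge> 0"
  defines "S \<equiv> {z :: real \<times> real. \<bar>fst z + t * snd z + c\<bar> < w \<and> \<bar>snd z - b\<bar> < h}"
  shows "open S" "measure lborel S = 4 * w * h" "S \<in> fmeasurable lborel"
proof -
  have "S = {z. \<bar>fst z + t * snd z + c\<bar> < w} \<inter> {z. \<bar>snd z - b\<bar> < h}" unfolding S_def by auto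
  also have "open \<dots>" by (intro open_Int open_Collect_less continuous_intros)
  finally show "open S" .
  then have "(indicator S :: _ \<Rightarrow> ennreal) \<in> borel_measurable (lborel \<Otimes>\<^sub>M lborel)"
    unfolding lborel_prod by (intro borel_measurable_indicator) auto
  note snd = lborel_pair.nn_integral_snd[OF this]
  have "emeasure lborel S = (\<integral>\<^sup>+v. \<integral>\<^sup>+u. indicator S (u, v) \<partial>lborel \<partial>lborel)"
    unfolding snd unfolding lborel_prod using \<open>open S\<close> by simp
  also have "\<dots> = (\<integral>\<^sup>+v. ennreal (2 * w) * indicator {b - h<..<b + h} v \<partial>lborel)"
  proof (intro nn_integral_cong)
    fix v
    have "(\<integral>\<^sup>+u. indicator S (u, v) \<partial>lborel)
        = (\<integral>\<^sup>+u. indicator {- w - t * v - c<..<w - t * v - c} u * indicator {b - h<..<b + h} v \<partial>lborel)"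
      by (intro nn_integral_cong) (auto simp: S_def indicator_def abs_less_iff)
    also have "\<dots> = ennreal (2 * w) * indicator {b - h<..<b + h} v"
      using assms(1) by (subst nn_integral_multc) auto
    finally show "(\<integral>\<^sup>+u. indicator S (u, v) \<partial>lborel) = ennreal (2 * w) * indicator {b - h<..<b + h} v" .
  qed
  also have "\<dots> = ennreal (2 * w) * ennreal (2 * h)"
    using assms(2) by (subst nn_integral_cmult_indicator) auto
  also have "\<dots> = ennreal (4 * w * h)" using assms(1,2) by (simp add: ennreal_mult[symmetric] del: ennreal_numeral)
  finally have e: "emeasure lborel S = ennreal (4 * w * h)" .
  then show "measure lborel S = 4 * w * h" using assms(1,2) by (simp add: measure_def)
  show "S \<in> fmeasurable lborel" using e \<open>open S\<close> by (auto simp: fmeasurable_def)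
qed

lemma dist_plane_le: "dist x z \<le> \<bar>fst x - fst z\<bar> + \<bar>snd x - snd z\<bar>" for x z :: "real \<times> real"
  unfolding dist_prod_def dist_real_def by (rule sqrt_sum_squares_le_sum) auto

lemma coordinate_dist_le: "\<bar>fst x - fst z\<bar> \<le> dist x z" "\<bar>snd x - snd z\<bar> \<le> dist x z" for x z :: "real \<times> real"
  using dist_fst_le[of x z] dist_snd_le[of x z] by (simp_all add: dist_real_def)

text \<open>The piece is a small disc about the centre \<open>a\<close> of the neighbourhood that
  the enlarged radius catches. With r = \<psi>(q)/q, the mass R^2 is of order \<eta> f(r), and
  spread over a disc of radius r/2 it is tested at radius s: for s \<le> r the decay of f(r)/r^2
  gives the bound, for s > r the monotonicity of f. If r/2 exceeds R/4, the disc is capped at radius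
  R/4 and the growth of f(s)/s^2 takes over.\<close>

lemma fine_piece_simultaneous:
  fixes f :: "real \<Rightarrow> real" and \<psi> :: "nat \<Rightarrow> real"
  assumes fpos: "\<And>s. s > 0 \<Longrightarrow> f s > 0"
    and fmono: "\<And>s t. 0 < s \<Longrightarrow> s \<le> t \<Longrightarrow> f s \<le> f t"
    and anti: "\<And>s t. 0 < s \<Longrightarrow> s \<le> t \<Longrightarrow> f t / t\<^sup>2 \<le> f s / s\<^sup>2"
    and flim: "filterlim (\<lambda>s. f s / s\<^sup>2) at_top (at_right 0)"
    and \<eta>: "\<eta> > 0"
    and \<psi>': "\<And>q. \<psi>' q = (if \<psi> q > 0 then real q * sqrt (\<eta> / 16 * f (\<psi> q / real q)) else 0)"
    and inf: "infinite (simultaneous_hits \<psi>' y1 y2 x)"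
  shows "fine_piece f \<eta> {z. \<exists>q\<ge>k. q > 0 \<and> near y1 (\<psi> q) (real q * fst z) \<and> near y2 (\<psi> q) (real q * snd z)} x"
    (is "fine_piece f \<eta> ?U x")
  unfolding fine_piece_def
proof (intro allI impI)
  fix \<delta> :: real assume \<delta>: "\<delta> > 0"
  \<comment> \<open>For the capped disc of radius R/4 the mass R^2 has density 16/\<pi>, so a ball
    of radius s receives at most 16 s^2.\<close>
  have "\<forall>\<^sub>F s in at_right 0. f s / s\<^sup>2 \<ge> 16 / \<eta>" using flim by (simp add: filterlim_at_top)
  then obtain b where b: "b > 0" "\<And>s. 0 < s \<Longrightarrow> s < b \<Longrightarrow> f s / s\<^sup>2 \<ge> 16 / \<eta>"
    unfolding eventually_at_right_field by auto
  have big: "16 * s\<^sup>2 \<le> \<eta> * f s" if "0 < s" "s < b" for s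
    using b(2)[OF that] that \<eta> by (simp add: field_simps)
  define \<epsilon> where "\<epsilon> = min \<delta> b"
  have \<epsilon>: "\<epsilon> > 0" "\<epsilon> \<le> \<delta>" "\<epsilon> \<le> b" unfolding \<epsilon>_def using \<delta> b(1) by auto
  obtain Q :: nat where Q: "2 / \<epsilon> < real Q" using reals_Archimedean2 by blast
  obtain q where q: "q > 0" "near y1 (\<psi>' q) (real q * fst x)" "near y2 (\<psi>' q) (real q * snd x)" "q \<ge> max k Q"
    using inf unfolding infinite_nat_iff_unbounded_le by blast
  have psi: "\<psi> q > 0" using q(2) near_zero[of "\<psi>' q"] \<psi>'[of q] by (cases "\<psi> q > 0") auto
  define r where "r = \<psi> q / real q"
  have r: "r > 0" unfolding r_def using psi q by simp
  define \<rho> where "\<rho> = min (\<psi>' q) 1 / real q"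
  have psi'0: "\<psi>' q > 0" using psi q(1) \<eta> fpos[OF r] unfolding \<psi>' r_def by simp
  have \<rho>: "\<rho> > 0" unfolding \<rho>_def using psi'0 q by simp
  have \<rho>1: "\<rho> \<le> 1 / real q" unfolding \<rho>_def by (intro divide_right_mono) auto
  have \<rho>2: "\<rho>\<^sup>2 \<le> \<eta> / 16 * f r"
  proof -
    have "\<rho> \<le> \<psi>' q / real q" unfolding \<rho>_def by (intro divide_right_mono) auto
    also have "\<dots> = sqrt (\<eta> / 16 * f r)" using psi q unfolding \<psi>' r_def by simp
    finally have "\<rho>\<^sup>2 \<le> (sqrt (\<eta> / 16 * f r))\<^sup>2" using \<rho> by (intro power_mono) auto
    then show ?thesis using \<eta> fpos[OF r] by simp
  qed
  \<comment> \<open>A Euclidean ball of radius 2\<rho> contains the max-norm ball of radius \<rho>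
    in which x lies.\<close>
  define R where "R = 2 * \<rho>"
  have R: "R > 0" "R < \<delta>" "R < b"
  proof -
    have "real q > 2 / \<epsilon>" using q(4) Q by linarith
    then have "2 / real q < \<epsilon>" using \<epsilon>(1) q(1) by (simp add: field_simps)
    moreover have "R \<le> 2 / real q" using \<rho>1 unfolding R_def by simp
    ultimately show "R > 0" "R < \<delta>" "R < b" using \<rho> \<epsilon> unfolding R_def by auto
  qed
  obtain p1 p2 :: int where p: "\<bar>real q * fst x + of_int p1 - y1\<bar> < min (\<psi>' q) 1" "\<bar>real q * snd x + of_int p2 - y2\<bar> < min (\<psi>' q) 1"
    using near_min_one[OF q(2)] near_min_one[OF q(3)] unfolding near_def by blast
  define a where "a = ((y1 - of_int p1) / real q, (y2 - of_int p2) / real q)"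
  have scale: "\<bar>u - (y - of_int p) / real q\<bar> = \<bar>real q * u + of_int p - y\<bar> / real q" for u y and p :: int
  proof -
    have "u - (y - of_int p) / real q = (real q * u + of_int p - y) / real q" using q(1) by (simp add: field_simps)
    then show ?thesis by (simp add: abs_divide)
  qed
  have "\<bar>fst x - fst a\<bar> < \<rho>" "\<bar>snd x - snd a\<bar> < \<rho>"
    unfolding a_def fst_conv snd_conv scale \<rho>_def using p q(1) by (auto intro: divide_strict_right_mono)
  then have xa: "x \<in> cball a R" using dist_plane_le[of x a] unfolding R_def by (simp add: dist_commute)
  \<comment> \<open>The bound r/2 keeps the closure inside the strict inequalities defining the
    neighbourhood, and R/4 keeps it inside the half ball.\<close>
  define r0 where "r0 = min (r / 2) (R / 4)"
  have r0: "r0 > 0" unfolding r0_def using r R by simp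
  define W where "W = ball a r0"
  have mW: "measure lborel W = pi * r0\<^sup>2" unfolding W_def using r0 by (simp add: content_ball_plane)
  show "\<exists>a R W. 0 < R \<and> R < \<delta> \<and> x \<in> cball a R \<and> open W \<and> W \<noteq> {} \<and> closure W \<subseteq> ?U \<inter> ball a (R / 2) \<and>
     (\<forall>z s. 0 < s \<longrightarrow> s < R \<longrightarrow> R\<^sup>2 * measure lborel (W \<inter> ball z s) \<le> \<eta> * f s * measure lborel W)"
  proof (intro exI conjI allI impI)
    show "0 < R" "R < \<delta>" "x \<in> cball a R" by fact+
    show "open W" "W \<noteq> {}" unfolding W_def using r0 by auto
    show "closure W \<subseteq> ?U \<inter> ball a (R / 2)"
    proof
      fix z assume "z \<in> closure W"
      then have z: "dist a z \<le> r0" unfolding W_def using r0 by auto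
      have "\<bar>real q * fst z + of_int p1 - y1\<bar> / real q < \<psi> q / real q" "\<bar>real q * snd z + of_int p2 - y2\<bar> / real q < \<psi> q / real q"
        unfolding scale[symmetric]
        using coordinate_dist_le[of z a] z r0 r unfolding a_def r0_def r_def[symmetric] by (auto simp: dist_commute)
      then have "near y1 (\<psi> q) (real q * fst z)" "near y2 (\<psi> q) (real q * snd z)"
        unfolding near_def using q(1) by (auto simp: divide_less_cancel)
      then have "z \<in> ?U" using q(1,4) by auto
      moreover have "z \<in> ball a (R / 2)" using z R unfolding r0_def by auto
      ultimately show "z \<in> ?U \<inter> ball a (R / 2)" by blast
    qed
    fix z s assume s: "0 < s" "s < R"
    define m where "m = min s r0"
    have "measure lborel (W \<inter> ball z s) \<le> pi * m\<^sup>2"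
    proof (cases "s \<le> r0")
      case True
      have "measure lborel (W \<inter> ball z s) \<le> measure lborel (ball z s)"
        using emeasure_lborel_ball_finite[of z s] unfolding W_def
        by (intro measure_mono_fmeasurable) (auto simp: fmeasurable_def)
      then show ?thesis using True s unfolding m_def by (simp add: content_ball_plane)
    next
      case False
      have "measure lborel (W \<inter> ball z s) \<le> measure lborel W"
        using emeasure_lborel_ball_finite[of a r0] unfolding W_def
        by (intro measure_mono_fmeasurable) (auto simp: fmeasurable_def)
      then show ?thesis using False unfolding m_def mW by simp
    qed
    moreover have key: "R\<^sup>2 * m\<^sup>2 \<le> \<eta> * f s * r0\<^sup>2"
    proof (cases "r / 2 \<le> R / 4")
      case False
      then have r0R: "r0 = R / 4" unfolding r0_def by simp
      have "R\<^sup>2 * m\<^sup>2 \<le> R\<^sup>2 * s\<^sup>2" using s r0 unfolding m_def by (intro mult_left_mono power_mono) auto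
      also have "\<dots> = 16 * s\<^sup>2 * r0\<^sup>2" unfolding r0R by (simp add: power2_eq_square)
      also have "\<dots> \<le> \<eta> * f s * r0\<^sup>2" using big[of s] s R by (intro mult_right_mono) auto
      finally show ?thesis .
    next
      case True
      then have r0r: "r0 = r / 2" unfolding r0_def by simp
      \<comment> \<open>The factor 1/16 in \<psi>' against R^2 = 4 \<rho>^2 leaves 1/4, which
        matches r0^2 = r^2/4.\<close>
      have R2: "R\<^sup>2 \<le> \<eta> / 4 * f r" using \<rho>2 unfolding R_def by (simp add: power2_eq_square)
      show ?thesis
      proof (cases "s \<le> r")
        case True
        have "f r * s\<^sup>2 \<le> f s * r\<^sup>2" using anti[OF s(1) True] s r by (simp add: field_simps)
        have "R\<^sup>2 * m\<^sup>2 \<le> (\<eta> / 4 * f r) * s\<^sup>2"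
          using R2 s r0 \<eta> fpos[OF r] unfolding m_def by (intro mult_mono power_mono) auto
        also have "\<dots> = \<eta> / 4 * (f r * s\<^sup>2)" by simp
        also have "\<dots> \<le> \<eta> / 4 * (f s * r\<^sup>2)" using \<open>f r * s\<^sup>2 \<le> f s * r\<^sup>2\<close> \<eta> by (intro mult_left_mono) auto
        also have "\<dots> = \<eta> * f s * r0\<^sup>2" unfolding r0r by (simp add: power2_eq_square)
        finally show ?thesis .
      next
        case False
        have "R\<^sup>2 * m\<^sup>2 \<le> (\<eta> / 4 * f r) * r0\<^sup>2"
          using R2 s r0 \<eta> fpos[OF r] unfolding m_def by (intro mult_mono power_mono) auto
        also have "\<dots> \<le> (\<eta> * f s) * r0\<^sup>2"
        proof (rule mult_right_mono)
          have "f r \<le> f s" using False r by (intro fmono) auto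
          then have "\<eta> / 4 * f r \<le> \<eta> / 4 * f s" using \<eta> by (intro mult_left_mono) auto
          also have "\<dots> \<le> \<eta> * f s" using \<eta> fpos[OF s(1)] by simp
          finally show "\<eta> / 4 * f r \<le> \<eta> * f s" .
        qed simp
        finally show ?thesis .
      qed
    qed
    ultimately have "R\<^sup>2 * measure lborel (W \<inter> ball z s) \<le> R\<^sup>2 * (pi * m\<^sup>2)" by (intro mult_left_mono) auto
    also have "\<dots> = pi * (R\<^sup>2 * m\<^sup>2)" by simp
    also have "\<dots> \<le> pi * (\<eta> * f s * r0\<^sup>2)" using key by (intro mult_left_mono) auto
    also have "\<dots> = \<eta> * f s * measure lborel W" unfolding mW by simp
    finally show "R\<^sup>2 * measure lborel (W \<inter> ball z s) \<le> \<eta> * f s * measure lborel W" .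
  qed
qed

text \<open>The neighbourhood is a strip about a line, and the piece is a parallelogram cut from it,
  of length of order \<rho> along the line. A ball of radius s meets it in area at most 4 s min(s,
  r0). For s \<le> r this is quadratic in s and the decay of f(r)/r^2 applies; for s > r it is
  linear in s.\<close>

lemma fine_piece_linear_form:
  fixes f :: "real \<Rightarrow> real" and \<psi> :: "nat \<Rightarrow> real"
  assumes fpos: "\<And>s. s > 0 \<Longrightarrow> f s > 0"
    and gmono: "\<And>s t. 0 < s \<Longrightarrow> s \<le> t \<Longrightarrow> f s / s \<le> f t / t"
    and anti: "\<And>s t. 0 < s \<Longrightarrow> s \<le> t \<Longrightarrow> f t / t\<^sup>2 \<le> f s / s\<^sup>2"
    and flim: "filterlim (\<lambda>s. f s / s\<^sup>2) at_top (at_right 0)"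
    and \<eta>: "\<eta> > 0"
    and \<psi>': "\<And>k. \<psi>' k = (if \<psi> k > 0 then real k * (\<eta> / 128 * (f (\<psi> k / real k) / (\<psi> k / real k))) else 0)"
    and inf: "infinite (linear_form_hits \<psi>' y x)"
  shows "fine_piece f \<eta> {z. \<exists>k\<ge>k0. \<exists>j\<in>totatives k. near y (\<psi> k) (real k * fst z + real j * snd z)} x"
    (is "fine_piece f \<eta> ?U x")
  unfolding fine_piece_def
proof (intro allI impI)
  fix \<delta> :: real assume \<delta>: "\<delta> > 0"
  \<comment> \<open>If the width is capped at \<rho>, mass 64 \<rho>^2 lies on area 4 \<rho>^2. The
    density 16 on an area of at most 4 s^2 gives 64 s^2.\<close>
  have "\<forall>\<^sub>F s in at_right 0. f s / s\<^sup>2 \<ge> 64 / \<eta>" using flim by (simp add: filterlim_at_top)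
  then obtain b where b: "b > 0" "\<And>s. 0 < s \<Longrightarrow> s < b \<Longrightarrow> f s / s\<^sup>2 \<ge> 64 / \<eta>"
    unfolding eventually_at_right_field by auto
  have big: "64 * s\<^sup>2 \<le> \<eta> * f s" if "0 < s" "s < b" for s
    using b(2)[OF that] that \<eta> by (simp add: field_simps)
  define \<epsilon> where "\<epsilon> = min \<delta> b"
  have \<epsilon>: "\<epsilon> > 0" "\<epsilon> \<le> \<delta>" "\<epsilon> \<le> b" unfolding \<epsilon>_def using \<delta> b(1) by auto
  obtain Q :: nat where Q: "8 / \<epsilon> < real Q" using reals_Archimedean2 by blast
  \<comment> \<open>Each k has finitely many totatives, so infinitely many hits force k to be
    unbounded.\<close>
  have "\<exists>k j. j \<in> totatives k \<and> near y (\<psi>' k) (real k * fst x + real j * snd x) \<and> k \<ge> max k0 Q"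
  proof (rule ccontr)
    assume no: "\<not> ?thesis"
    have "(linear_form_hits \<psi>' y x) \<subseteq> Sigma {..max k0 Q} totatives"
    proof
      fix i assume "i \<in> (linear_form_hits \<psi>' y x)"
      then obtain k j where i: "i = (k, j)" "j \<in> totatives k" "near y (\<psi>' k) (real k * fst x + real j * snd x)" by blast
      have "\<not> k \<ge> max k0 Q" using no i(2,3) by blast
      then have "k \<le> max k0 Q" by linarith
      then show "i \<in> Sigma {..max k0 Q} totatives" using i by simp
    qed
    then show False using inf by (meson finite_SigmaI finite_atMost finite_subset finite_totatives)
  qed
  then obtain k j where kj: "j \<in> totatives k" "near y (\<psi>' k) (real k * fst x + real j * snd x)" "k \<ge> max k0 Q" by blast
  have jk: "k > 0" "j \<le> k" using kj(1) by (auto simp: totatives_def intro: Nat.gr0I)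
  have psi: "\<psi> k > 0" using kj(2) near_zero[of "\<psi>' k"] \<psi>'[of k] by (cases "\<psi> k > 0") auto
  define r where "r = \<psi> k / real k"
  have r: "r > 0" unfolding r_def using psi jk by simp
  have psi'0: "\<psi>' k > 0" using psi jk \<eta> fpos[OF r] r unfolding \<psi>' r_def by simp
  define \<rho> where "\<rho> = min (\<psi>' k) 1 / real k"
  have \<rho>: "\<rho> > 0" unfolding \<rho>_def using psi'0 jk by simp
  have \<rho>1: "\<rho> \<le> 1 / real k" unfolding \<rho>_def by (intro divide_right_mono) auto
  have \<rho>2: "\<rho> \<le> \<eta> / 128 * (f r / r)"
  proof -
    have "\<rho> \<le> \<psi>' k / real k" unfolding \<rho>_def by (intro divide_right_mono) auto
    also have "\<dots> = \<eta> / 128 * (f r / r)" using psi jk unfolding \<psi>' r_def by simp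
    finally show ?thesis .
  qed
  \<comment> \<open>The closure of the parallelogram reaches at most 3\<rho> from \<open>a\<close>,
    so it fits into the half ball of radius 4\<rho>.\<close>
  define R where "R = 8 * \<rho>"
  have R: "R > 0" "R < \<delta>" "R < b"
  proof -
    have "real k > 8 / \<epsilon>" using kj(3) Q by linarith
    then have "8 / real k < \<epsilon>" using \<epsilon>(1) jk(1) by (simp add: field_simps)
    moreover have "R \<le> 8 / real k" using \<rho>1 unfolding R_def by simp
    ultimately show "R > 0" "R < \<delta>" "R < b" using \<rho> \<epsilon> unfolding R_def by auto
  qed
  obtain p :: int where p: "\<bar>real k * fst x + real j * snd x + of_int p - y\<bar> < min (\<psi>' k) 1"
    using near_min_one[OF kj(2)] unfolding near_def by blast
  \<comment> \<open>The inverse slope of the line. Since j \<le> k it is at most 1, which keeps the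
    parallelogram close to \<open>a\<close>.\<close>
  define t where "t = real j / real k"
  have t: "0 \<le> t" "t \<le> 1" unfolding t_def using jk by auto
  define c where "c = (of_int p - y) / real k"
  have lin: "\<bar>fst z + t * snd z + c\<bar> = \<bar>real k * fst z + real j * snd z + of_int p - y\<bar> / real k" for z
  proof -
    have "fst z + t * snd z + c = (real k * fst z + real j * snd z + of_int p - y) / real k"
      unfolding t_def c_def using jk(1) by (simp add: field_simps)
    then show ?thesis by (simp add: abs_divide)
  qed
  \<comment> \<open>The point of the line fst z + t snd z + c = 0 with the same second coordinate as
    x.\<close>
  define a where "a = (- t * snd x - c, snd x)"
  have "\<bar>fst x + t * snd x + c\<bar> < \<rho>" unfolding lin \<rho>_def using p jk(1) by (intro divide_strict_right_mono) auto
  then have "\<bar>fst x - fst a\<bar> < \<rho>" "snd x = snd a" unfolding a_def by (auto simp: algebra_simps)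
  then have xa: "x \<in> cball a R" using dist_plane_le[of x a] \<rho> unfolding R_def by (simp add: dist_commute)
  define r0 where "r0 = min (r / 2) \<rho>"
  have r0: "r0 > 0" "r0 \<le> \<rho>" unfolding r0_def using r \<rho> by auto
  define W where "W = {z. \<bar>fst z + t * snd z + c\<bar> < r0 \<and> \<bar>snd z - snd a\<bar> < \<rho>}"
  have W: "open W" "measure lborel W = 4 * r0 * \<rho>" "W \<in> fmeasurable lborel"
    unfolding W_def using r0 \<rho> by (intro parallelogram; simp)+
  show "\<exists>a R W. 0 < R \<and> R < \<delta> \<and> x \<in> cball a R \<and> open W \<and> W \<noteq> {} \<and> closure W \<subseteq> ?U \<inter> ball a (R / 2) \<and>
     (\<forall>z s. 0 < s \<longrightarrow> s < R \<longrightarrow> R\<^sup>2 * measure lborel (W \<inter> ball z s) \<le> \<eta> * f s * measure lborel W)"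
  proof (intro exI conjI allI impI)
    show "0 < R" "R < \<delta>" "x \<in> cball a R" "open W" by fact+
    show "W \<noteq> {}" using W(2) r0 \<rho> by auto
    show "closure W \<subseteq> ?U \<inter> ball a (R / 2)"
    proof
      fix z assume "z \<in> closure W"
      moreover have "closure W \<subseteq> {z. \<bar>fst z + t * snd z + c\<bar> \<le> r0} \<inter> {z. \<bar>snd z - snd a\<bar> \<le> \<rho>}"
        unfolding W_def by (intro closure_minimal closed_Int closed_Collect_le continuous_intros) auto
      ultimately have z: "\<bar>fst z + t * snd z + c\<bar> \<le> r0" "\<bar>snd z - snd a\<bar> \<le> \<rho>" by auto
      have "\<bar>real k * fst z + real j * snd z + of_int p - y\<bar> / real k < \<psi> k / real k"
        unfolding lin[symmetric] using z(1) r unfolding r0_def r_def[symmetric] by auto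
      then have "near y (\<psi> k) (real k * fst z + real j * snd z)"
        unfolding near_def using jk(1) by (auto simp: divide_less_cancel)
      then have "z \<in> ?U" using kj(1,3) by auto
      moreover have "z \<in> ball a (R / 2)"
      proof -
        have "fst z - fst a = (fst z + t * snd z + c) - t * (snd z - snd a)" unfolding a_def by (simp add: algebra_simps)
        then have "\<bar>fst z - fst a\<bar> \<le> \<bar>fst z + t * snd z + c\<bar> + \<bar>t * (snd z - snd a)\<bar>" by (metis abs_triangle_ineq4)
        also have "\<bar>t * (snd z - snd a)\<bar> \<le> 1 * \<rho>" unfolding abs_mult using t z(2) by (intro mult_mono) auto
        finally have "dist z a \<le> 3 * \<rho>" using dist_plane_le[of z a] z r0 by linarith
        then show ?thesis using \<rho> unfolding R_def by (simp add: dist_commute)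
      qed
      ultimately show "z \<in> ?U \<inter> ball a (R / 2)" by blast
    qed
    fix z s assume s: "0 < s" "s < R"
    define m where "m = min s r0"
    have m: "0 \<le> m" "m \<le> s" "m \<le> r0" unfolding m_def using s r0 by auto
    have mWs: "measure lborel (W \<inter> ball z s) \<le> 4 * s * m"
    proof (cases "s \<le> r0")
      case True
      have "measure lborel (W \<inter> ball z s) \<le> measure lborel (ball z s)"
        using emeasure_lborel_ball_finite[of z s] W(1)
        by (intro measure_mono_fmeasurable) (auto simp: fmeasurable_def)
      also have "\<dots> = pi * s\<^sup>2" using s by (simp add: content_ball_plane)
      also have "\<dots> \<le> 4 * s\<^sup>2" using pi_less_4 by (intro mult_right_mono) auto
      finally show ?thesis using True unfolding m_def by (simp add: power2_eq_square)
    next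
      case False
      have "measure lborel (W \<inter> ball z s) \<le> measure lborel {w. \<bar>fst w + t * snd w + c\<bar> < r0 \<and> \<bar>snd w - snd z\<bar> < s}"
      proof (rule measure_mono_fmeasurable)
        show "W \<inter> ball z s \<subseteq> {w. \<bar>fst w + t * snd w + c\<bar> < r0 \<and> \<bar>snd w - snd z\<bar> < s}"
        proof
          fix w assume w: "w \<in> W \<inter> ball z s"
          then have "\<bar>snd w - snd z\<bar> < s" using coordinate_dist_le(2)[of w z] by (simp add: dist_commute)
          then show "w \<in> {w. \<bar>fst w + t * snd w + c\<bar> < r0 \<and> \<bar>snd w - snd z\<bar> < s}" using w unfolding W_def by simp
        qed
        show "{w. \<bar>fst w + t * snd w + c\<bar> < r0 \<and> \<bar>snd w - snd z\<bar> < s} \<in> fmeasurable lborel"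
          using r0 s by (intro parallelogram) auto
      qed (use W(1) in auto)
      also have "\<dots> = 4 * r0 * s" using r0 s by (intro parallelogram) auto
      finally show ?thesis using False unfolding m_def by (simp add: mult.commute mult.left_commute)
    qed
    \<comment> \<open>This is the required bound after cancelling 4\<rho> from R^2 = 64 \<rho>^2 and
      |W| = 4 r0 \<rho>. The factor 1/128 in \<psi>' turns 64 into 1/2, which matches r0 =
      r/2.\<close>
    have key: "64 * \<rho> * s * m \<le> \<eta> * f s * r0"
    proof (cases "r / 2 \<le> \<rho>")
      case False
      then have r0\<rho>: "r0 = \<rho>" unfolding r0_def by simp
      have "64 * \<rho> * s * m \<le> 64 * \<rho> * s * s" using m s \<rho> by (intro mult_left_mono) auto
      also have "\<dots> = 64 * s\<^sup>2 * r0" unfolding r0\<rho> by (simp add: power2_eq_square)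
      also have "\<dots> \<le> \<eta> * f s * r0" using big[of s] s R r0 by (intro mult_right_mono) auto
      finally show ?thesis .
    next
      case True
      then have r0r: "r0 = r / 2" unfolding r0_def by simp
      have f0: "f s > 0" using fpos s by auto
      define G where "G = \<eta> / 128 * (f r / r)"
      have G: "0 < G" "\<rho> \<le> G" unfolding G_def using fpos[OF r] r \<eta> \<rho>2 by simp_all
      show ?thesis
      proof (cases "s \<le> r")
        case True
        have "f r * s\<^sup>2 \<le> f s * r\<^sup>2" using anti[OF s(1) True] s r by (simp add: field_simps)
        then have le: "f r / r * s\<^sup>2 \<le> f s * r" using r by (simp add: field_simps power2_eq_square)
        have "64 * \<rho> * s * m \<le> 64 * G * s * s"
          using G m s \<rho> by (intro mult_mono) auto
        also have "\<dots> = \<eta> / 2 * (f r / r * s\<^sup>2)" unfolding G_def by (simp add: power2_eq_square)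
        also have "\<dots> \<le> \<eta> / 2 * (f s * r)" using le \<eta> by (intro mult_left_mono) auto
        also have "\<dots> = \<eta> * f s * r0" unfolding r0r by simp
        finally show ?thesis .
      next
        case False
        \<comment> \<open>Here the ball cuts a length of order s from the strip, so it is the
          monotonicity of g(r) = f(r)/r that is needed.\<close>
        have "f r / r \<le> f s / s" using False r by (intro gmono) auto
        then have le: "f r / r * s \<le> f s" using s by (simp add: field_simps)
        have "64 * \<rho> * s * m \<le> 64 * G * s * r0"
          using G m s \<rho> by (intro mult_mono) auto
        also have "\<dots> = \<eta> / 2 * (f r / r * s) * r0" unfolding G_def by simp
        also have "\<dots> \<le> \<eta> / 2 * f s * r0" using le \<eta> r0 by (intro mult_right_mono mult_left_mono) auto
        also have "\<dots> \<le> \<eta> * f s * r0" using \<eta> r0 f0 by simp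
        finally show ?thesis .
      qed
    qed
    have "R\<^sup>2 * measure lborel (W \<inter> ball z s) \<le> R\<^sup>2 * (4 * s * m)" using mWs by (intro mult_left_mono) auto
    also have "\<dots> = (4 * \<rho>) * (64 * \<rho> * s * m)" unfolding R_def by (simp add: power2_eq_square)
    also have "\<dots> \<le> (4 * \<rho>) * (\<eta> * f s * r0)" using key \<rho> by (intro mult_left_mono) auto
    also have "\<dots> = \<eta> * f s * measure lborel W" unfolding W(2) by simp
    finally show "R\<^sup>2 * measure lborel (W \<inter> ball z s) \<le> \<eta> * f s * measure lborel W" .
  qed
qed

section \<open>Hausdorff measure of the limsup sets\<close>

lemma infinite_of_unbounded_index:
  assumes "\<And>k. \<exists>q\<ge>k. P (q :: nat)"
  shows "infinite {q. P q}"
  unfolding infinite_nat_iff_unbounded_le using assms by blast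

lemma unit_box_plane:
  "box (0, 0) (1, 1) \<subseteq> torus" "torus \<subseteq> cbox (0, 0) (1, 1)" "box (0, 0) (1, 1) \<subseteq> cbox (0, 0) (1 :: real, 1 :: real)"
  "negligible (cbox (0, 0) (1 :: real, 1 :: real) - torus)"
  "measure lborel (box (0, 0) (1 :: real, 1 :: real)) = 1"
proof -
  have mem: "x \<in> box (0, 0) (1, 1) \<longleftrightarrow> 0 < fst x \<and> fst x < 1 \<and> 0 < snd x \<and> snd x < 1"
    "x \<in> cbox (0, 0) (1, 1) \<longleftrightarrow> 0 \<le> fst x \<and> fst x \<le> 1 \<and> 0 \<le> snd x \<and> snd x \<le> 1" for x :: "real \<times> real"
    by (auto simp: mem_box Basis_prod_def inner_prod_def)
  show "box (0, 0) (1, 1) \<subseteq> torus" "torus \<subseteq> cbox (0, 0) (1, 1)" "box (0, 0) (1, 1) \<subseteq> cbox (0, 0) (1 :: real, 1 :: real)"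
    using mem by (auto simp: torus_def)
  show "measure lborel (box (0, 0) (1 :: real, 1 :: real)) = 1"
    by (subst measure_lborel_box) (auto simp: Basis_prod_def inner_prod_def prod.union_disjoint)
  show "negligible (cbox (0, 0) (1 :: real, 1 :: real) - torus)"
    by (rule negligible_subset[OF negligible_frontier_interval[of "(0, 0)" "(1, 1)"]])
      (use \<open>box (0, 0) (1, 1) \<subseteq> torus\<close> in blast)
qed

text \<open>The dichotomy behind both cases, with each hypothesis required only in the branch that
  uses it. If f(r)/r^2 is unbounded on (0,1], it cannot be increasing, for then f(1) would bound it.
  So it decreases, hence tends to infinity at 0, and the decrease also gives the doubling inequality
  f(2s) \<le> 4 f(s).\<close>

lemma hausdorff_fm_full:
  fixes f :: "real \<Rightarrow> real" and U :: "nat \<Rightarrow> (real \<times> real) set"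
  assumes fpos: "\<And>s. s > 0 \<Longrightarrow> f s > 0"
    and fmono: "\<And>s t. 0 < s \<Longrightarrow> s \<le> t \<Longrightarrow> f s \<le> f t"
    and ratio: "mono_on {0<..} (\<lambda>r. f r / r\<^sup>2) \<or> antimono_on {0<..} (\<lambda>r. f r / r\<^sup>2)"
    and F: "F \<subseteq> cbox (0, 0) (1, 1)"
    and bounded: "\<And>C. (\<And>r. 0 < r \<Longrightarrow> r \<le> 1 \<Longrightarrow> f r \<le> C * r\<^sup>2) \<Longrightarrow> AE x in lborel. x \<in> torus \<longrightarrow> x \<in> F"
    and pieces: "\<And>k \<eta>. (\<And>s t. 0 < s \<Longrightarrow> s \<le> t \<Longrightarrow> f t / t\<^sup>2 \<le> f s / s\<^sup>2) \<Longrightarrow>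
        filterlim (\<lambda>s. f s / s\<^sup>2) at_top (at_right 0) \<Longrightarrow> \<eta> > 0 \<Longrightarrow>
        AE x in lborel. x \<in> torus \<longrightarrow> fine_piece f \<eta> (U k) x"
    and FU: "box (0, 0) (1, 1) \<inter> (\<Inter>k. U k) \<subseteq> F"
  shows "hausdorff_fm plane_dist f F = hausdorff_fm plane_dist f (cbox (0, 0) (1, 1))"
proof (rule antisym)
  show "hausdorff_fm plane_dist f F \<le> hausdorff_fm plane_dist f (cbox (0, 0) (1, 1))"
    using F by (rule hausdorff_fm_mono)
  show "hausdorff_fm plane_dist f (cbox (0, 0) (1, 1)) \<le> hausdorff_fm plane_dist f F"
  proof (cases "\<exists>C. \<forall>r. 0 < r \<longrightarrow> r \<le> 1 \<longrightarrow> f r \<le> C * r\<^sup>2")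
    case True
    then obtain C where C: "\<And>r. 0 < r \<Longrightarrow> r \<le> 1 \<Longrightarrow> f r \<le> C * r\<^sup>2" by blast
    define N where "N = cbox (0, 0) (1, 1) - F"
    \<comment> \<open>Passing to the completion encloses the exceptional set in a Lebesgue null set,
      which sidesteps the measurability of \<open>F\<close>.\<close>
    have "AE x in lebesgue. x \<in> torus \<longrightarrow> x \<in> F"
      using bounded[OF C] by (rule AE_completion)
    then obtain N' where N': "N' \<in> null_sets lebesgue" "{x \<in> space lebesgue. \<not> (x \<in> torus \<longrightarrow> x \<in> F)} \<subseteq> N'"
      unfolding eventually_ae_filter by blast
    then have "negligible N'" by (simp add: negligible_iff_null_sets)
    then have "negligible ((cbox (0, 0) (1, 1) - torus) \<union> N')" using unit_box_plane(4) by (rule negligible_Un[rotated])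
    then have neg: "negligible N" by (rule negligible_subset) (use N'(2) in \<open>auto simp: N_def\<close>)
    have "hausdorff_fm plane_dist f N = 0"
      using C neg by (rule hausdorff_fm_null_set) (auto simp: N_def)
    moreover have "hausdorff_fm plane_dist f (F \<union> N) \<le> hausdorff_fm plane_dist f F + hausdorff_fm plane_dist f N"
      by (rule hausdorff_fm_subadditive)
    moreover have "F \<union> N = cbox (0, 0) (1, 1)" using F unfolding N_def by auto
    ultimately show ?thesis by simp
  next
    case False
    have "\<not> mono_on {0<..} (\<lambda>r. f r / r\<^sup>2)"
    proof
      assume "mono_on {0<..} (\<lambda>r. f r / r\<^sup>2)"
      then have "f r / r\<^sup>2 \<le> f 1 / 1\<^sup>2" if "0 < r" "r \<le> 1" for r using that by (auto dest!: mono_onD[of _ _ r 1])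
      then have "\<forall>r. 0 < r \<longrightarrow> r \<le> 1 \<longrightarrow> f r \<le> f 1 * r\<^sup>2" by (auto simp: field_simps)
      then show False using False by blast
    qed
    then have am: "antimono_on {0<..} (\<lambda>r. f r / r\<^sup>2)" using ratio by blast
    have anti: "f t / t\<^sup>2 \<le> f s / s\<^sup>2" if "0 < s" "s \<le> t" for s t
      using monotone_onD[OF am, of s t] that by auto
    have lim: "filterlim (\<lambda>s. f s / s\<^sup>2) at_top (at_right 0)"
      unfolding filterlim_at_top
    proof
      fix K
      obtain r where r: "0 < r" "f r > K * r\<^sup>2" using False by (meson not_le)
      have "K \<le> f s / s\<^sup>2" if "0 < s" "s < r" for s
      proof -
        have "K \<le> f r / r\<^sup>2" using r by (simp add: field_simps)
        also have "\<dots> \<le> f s / s\<^sup>2" using that by (intro anti) auto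
        finally show ?thesis .
      qed
      then show "\<forall>\<^sub>F s in at_right 0. K \<le> f s / s\<^sup>2" using r(1) unfolding eventually_at_right_field by blast
    qed
    have double: "f (2 * s) \<le> 4 * f s" if "s > 0" for s
      using anti[of s "2 * s"] that by (simp add: field_simps)
    have "hausdorff_fm plane_dist f (box (0, 0) (1, 1) \<inter> (\<Inter>k. U k)) = \<infinity>"
    proof (rule mass_transference[OF fpos fmono double lim plane_dist_ball_subset])
      show "AE x in lborel. x \<in> box (0, 0) (1, 1) \<longrightarrow> fine_piece f \<eta> (U k) x" if "\<eta> > 0" for k \<eta>
        using pieces[OF anti lim that, of k] unit_box_plane(1) by (auto elim!: eventually_mono)
    qed (auto simp: unit_box_plane(5) bounded_box)
    moreover have "hausdorff_fm plane_dist f (box (0, 0) (1, 1) \<inter> (\<Inter>k. U k)) \<le> hausdorff_fm plane_dist f F"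
      using FU by (rule hausdorff_fm_mono)
    ultimately show ?thesis by (simp add: top_unique)
  qed
qed

lemma not_summable_mono:
  fixes a b :: "nat \<Rightarrow> real"
  assumes "\<not> summable a" "c > 0" "\<And>n. 0 \<le> a n" "\<forall>\<^sub>F n in sequentially. c * a n \<le> b n"
  shows "\<not> summable b"
proof
  assume "summable b"
  then have "summable (\<lambda>n. c * a n)"
    using assms(2,3,4) by (intro summable_comparison_test_ev[of "\<lambda>n. c * a n" b]) (auto elim!: eventually_mono)
  then show False using assms(1,2) by (simp add: summable_cmult_iff)
qed

text \<open>Both branches use the same full measure theorem: for \<psi> itself when f(r) \<le> C
  r^2, and for the enlarged radius \<psi>' when f(r)/r^2 tends to infinity.\<close>

theorem simultaneous_hausdorff:
  fixes f :: "real \<Rightarrow> real" and \<psi> :: "nat \<Rightarrow> real" and y1 y2 :: real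
  assumes fpos: "\<And>s. s > 0 \<Longrightarrow> f s > 0"
    and fmono: "\<And>s t. 0 < s \<Longrightarrow> s \<le> t \<Longrightarrow> f s \<le> f t"
    and ratio: "mono_on {0<..} (\<lambda>r. f r / r\<^sup>2) \<or> antimono_on {0<..} (\<lambda>r. f r / r\<^sup>2)"
    and psi: "\<And>q. 0 \<le> \<psi> q"
    and div: "\<not> summable (\<lambda>q. real (totient q) / real q * (real q)\<^sup>2 * (if \<psi> q > 0 then f (\<psi> q / real q) else 0))"
  defines "F \<equiv> {x \<in> cbox (0, 0) (1, 1). infinite (simultaneous_hits \<psi> y1 y2 x)}"
  shows "hausdorff_fm plane_dist f F = hausdorff_fm plane_dist f (cbox (0, 0) (1, 1))"
proof (cases "infinite {q. \<psi> q > 1 / 2}")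
  case True
  then show ?thesis unfolding F_def using infinite_simultaneous_hits by simp
next
  case small: False
  define T where "T q = real (totient q) / real q * (real q)\<^sup>2 * (if \<psi> q > 0 then f (\<psi> q / real q) else 0)" for q
  have T0: "T q \<ge> 0" for q unfolding T_def using fpos[of "\<psi> q / real q"] by (cases "q = 0") auto
  have Tdiv: "\<not> summable T" using div unfolding T_def .
  define U where "U k = {z :: real \<times> real. \<exists>q\<ge>k. q > 0 \<and> near y1 (\<psi> q) (real q * fst z) \<and> near y2 (\<psi> q) (real q * snd z)}" for k
  show ?thesis
  proof (rule hausdorff_fm_full[OF fpos fmono ratio, where U = U])
    show "F \<subseteq> cbox (0, 0) (1, 1)" unfolding F_def by auto
    show "box (0, 0) (1, 1) \<inter> (\<Inter>k. U k) \<subseteq> F"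
    proof
      fix x assume x: "x \<in> box (0, 0) (1, 1) \<inter> (\<Inter>k. U k)"
      have "infinite (simultaneous_hits \<psi> y1 y2 x)"
        by (rule infinite_of_unbounded_index) (use x in \<open>auto simp: U_def\<close>)
      then show "x \<in> F" using x unit_box_plane(3) unfolding F_def by blast
    qed
  next
    fix C assume C: "\<And>r. 0 < r \<Longrightarrow> r \<le> 1 \<Longrightarrow> f r \<le> C * r\<^sup>2"
    have C0: "C > 0" using C[of 1] fpos[of 1] by simp
    have "\<forall>\<^sub>F q in cofinite. \<not> \<psi> q > 1 / 2" using small by (simp add: eventually_cofinite)
    \<comment> \<open>Eventually \<psi>(q)/q \<le> 1, the range in which f(r) \<le> C r^2 is
      available.\<close>
    then have ev: "\<forall>\<^sub>F q in sequentially. \<psi> q \<le> 1 / 2" by (simp add: cofinite_eq_sequentially not_less)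
    have "\<not> summable (\<lambda>q. real (totient q) / real q * (\<psi> q)\<^sup>2)"
    proof (rule not_summable_mono[OF Tdiv _ T0])
      show "1 / C > 0" using C0 by simp
      show "\<forall>\<^sub>F q in sequentially. 1 / C * T q \<le> real (totient q) / real q * (\<psi> q)\<^sup>2"
        using ev eventually_gt_at_top[of 0]
      proof eventually_elim
        case (elim q)
        show ?case
        proof (cases "\<psi> q > 0")
          case True
          have "\<psi> q / real q \<le> 1" using elim by (simp add: divide_le_eq_1)
          then have "f (\<psi> q / real q) \<le> C * (\<psi> q / real q)\<^sup>2" using True elim by (intro C) auto
          then have "(real q)\<^sup>2 * f (\<psi> q / real q) \<le> C * (\<psi> q)\<^sup>2" using elim by (simp add: field_simps power_divide)
          then have "real (totient q) / real q * ((real q)\<^sup>2 * f (\<psi> q / real q)) \<le> real (totient q) / real q * (C * (\<psi> q)\<^sup>2)"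
            by (intro mult_left_mono) auto
          then have "T q \<le> C * (real (totient q) / real q * (\<psi> q)\<^sup>2)" unfolding T_def using True by (simp add: algebra_simps)
          then show ?thesis using C0 by (simp add: field_simps)
        qed (simp add: T_def)
      qed
    qed
    from simultaneous_limsup_full[OF psi this, of y1 y2]
    show "AE x in lborel. x \<in> torus \<longrightarrow> x \<in> F"
      using unit_box_plane(2) unfolding F_def by (auto elim!: eventually_mono)
  next
    fix k \<eta> assume anti: "\<And>s t. 0 < s \<Longrightarrow> s \<le> t \<Longrightarrow> f t / t\<^sup>2 \<le> f s / s\<^sup>2"
      and lim: "filterlim (\<lambda>s. f s / s\<^sup>2) at_top (at_right 0)" and \<eta>: "(\<eta> :: real) > 0"
    \<comment> \<open>Squaring gives \<phi>(q)/q \<psi>'(q)^2 = (\<eta>/16) T(q), so the enlarged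
      series diverges for every \<eta> > 0.\<close>
    define \<psi>' where "\<psi>' q = (if \<psi> q > 0 then real q * sqrt (\<eta> / 16 * f (\<psi> q / real q)) else 0)" for q
    have psi'0: "\<psi>' q \<ge> 0" for q unfolding \<psi>'_def using fpos[of "\<psi> q / real q"] \<eta> by (cases "q = 0") auto
    have "\<not> summable (\<lambda>q. real (totient q) / real q * (\<psi>' q)\<^sup>2)"
    proof (rule not_summable_mono[OF Tdiv _ T0])
      show "\<eta> / 16 > 0" using \<eta> by simp
      have "\<eta> / 16 * T q \<le> real (totient q) / real q * (\<psi>' q)\<^sup>2" for q
      proof (cases "\<psi> q > 0 \<and> q > 0")
        case True
        then have sq: "(\<psi>' q)\<^sup>2 = (real q)\<^sup>2 * (\<eta> / 16 * f (\<psi> q / real q))"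
          unfolding \<psi>'_def using fpos[of "\<psi> q / real q"] \<eta> by (simp add: power_mult_distrib)
        show ?thesis unfolding T_def sq using True by (simp add: algebra_simps)
      qed (auto simp: T_def)
      then show "\<forall>\<^sub>F q in sequentially. \<eta> / 16 * T q \<le> real (totient q) / real q * (\<psi>' q)\<^sup>2" by simp
    qed
    from simultaneous_limsup_full[OF psi'0 this, of y1 y2]
    show "AE x in lborel. x \<in> torus \<longrightarrow> fine_piece f \<eta> (U k) x"
    proof eventually_elim
      case (elim x)
      show ?case unfolding U_def
        using elim fine_piece_simultaneous[OF fpos fmono anti lim \<eta> \<psi>'_def, of y1 x y2 k] by blast
    qed
  qed
qed

theorem linear_form_hausdorff:
  fixes f :: "real \<Rightarrow> real" and \<psi> :: "nat \<Rightarrow> real" and y :: real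
  assumes fpos: "\<And>s. s > 0 \<Longrightarrow> f s > 0"
    and fmono: "\<And>s t. 0 < s \<Longrightarrow> s \<le> t \<Longrightarrow> f s \<le> f t"
    and gmono: "\<And>s t. 0 < s \<Longrightarrow> s \<le> t \<Longrightarrow> f s / s \<le> f t / t"
    and ratio: "mono_on {0<..} (\<lambda>r. f r / r\<^sup>2) \<or> antimono_on {0<..} (\<lambda>r. f r / r\<^sup>2)"
    and psi: "\<And>q. 0 \<le> \<psi> q"
    and div: "\<not> summable (\<lambda>q. real (totient q) / real q * (real q)\<^sup>2 * (if \<psi> q > 0 then f (\<psi> q / real q) / (\<psi> q / real q) else 0))"
  defines "F \<equiv> {x \<in> cbox (0, 0) (1, 1). infinite (linear_form_hits \<psi> y x)}"
  shows "hausdorff_fm plane_dist f F = hausdorff_fm plane_dist f (cbox (0, 0) (1, 1))"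
proof (cases "infinite {q. \<psi> q > 1 / 2}")
  case True
  then show ?thesis unfolding F_def using infinite_linear_form_hits by simp
next
  case small: False
  define T where "T q = real (totient q) / real q * (real q)\<^sup>2 * (if \<psi> q > 0 then f (\<psi> q / real q) / (\<psi> q / real q) else 0)" for q
  have T0: "T q \<ge> 0" for q unfolding T_def using fpos[of "\<psi> q / real q"] by (cases "q = 0") auto
  have Tdiv: "\<not> summable T" using div unfolding T_def .
  define U where "U k0 = {z :: real \<times> real. \<exists>k\<ge>k0. \<exists>j\<in>totatives k. near y (\<psi> k) (real k * fst z + real j * snd z)}" for k0
  show ?thesis
  proof (rule hausdorff_fm_full[OF fpos fmono ratio, where U = U])
    show "F \<subseteq> cbox (0, 0) (1, 1)" unfolding F_def by auto
    show "box (0, 0) (1, 1) \<inter> (\<Inter>k. U k) \<subseteq> F"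
    proof
      fix x assume x: "x \<in> box (0, 0) (1, 1) \<inter> (\<Inter>k. U k)"
      define E where "E = (linear_form_hits \<psi> y x)"
      \<comment> \<open>Infinitely many first components already force infinitely many
        pairs.\<close>
      have "infinite {k. \<exists>j\<in>totatives k. near y (\<psi> k) (real k * fst x + real j * snd x)}"
        by (rule infinite_of_unbounded_index) (use x in \<open>auto simp: U_def\<close>)
      also have "{k. \<exists>j\<in>totatives k. near y (\<psi> k) (real k * fst x + real j * snd x)} = fst ` E"
        unfolding E_def by force
      finally have "infinite E" using finite_imageI[of E fst] by blast
      then show "x \<in> F" using x unit_box_plane(3) unfolding F_def E_def by blast
    qed
  next
    fix C assume C: "\<And>r. 0 < r \<Longrightarrow> r \<le> 1 \<Longrightarrow> f r \<le> C * r\<^sup>2"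
    have C0: "C > 0" using C[of 1] fpos[of 1] by simp
    have "\<forall>\<^sub>F q in cofinite. \<not> \<psi> q > 1 / 2" using small by (simp add: eventually_cofinite)
    then have ev: "\<forall>\<^sub>F q in sequentially. \<psi> q \<le> 1 / 2" by (simp add: cofinite_eq_sequentially not_less)
    have "\<not> summable (\<lambda>q. real (totient q) * \<psi> q)"
    proof (rule not_summable_mono[OF Tdiv _ T0])
      show "1 / C > 0" using C0 by simp
      show "\<forall>\<^sub>F q in sequentially. 1 / C * T q \<le> real (totient q) * \<psi> q"
        using ev eventually_gt_at_top[of 0]
      proof eventually_elim
        case (elim q)
        show ?case
        proof (cases "\<psi> q > 0")
          case True
          define r where "r = \<psi> q / real q"
          have r: "r > 0" "r \<le> 1" unfolding r_def using elim True by (simp_all add: divide_le_eq_1)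
          have "f r / r \<le> C * r" using C[OF r] r by (simp add: field_simps power2_eq_square)
          then have "real q * (f r / r) \<le> real q * (C * r)" by (intro mult_left_mono) auto
          also have "\<dots> = C * \<psi> q" unfolding r_def using elim by simp
          finally have "real (totient q) * (real q * (f r / r)) \<le> real (totient q) * (C * \<psi> q)"
            by (intro mult_left_mono) auto
          moreover have "T q = real (totient q) * (real q * (f r / r))"
            unfolding T_def r_def using True elim by (simp add: power2_eq_square)
          ultimately have "T q \<le> C * (real (totient q) * \<psi> q)" by (simp only: mult.left_commute)
          then show ?thesis using C0 by (simp add: field_simps)
        qed (simp add: T_def psi)
      qed
    qed
    from linear_form_limsup_full[OF psi this, of y]
    show "AE x in lborel. x \<in> torus \<longrightarrow> x \<in> F"
      using unit_box_plane(2) unfolding F_def by (auto elim!: eventually_mono)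
  next
    fix k \<eta> assume anti: "\<And>s t. 0 < s \<Longrightarrow> s \<le> t \<Longrightarrow> f t / t\<^sup>2 \<le> f s / s\<^sup>2"
      and lim: "filterlim (\<lambda>s. f s / s\<^sup>2) at_top (at_right 0)" and \<eta>: "(\<eta> :: real) > 0"
    \<comment> \<open>The radius enters the measure of a strip linearly, so no root is taken:
      \<phi>(q) \<psi>'(q) = (\<eta>/128) T(q).\<close>
    define \<psi>' where "\<psi>' q = (if \<psi> q > 0 then real q * (\<eta> / 128 * (f (\<psi> q / real q) / (\<psi> q / real q))) else 0)" for q
    have psi'0: "\<psi>' q \<ge> 0" for q unfolding \<psi>'_def using fpos[of "\<psi> q / real q"] \<eta> by (cases "q = 0") auto
    have "\<not> summable (\<lambda>q. real (totient q) * \<psi>' q)"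
    proof (rule not_summable_mono[OF Tdiv _ T0])
      show "\<eta> / 128 > 0" using \<eta> by simp
      have "\<eta> / 128 * T q \<le> real (totient q) * \<psi>' q" for q
        by (cases "q = 0") (simp_all add: T_def \<psi>'_def power2_eq_square mult.commute mult.left_commute)
      then show "\<forall>\<^sub>F q in sequentially. \<eta> / 128 * T q \<le> real (totient q) * \<psi>' q" by simp
    qed
    from linear_form_limsup_full[OF psi'0 this, of y]
    show "AE x in lborel. x \<in> torus \<longrightarrow> fine_piece f \<eta> (U k) x"
    proof eventually_elim
      case (elim x)
      show ?case unfolding U_def
        using elim fine_piece_linear_form[OF fpos gmono anti lim \<eta> \<psi>'_def, of y x k] by blast
    qed
  qed
qed

section \<open>Transfer to matrices\<close>

lemma totient_ratio_powr_le:
  assumes "\<epsilon> > 0"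
  shows "(real (totient q) / real q) powr (1 + \<epsilon>) \<le> real (totient q) / real q"
proof -
  have t: "0 \<le> real (totient q) / real q" "real (totient q) / real q \<le> 1"
    using totient_le[of q] by (auto simp: divide_le_eq_1)
  have "(real (totient q) / real q) powr (1 + \<epsilon>) \<le> (real (totient q) / real q) powr 1"
    using assms t by (intro powr_mono') auto
  then show ?thesis using t(1) by simp
qed

text \<open>An inclusion of the image of \<open>F\<close> in \<open>A_set\<close> is enough:
  \<open>A_set\<close> lies in the cube, so its measure is squeezed between two equal
  values.\<close>

lemma A_set_transfer:
  fixes \<Phi> :: "real \<times> real \<Rightarrow> real^'m^'n" and y :: "real^'m"
  assumes "bij \<Phi>" "\<And>x z. maxdist (\<Phi> x) (\<Phi> z) = plane_dist x z"
    and "\<Phi> ` cbox (0, 0) (1, 1) = unit_cube" and "\<Phi> ` F \<subseteq> A_set \<psi> y"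
    and "hausdorff_fm plane_dist f F = hausdorff_fm plane_dist f (cbox (0, 0) (1, 1))"
  shows "hausdorff_fm maxdist f (A_set \<psi> y :: (real^'m^'n) set) = hausdorff_fm maxdist f (unit_cube :: (real^'m^'n) set)"
proof (rule antisym)
  note tr = hausdorff_fm_bij[where d = maxdist and d' = plane_dist and f = f, OF assms(1,2)]
  show "hausdorff_fm maxdist f (A_set \<psi> y :: (real^'m^'n) set) \<le> hausdorff_fm maxdist f (unit_cube :: (real^'m^'n) set)"
    by (rule hausdorff_fm_mono) (auto simp: A_set_def)
  have "hausdorff_fm maxdist f (unit_cube :: (real^'m^'n) set) = hausdorff_fm maxdist f (\<Phi> ` F)"
    unfolding assms(3)[symmetric] tr using assms(5) by simp
  also have "\<dots> \<le> hausdorff_fm maxdist f (A_set \<psi> y :: (real^'m^'n) set)" by (rule hausdorff_fm_mono) fact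
  finally show "hausdorff_fm maxdist f (unit_cube :: (real^'m^'n) set) \<le> hausdorff_fm maxdist f (A_set \<psi> y :: (real^'m^'n) set)" .
qed

lemma mem_cbox_unit: "x \<in> cbox (0, 0) (1, 1) \<longleftrightarrow> 0 \<le> fst x \<and> fst x \<le> 1 \<and> 0 \<le> snd x \<and> snd x \<le> (1 :: real)"
  for x :: "real \<times> real" by (auto simp: mem_box Basis_prod_def inner_prod_def)

text \<open>The finite index types carry no preferred elements, so these are first named by
  enumerating \<open>UNIV\<close>; this also decides which entry of y belongs to which coordinate.
  Positive q suffice, as each of them yields a solution of its own.\<close>

lemma simultaneous_embedding:
  fixes y :: "real^'m" and \<psi> :: "nat \<Rightarrow> real"
  assumes "CARD('n) = 1" "CARD('m) = 2"
  obtains \<Phi> :: "real \<times> real \<Rightarrow> real^'m^'n" and y1 y2 where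
    "bij \<Phi>" "\<And>x z. maxdist (\<Phi> x) (\<Phi> z) = plane_dist x z" "\<Phi> ` cbox (0, 0) (1, 1) = unit_cube"
    "\<Phi> ` {x \<in> cbox (0, 0) (1, 1). infinite (simultaneous_hits \<psi> y1 y2 x)} \<subseteq> A_set \<psi> y"
proof -
  obtain i0 :: 'n where i0: "UNIV = {i0}" using assms(1) by (auto simp: card_1_singleton_iff)
  obtain j1 j2 :: 'm where j: "UNIV = {j1, j2}" "j1 \<noteq> j2" using assms(2) by (auto simp: card_2_iff)
  have i_eq: "i = i0" for i using i0 by auto
  have j_cases: "j = j1 \<or> j = j2" for j using j(1) by auto
  define \<Phi> :: "real \<times> real \<Rightarrow> real^'m^'n" where "\<Phi> x = (\<chi> i j. if j = j1 then fst x else snd x)" for x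
  have \<Phi>: "\<Phi> x $ i $ j1 = fst x" "\<Phi> x $ i $ j2 = snd x" for x i unfolding \<Phi>_def using j(2) by auto
  have surj: "\<exists>x. \<Phi> x = A" for A
  proof
    show "\<Phi> (A $ i0 $ j1, A $ i0 $ j2) = A"
    proof (unfold vec_eq_iff, intro allI)
      fix i j
      show "\<Phi> (A $ i0 $ j1, A $ i0 $ j2) $ i $ j = A $ i $ j"
        unfolding i_eq[of i] using j_cases[of j] by (auto simp: \<Phi>)
    qed
  qed
  show ?thesis
  proof (rule that[of \<Phi> "y $ j1" "y $ j2"])
    have inj: "inj \<Phi>" by (rule injI) (metis \<Phi> prod_eqI)
    show "bij \<Phi>"
    proof (rule bijI[OF inj])
      show "surj \<Phi>" using surj by (metis surjI)
    qed
    show "maxdist (\<Phi> x) (\<Phi> z) = plane_dist x z" for x z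
    proof -
      have "range (\<lambda>(i, j). \<bar>\<Phi> x $ i $ j - \<Phi> z $ i $ j\<bar>) = {\<bar>fst x - fst z\<bar>, \<bar>snd x - snd z\<bar>}"
        unfolding UNIV_Times_UNIV[symmetric] i0 j(1) using \<Phi> by auto
      then show ?thesis unfolding maxdist_def plane_dist_def by simp
    qed
    have cube: "\<Phi> x \<in> unit_cube \<longleftrightarrow> x \<in> cbox (0, 0) (1, 1)" for x
    proof
      assume "\<Phi> x \<in> unit_cube"
      then have "0 \<le> \<Phi> x $ i0 $ j1 \<and> \<Phi> x $ i0 $ j1 \<le> 1" "0 \<le> \<Phi> x $ i0 $ j2 \<and> \<Phi> x $ i0 $ j2 \<le> 1"
        unfolding unit_cube_def by blast+
      then show "x \<in> cbox (0, 0) (1, 1)" by (simp add: \<Phi> mem_cbox_unit)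
    next
      assume x: "x \<in> cbox (0, 0) (1, 1)"
      have "0 \<le> \<Phi> x $ i $ j \<and> \<Phi> x $ i $ j \<le> 1" for i j
        using x j_cases[of j] by (auto simp: \<Phi> mem_cbox_unit)
      then show "\<Phi> x \<in> unit_cube" unfolding unit_cube_def by blast
    qed
    show "\<Phi> ` cbox (0, 0) (1, 1) = unit_cube"
    proof (rule Set.set_eqI)
      fix A
      obtain x where A: "\<Phi> x = A" using surj by blast
      have "A \<in> \<Phi> ` cbox (0, 0) (1, 1) \<longleftrightarrow> x \<in> cbox (0, 0) (1, 1)"
        unfolding A[symmetric] using inj by (rule inj_image_mem_iff)
      then show "A \<in> \<Phi> ` cbox (0, 0) (1, 1) \<longleftrightarrow> A \<in> unit_cube" using cube[of x] A by simp
    qed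
    show "\<Phi> ` {x \<in> cbox (0, 0) (1, 1). infinite (simultaneous_hits \<psi> (y $ j1) (y $ j2) x)} \<subseteq> A_set \<psi> y"
    proof (rule image_subsetI)
      fix x assume x: "x \<in> {x \<in> cbox (0, 0) (1, 1). infinite (simultaneous_hits \<psi> (y $ j1) (y $ j2) x)}"
      define E where "E = (simultaneous_hits \<psi> (y $ j1) (y $ j2) x)"
      have E: "infinite E" using x unfolding E_def by simp
      define v :: "nat \<Rightarrow> int^'n" where "v q = (\<chi> i. int q)" for q
      have "\<exists>p :: int^'m. \<forall>j. \<bar>rowmul (v q) (\<Phi> x) $ j + of_int (p $ j) - y $ j\<bar> < \<psi> (qnorm (v q))" if q: "q \<in> E" for q
      proof -
        obtain p1 p2 :: int where p: "\<bar>real q * fst x + of_int p1 - y $ j1\<bar> < \<psi> q" "\<bar>real q * snd x + of_int p2 - y $ j2\<bar> < \<psi> q"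
          using q unfolding E_def near_def by blast
        have qn: "qnorm (v q) = q" unfolding qnorm_def i0 v_def by simp
        have rm: "rowmul (v q) (\<Phi> x) $ j = real q * \<Phi> x $ i0 $ j" for j unfolding rowmul_def i0 v_def by simp
        show ?thesis
        proof (intro exI[of _ "\<chi> j. if j = j1 then p1 else p2"] allI)
          fix j
          show "\<bar>rowmul (v q) (\<Phi> x) $ j + of_int ((\<chi> j. if j = j1 then p1 else p2) $ j) - y $ j\<bar> < \<psi> (qnorm (v q))"
            using p j_cases[of j] j(2) unfolding qn rm by (auto simp: \<Phi>)
        qed
      qed
      then obtain P where P: "\<And>q. q \<in> E \<Longrightarrow> \<forall>j. \<bar>rowmul (v q) (\<Phi> x) $ j + of_int ((P q :: int^'m) $ j) - y $ j\<bar> < \<psi> (qnorm (v q))" by metis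
      \<comment> \<open>The second component alone separates different q, whichever translates
        \<open>P q\<close> were chosen.\<close>
      have "inj_on (\<lambda>q. (P q, v q)) E" by (rule inj_onI) (auto simp: v_def vec_eq_iff)
      then have "infinite ((\<lambda>q. (P q, v q)) ` E)" using E by (simp add: finite_image_iff)
      moreover have "(\<lambda>q. (P q, v q)) ` E \<subseteq> {(p :: int^'m, q :: int^'n). q \<noteq> 0 \<and>
        (\<forall>j. \<bar>rowmul q (\<Phi> x) $ j + of_int (p $ j) - y $ j\<bar> < \<psi> (qnorm q))}"
      proof (rule image_subsetI)
        fix q assume q: "q \<in> E"
        have "v q \<noteq> 0" using q unfolding v_def vec_eq_iff E_def by auto
        then show "(P q, v q) \<in> {(p :: int^'m, q :: int^'n). q \<noteq> 0 \<and>
          (\<forall>j. \<bar>rowmul q (\<Phi> x) $ j + of_int (p $ j) - y $ j\<bar> < \<psi> (qnorm q))}" using P[OF q] by simp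
      qed
      ultimately have "infinite {(p :: int^'m, q :: int^'n). q \<noteq> 0 \<and>
        (\<forall>j. \<bar>rowmul q (\<Phi> x) $ j + of_int (p $ j) - y $ j\<bar> < \<psi> (qnorm q))}" by (rule infinite_super[rotated])
      then show "\<Phi> x \<in> A_set \<psi> y" using x cube unfolding A_set_def by blast
    qed
  qed
qed

text \<open>The max norm of the integer vector must equal k, the argument of \<psi> in
  \<open>linear_form_hits\<close>; the restriction to j \<le> k there ensures this. Distinct pairs
  give distinct integer vectors, so infinitude is preserved.\<close>

lemma linear_form_embedding:
  fixes y :: "real^'m" and \<psi> :: "nat \<Rightarrow> real"
  assumes "CARD('n) = 2" "CARD('m) = 1"
  obtains \<Phi> :: "real \<times> real \<Rightarrow> real^'m^'n" and y0 where
    "bij \<Phi>" "\<And>x z. maxdist (\<Phi> x) (\<Phi> z) = plane_dist x z" "\<Phi> ` cbox (0, 0) (1, 1) = unit_cube"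
    "\<Phi> ` {x \<in> cbox (0, 0) (1, 1). infinite (linear_form_hits \<psi> y0 x)} \<subseteq> A_set \<psi> y"
proof -
  obtain j0 :: 'm where j0: "UNIV = {j0}" using assms(2) by (auto simp: card_1_singleton_iff)
  obtain i1 i2 :: 'n where i: "UNIV = {i1, i2}" "i1 \<noteq> i2" using assms(1) by (auto simp: card_2_iff)
  have j_eq: "j = j0" for j using j0 by auto
  have i_cases: "k = i1 \<or> k = i2" for k using i(1) by auto
  define \<Phi> :: "real \<times> real \<Rightarrow> real^'m^'n" where "\<Phi> x = (\<chi> i j. if i = i1 then fst x else snd x)" for x
  have \<Phi>: "\<Phi> x $ i1 $ j = fst x" "\<Phi> x $ i2 $ j = snd x" for x j unfolding \<Phi>_def using i(2) by auto
  have surj: "\<exists>x. \<Phi> x = A" for A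
  proof
    show "\<Phi> (A $ i1 $ j0, A $ i2 $ j0) = A"
    proof (unfold vec_eq_iff, intro allI)
      fix i j
      show "\<Phi> (A $ i1 $ j0, A $ i2 $ j0) $ i $ j = A $ i $ j"
        unfolding j_eq[of j] using i_cases[of i] by (auto simp: \<Phi>)
    qed
  qed
  show ?thesis
  proof (rule that[of \<Phi> "y $ j0"])
    have inj: "inj \<Phi>" by (rule injI) (metis \<Phi> prod_eqI)
    show "bij \<Phi>"
    proof (rule bijI[OF inj])
      show "surj \<Phi>" using surj by (metis surjI)
    qed
    show "maxdist (\<Phi> x) (\<Phi> z) = plane_dist x z" for x z
    proof -
      have "range (\<lambda>(i, j). \<bar>\<Phi> x $ i $ j - \<Phi> z $ i $ j\<bar>) = {\<bar>fst x - fst z\<bar>, \<bar>snd x - snd z\<bar>}"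
        unfolding UNIV_Times_UNIV[symmetric] j0 i(1) using \<Phi> by auto
      then show ?thesis unfolding maxdist_def plane_dist_def by simp
    qed
    have cube: "\<Phi> x \<in> unit_cube \<longleftrightarrow> x \<in> cbox (0, 0) (1, 1)" for x
    proof
      assume "\<Phi> x \<in> unit_cube"
      then have "0 \<le> \<Phi> x $ i1 $ j0 \<and> \<Phi> x $ i1 $ j0 \<le> 1" "0 \<le> \<Phi> x $ i2 $ j0 \<and> \<Phi> x $ i2 $ j0 \<le> 1"
        unfolding unit_cube_def by blast+
      then show "x \<in> cbox (0, 0) (1, 1)" by (simp add: \<Phi> mem_cbox_unit)
    next
      assume x: "x \<in> cbox (0, 0) (1, 1)"
      have "0 \<le> \<Phi> x $ i $ j \<and> \<Phi> x $ i $ j \<le> 1" for i j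
        using x i_cases[of i] by (auto simp: \<Phi> mem_cbox_unit)
      then show "\<Phi> x \<in> unit_cube" unfolding unit_cube_def by blast
    qed
    show "\<Phi> ` cbox (0, 0) (1, 1) = unit_cube"
    proof (rule Set.set_eqI)
      fix A
      obtain x where A: "\<Phi> x = A" using surj by blast
      have "A \<in> \<Phi> ` cbox (0, 0) (1, 1) \<longleftrightarrow> x \<in> cbox (0, 0) (1, 1)"
        unfolding A[symmetric] using inj by (rule inj_image_mem_iff)
      then show "A \<in> \<Phi> ` cbox (0, 0) (1, 1) \<longleftrightarrow> A \<in> unit_cube" using cube[of x] A by simp
    qed
    show "\<Phi> ` {x \<in> cbox (0, 0) (1, 1). infinite (linear_form_hits \<psi> (y $ j0) x)} \<subseteq> A_set \<psi> y"
    proof (rule image_subsetI)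
      fix x assume x: "x \<in> {x \<in> cbox (0, 0) (1, 1). infinite (linear_form_hits \<psi> (y $ j0) x)}"
      define E where "E = (linear_form_hits \<psi> (y $ j0) x)"
      have E: "infinite E" using x unfolding E_def by simp
      define v :: "nat \<times> nat \<Rightarrow> int^'n" where "v kj = (\<chi> i. if i = i1 then int (fst kj) else int (snd kj))" for kj
      have v: "v kj $ i1 = int (fst kj)" "v kj $ i2 = int (snd kj)" for kj unfolding v_def using i(2) by auto
      have "\<exists>p :: int^'m. \<forall>j. \<bar>rowmul (v kj) (\<Phi> x) $ j + of_int (p $ j) - y $ j\<bar> < \<psi> (qnorm (v kj))" if kj: "kj \<in> E" for kj
      proof -
        obtain p :: int where p: "\<bar>real (fst kj) * fst x + real (snd kj) * snd x + of_int p - y $ j0\<bar> < \<psi> (fst kj)"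
          using kj unfolding E_def near_def by auto
        have "snd kj \<le> fst kj" using kj totatives_le unfolding E_def by auto
        then have qn: "qnorm (v kj) = fst kj" unfolding qnorm_def i(1) by (simp add: v)
        have rm: "rowmul (v kj) (\<Phi> x) $ j = real (fst kj) * fst x + real (snd kj) * snd x" for j
          unfolding rowmul_def i(1) using i(2) by (simp add: v \<Phi>)
        show ?thesis
        proof (intro exI[of _ "\<chi> j. p"] allI)
          fix j
          show "\<bar>rowmul (v kj) (\<Phi> x) $ j + of_int ((\<chi> j. p) $ j) - y $ j\<bar> < \<psi> (qnorm (v kj))"
            using p j_eq[of j] unfolding qn rm by simp
        qed
      qed
      then obtain P where P: "\<And>kj. kj \<in> E \<Longrightarrow> \<forall>j. \<bar>rowmul (v kj) (\<Phi> x) $ j + of_int ((P kj :: int^'m) $ j) - y $ j\<bar> < \<psi> (qnorm (v kj))" by metis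
      have "inj_on (\<lambda>kj. (P kj, v kj)) E"
      proof (rule inj_onI)
        fix a b assume "(P a, v a) = (P b, v b)"
        then have "v a $ i1 = v b $ i1" "v a $ i2 = v b $ i2" by auto
        then show "a = b" unfolding v by (simp add: prod_eq_iff)
      qed
      then have "infinite ((\<lambda>kj. (P kj, v kj)) ` E)" using E by (simp add: finite_image_iff)
      moreover have "(\<lambda>kj. (P kj, v kj)) ` E \<subseteq> {(p :: int^'m, q :: int^'n). q \<noteq> 0 \<and>
        (\<forall>j. \<bar>rowmul q (\<Phi> x) $ j + of_int (p $ j) - y $ j\<bar> < \<psi> (qnorm q))}"
      proof (rule image_subsetI)
        fix kj assume kj: "kj \<in> E"
        have "snd kj > 0" using kj unfolding E_def totatives_def by auto
        then have "v kj $ i2 \<noteq> 0" unfolding v by simp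
        then have "v kj \<noteq> 0" by (metis zero_index)
        then show "(P kj, v kj) \<in> {(p :: int^'m, q :: int^'n). q \<noteq> 0 \<and>
          (\<forall>j. \<bar>rowmul q (\<Phi> x) $ j + of_int (p $ j) - y $ j\<bar> < \<psi> (qnorm q))}" using P[OF kj] by simp
      qed
      ultimately have "infinite {(p :: int^'m, q :: int^'n). q \<noteq> 0 \<and>
        (\<forall>j. \<bar>rowmul q (\<Phi> x) $ j + of_int (p $ j) - y $ j\<bar> < \<psi> (qnorm q))}" by (rule infinite_super[rotated])
      then show "\<Phi> x \<in> A_set \<psi> y" using x cube unfolding A_set_def by blast
    qed
  qed
qed

theorem theorem6:
  fixes \<epsilon> :: real and f g :: "real \<Rightarrow> real" and \<psi> :: "nat \<Rightarrow> real" and y :: "real^'m"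
  assumes eps: "\<epsilon> > 0"
    and nm: "CARD('n) * CARD('m) = 2"
    and f_dim: "dimension_function f"
    and g_def: "\<forall>r>0. g r = r powr (- real (CARD('m) * (CARD('n) - 1))) * f r"
    and g_dim: "dimension_function g"
    and mono: "mono_on {0<..} (\<lambda>r. r powr (- real (CARD('n) * CARD('m))) * f r)
             \<or> antimono_on {0<..} (\<lambda>r. r powr (- real (CARD('n) * CARD('m))) * f r)"
    and psi_nonneg: "\<forall>q. \<psi> q \<ge> 0"
    and y_unit: "\<forall>j. 0 \<le> y$j \<and> y$j \<le> 1"
    and diverge: "\<not> summable (\<lambda>q::nat. if q = 0 then 0 else
          (real (totient q) / real q) powr (1 + \<epsilon>) * real q ^ (CARD('n) + CARD('m) - 1) *
          (if \<psi> q > 0 then g (\<psi> q / real q) else 0))"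
  shows "hausdorff_fm maxdist f (A_set \<psi> y :: (real^'m^'n) set)
         = hausdorff_fm maxdist f (unit_cube :: (real^'m^'n) set)"
proof -
  have fpos: "f s > 0" if "s > 0" for s using f_dim that unfolding dimension_function_def by simp
  have fmono: "f s \<le> f t" if "0 < s" "s \<le> t" for s t
  proof -
    have "mono_on {0<..} f" using f_dim unfolding dimension_function_def by simp
    then show ?thesis by (rule mono_onD) (use that in auto)
  qed
  have gpos: "g s > 0" if "s > 0" for s using g_dim that unfolding dimension_function_def by simp
  have gmono: "g s \<le> g t" if "0 < s" "s \<le> t" for s t
  proof -
    have "mono_on {0<..} g" using g_dim unfolding dimension_function_def by simp
    then show ?thesis by (rule mono_onD) (use that in auto)
  qed
  have psi: "0 \<le> \<psi> q" for q using psi_nonneg by simp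
  have pw: "r powr (- real (CARD('n) * CARD('m))) * f r = f r / r\<^sup>2" if "r > 0" for r
    unfolding nm using that by (simp add: powr_minus powr_numeral field_simps)
  have ratio: "mono_on {0<..} (\<lambda>r. f r / r\<^sup>2) \<or> antimono_on {0<..} (\<lambda>r. f r / r\<^sup>2)"
    using mono pw by (simp add: monotone_on_def)
  have cards: "CARD('n) = 1 \<and> CARD('m) = 2 \<or> CARD('n) = 2 \<and> CARD('m) = 1"
  proof -
    have "CARD('n) dvd 2" using nm by (metis dvd_triv_left)
    then have "CARD('n) \<le> 2" by (rule dvd_imp_le) simp
    then have "CARD('n) = 1 \<or> CARD('n) = 2" using zero_less_card_finite[where 'a = 'n] by linarith
    then show ?thesis using nm by auto
  qed
  have expn: "CARD('n) + CARD('m) - 1 = 2" using cards by auto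
  \<comment> \<open>The guard at q = 0 disappears here, since the factor q^2 vanishes there anyway.
    The exponent n + m - 1 is 2 in both cases, so one series serves for both.\<close>
  have div: "\<not> summable (\<lambda>q. real (totient q) / real q * (real q)\<^sup>2 * (if \<psi> q > 0 then g (\<psi> q / real q) else 0))"
  proof (rule not_summable_mono[OF diverge, of 1])
    have "(if q = 0 then 0 else (real (totient q) / real q) powr (1 + \<epsilon>) * real q ^ (CARD('n) + CARD('m) - 1) *
          (if \<psi> q > 0 then g (\<psi> q / real q) else 0))
       \<le> real (totient q) / real q * (real q)\<^sup>2 * (if \<psi> q > 0 then g (\<psi> q / real q) else 0)" for q
    proof (cases "q = 0")
      case False
      have "0 \<le> (if \<psi> q > 0 then g (\<psi> q / real q) else 0)" using gpos[of "\<psi> q / real q"] False by auto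
      then have "(real (totient q) / real q) powr (1 + \<epsilon>) * (real q)\<^sup>2 * (if \<psi> q > 0 then g (\<psi> q / real q) else 0)
          \<le> real (totient q) / real q * (real q)\<^sup>2 * (if \<psi> q > 0 then g (\<psi> q / real q) else 0)"
        using totient_ratio_powr_le[OF eps, of q] by (intro mult_right_mono) auto
      then show ?thesis unfolding expn using False by (simp only: if_False)
    qed simp
    then show "\<forall>\<^sub>F q in sequentially. 1 * (if q = 0 then 0 else (real (totient q) / real q) powr (1 + \<epsilon>) * real q ^ (CARD('n) + CARD('m) - 1) *
          (if \<psi> q > 0 then g (\<psi> q / real q) else 0))
       \<le> real (totient q) / real q * (real q)\<^sup>2 * (if \<psi> q > 0 then g (\<psi> q / real q) else 0)" by simp
    show "0 \<le> (if q = 0 then 0 else (real (totient q) / real q) powr (1 + \<epsilon>) * real q ^ (CARD('n) + CARD('m) - 1) *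
          (if \<psi> q > 0 then g (\<psi> q / real q) else 0))" for q
      using gpos[of "\<psi> q / real q"] by auto
  qed simp
  from cards show ?thesis
  proof
    assume c: "CARD('n) = 1 \<and> CARD('m) = 2"
    \<comment> \<open>For n = 1 the exponent m (n - 1) is 0.\<close>
    have gf: "g r = f r" if "r > 0" for r using g_def that c by simp
    have "(if \<psi> q > 0 then g (\<psi> q / real q) else 0) = (if \<psi> q > 0 then f (\<psi> q / real q) else 0)" if "q > 0" for q
      using gf that by simp
    then have "real (totient q) / real q * (real q)\<^sup>2 * (if \<psi> q > 0 then g (\<psi> q / real q) else 0)
        = real (totient q) / real q * (real q)\<^sup>2 * (if \<psi> q > 0 then f (\<psi> q / real q) else 0)" for q
      by (cases "q = 0") auto
    with div have "\<not> summable (\<lambda>q. real (totient q) / real q * (real q)\<^sup>2 * (if \<psi> q > 0 then f (\<psi> q / real q) else 0))"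
      by (simp only: not_False_eq_True)
    note H = simultaneous_hausdorff[OF fpos fmono ratio psi this]
    obtain \<Phi> :: "real \<times> real \<Rightarrow> real^'m^'n" and y1 y2 where
      "bij \<Phi>" "\<And>x z. maxdist (\<Phi> x) (\<Phi> z) = plane_dist x z" "\<Phi> ` cbox (0, 0) (1, 1) = unit_cube"
      "\<Phi> ` {x \<in> cbox (0, 0) (1, 1). infinite (simultaneous_hits \<psi> y1 y2 x)} \<subseteq> A_set \<psi> y"
      by (rule simultaneous_embedding[where y = y and \<psi> = \<psi>]) (use c in auto)
    from A_set_transfer[OF this H] show ?thesis .
  next
    assume c: "CARD('n) = 2 \<and> CARD('m) = 1"
    \<comment> \<open>For n = 2 and m = 1 the exponent m (n - 1) is 1, so the monotonicity of g is
      that of f(r)/r.\<close>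
    have gf: "g r = f r / r" if "r > 0" for r
      using g_def that c by (simp add: powr_minus divide_inverse mult.commute)
    have gmono': "f s / s \<le> f t / t" if "0 < s" "s \<le> t" for s t
      using gmono[OF that] gf that by simp
    have "(if \<psi> q > 0 then g (\<psi> q / real q) else 0) = (if \<psi> q > 0 then f (\<psi> q / real q) / (\<psi> q / real q) else 0)" if "q > 0" for q
      using gf that by simp
    then have "real (totient q) / real q * (real q)\<^sup>2 * (if \<psi> q > 0 then g (\<psi> q / real q) else 0)
        = real (totient q) / real q * (real q)\<^sup>2 * (if \<psi> q > 0 then f (\<psi> q / real q) / (\<psi> q / real q) else 0)" for q
      by (cases "q = 0") auto
    with div have "\<not> summable (\<lambda>q. real (totient q) / real q * (real q)\<^sup>2 * (if \<psi> q > 0 then f (\<psi> q / real q) / (\<psi> q / real q) else 0))"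
      by (simp only: not_False_eq_True)
    note H = linear_form_hausdorff[OF fpos fmono gmono' ratio psi this]
    obtain \<Phi> :: "real \<times> real \<Rightarrow> real^'m^'n" and y0 where
      "bij \<Phi>" "\<And>x z. maxdist (\<Phi> x) (\<Phi> z) = plane_dist x z" "\<Phi> ` cbox (0, 0) (1, 1) = unit_cube"
      "\<Phi> ` {x \<in> cbox (0, 0) (1, 1). infinite (linear_form_hits \<psi> y0 x)} \<subseteq> A_set \<psi> y"
      by (rule linear_form_embedding[where y = y and \<psi> = \<psi>]) (use c in auto)
    from A_set_transfer[OF this H] show ?thesis .
  qed
qed

end
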